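(* Let $n\geq 3$, let $\alpha=(\alpha_1,\ldots,\alpha_n)$ be a generic $n$-tuple of positive real numbers, let $X=X(\alpha)$ be the associated hyperpolygon space, and let $S\subseteq\{1,\ldots,n\}$ be a short subset with $|S|\geq 2$. Then the core component $U_S\subseteq X$ is homeomorphic to the moduli space of $(n+1)$-tuples of vectors $$\{u_i,v_j,w\in\mathbb{R}^3\mid i\in S,\ j\in S^c\},$$ taken up to rotation (i.e. modulo the simultaneous action of $SO(3)$ on all the vectors), satisfying the following conditions: 1. $w+\sum_{j\in S^c}v_j=0$; 2. $\sum_{i\in S}u_i=0$; 3. $u_i\cdot w=0$ for all $i\in S$; 4. $\|v_j\|=\alpha_j$ for all $j\in S^c$; 5. $\|w\|=\sum_{i\in S}\sqrt{\alpha_i^2+\|u_i\|^2}$.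
   Context: Generic: there is no subset $S\subseteq\{1,\ldots,n\}$ with $\sum_{i\in S}\alpha_i=\sum_{j\in S^c}\alpha_j$, where $S^c=\{1,\ldots,n\}\setminus S$. A subset $S$ is short if $\sum_{i\in S}\alpha_i<\sum_{j\in S^c}\alpha_j$, and long otherwise. Groups and action: $G=\big(SL(2,\mathbb{C})\times(\mathbb{C}^* )^n\big)/\mathbb{Z}_2$, with $\mathbb{Z}_2$ acting by multiplying every factor by $-1$; $K=\big(SU(2)\times U(1)^n\big)/\mathbb{Z}_2\subseteq G$. Points of $T^*\mathbb{C}^{2n}$ are written $(p,q)$, where $q=(q_1,\ldots,q_n)$ is an $n$-tuple of column vectors in $\mathbb{C}^2$ and $p=(p_1,\ldots,p_n)$ is an $n$-tuple of row vectors in $\mathbb{C}^2$. $G$ acts on the right by $(p,q)[A;e_1,\ldots,e_n]=\big((e_1^{-1}p_1A,\ldots,e_n^{-1}p_nA),(A^{-1}q_1e_1,\ldots,A^{-1}q_ne_n)\big)$. With $(\cdot)_0$ denoting traceless part: $\mu_{\mathbb{R}}(p,q)=\alpha$ iff $\sum_i(q_iq_i^*-p_i^*p_i)_0=0$ and $\frac12(|q_i|^2-|p_i|^2)=\alpha_i$ for all $i$; $\mu_{\mathbb{C}}(p,q)=0$ iff $\sum_i(q_ip_i)_0=0$ and $p_iq_i=0$ for all $i$. Straight: $S$ is straight in $(p,q)$ if $q_i$ is proportional to $q_j$ for all $i,j\in S$. Stability: $(p,q)$ is $\alpha$-stable iff (1) $q_i\neq0$ for all $i$, and (2) whenever a subset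 $S$ is straight in $(p,q)$ and $p_j=0$ for all $j\in S^c$, then $S$ is short. The hyperpolygon space is $X=X(\alpha)=\big(\mu_{\mathbb{R}}^{-1}(\alpha)\cap\mu_{\mathbb{C}}^{-1}(0)\big)/K\cong\mu_{\mathbb{C}}^{-1}(0)^{\alpha\text{-st}}/G$ (the two quotients being identified via the inclusion of level sets); $[p,q]$ denotes the $G$-orbit of $(p,q)\in\mu_{\mathbb{C}}^{-1}(0)^{\alpha\text{-st}}$. $\mathbb{C}^*$ acts on $X$ by $\lambda\cdot[p,q]=[\lambda p,q]$. For a short subset $S$ with $|S|\geq2$, let $X_S=\{[p,q]\in X\mid S\text{ and }S^c\text{ are each straight, and }p_j=0\text{ for all }j\in S^c\}$, and let $U_S$ be the closure in $X$ of $\{[p,q]\in X\mid \lim_{\lambda\to\infty}\lambda\cdot[p,q]\in X_S\}$. *)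

theory Defs
  imports "HOL-Analysis.Analysis"
begin

section \<open>Quotient topologies\<close>

definition quotient_topology :: "'a topology \<Rightarrow> ('a \<Rightarrow> 'b) \<Rightarrow> 'b topology" where
  "quotient_topology X f =
     topology (\<lambda>U. U \<subseteq> f ` topspace X \<and> openin X {x \<in> topspace X. f x \<in> U})"

lemma openin_quotient_topology:
  "openin (quotient_topology X f) U \<longleftrightarrow>
     U \<subseteq> f ` topspace X \<and> openin X {x \<in> topspace X. f x \<in> U}"
proof -
  have "istopology (\<lambda>U. U \<subseteq> f ` topspace X \<and> openin X {x \<in> topspace X. f x \<in> U})"
    unfolding istopology_def
  proof (intro conjI allI impI)
    fix U V
    assume U: "U \<subseteq> f ` topspace X \<and> openin X {x \<in> topspace X. f x \<in> U}"
      and V: "V \<subseteq> f ` topspace X \<and> openin X {x \<in> topspace X. f x \<in> V}"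
    have *: "{x \<in> topspace X. f x \<in> U \<inter> V} =
        {x \<in> topspace X. f x \<in> U} \<inter> {x \<in> topspace X. f x \<in> V}"
      by blast
    show "openin X {x \<in> topspace X. f x \<in> U \<inter> V}"
      unfolding * by (rule openin_Int[OF conjunct2[OF U] conjunct2[OF V]])
    show "U \<inter> V \<subseteq> f ` topspace X" using conjunct1[OF U] by blast
  next
    fix \<K>
    assume K: "\<forall>U\<in>\<K>. U \<subseteq> f ` topspace X \<and> openin X {x \<in> topspace X. f x \<in> U}"
    have *: "{x \<in> topspace X. f x \<in> \<Union>\<K>} = \<Union> ((\<lambda>U. {x \<in> topspace X. f x \<in> U}) ` \<K>)"
      by blast
    show "openin X {x \<in> topspace X. f x \<in> \<Union>\<K>}"
      unfolding * by (rule openin_Union) (use K in blast)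
    show "\<Union>\<K> \<subseteq> f ` topspace X" using K by blast
  qed
  then show ?thesis
    by (simp add: quotient_topology_def)
qed

lemma topspace_quotient_topology: "topspace (quotient_topology X f) = f ` topspace X"
proof (rule antisym)
  show "topspace (quotient_topology X f) \<subseteq> f ` topspace X"
    using openin_topspace[of "quotient_topology X f"] unfolding openin_quotient_topology by (rule conjunct1)
  have "{x \<in> topspace X. f x \<in> f ` topspace X} = topspace X"
    by auto
  then have "openin (quotient_topology X f) (f ` topspace X)"
    by (simp add: openin_quotient_topology)
  then show "f ` topspace X \<subseteq> topspace (quotient_topology X f)"
    by (rule openin_subset)
qed

lemma quotient_map_quotient_topology: "quotient_map X (quotient_topology X f) f"
  by (simp add: quotient_map_def topspace_quotient_topology openin_quotient_topology)


section \<open>The group actions\<close>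

text \<open>
  The index set \<open>{1, \<dots>, n}\<close> is the finite type \<^typ>\<open>'n\<close>.  A point \<open>(p, q)\<close> of
  the cotangent bundle consists of an \<open>n\<close>-tuple \<open>p\<close> of row vectors and an \<open>n\<close>-tuple \<open>q\<close> of
  column vectors; both kinds of vector have type \<^typ>\<open>complex ^ 2\<close>, rows being multiplied
  by matrices from the right (\<open>v*\<close>) and columns from the left (\<open>*v\<close>).
\<close>

type_synonym 'n point = "(complex ^ 2 ^ 'n) \<times> (complex ^ 2 ^ 'n)"

definition act ::
    "complex ^ 2 ^ 2 \<Rightarrow> complex ^ 'n \<Rightarrow> 'n::finite point \<Rightarrow> 'n point" where
  "act A e = (\<lambda>(p, q).
     (\<chi> i. inverse (e $ i) *s (p $ i v* A),
      \<chi> i. e $ i *s (matrix_inv A *v (q $ i))))"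

definition adjoint_matrix :: "complex ^ 2 ^ 2 \<Rightarrow> complex ^ 2 ^ 2" where
  "adjoint_matrix A = (\<chi> i j. cnj (A $ j $ i))"

definition SL2 :: "(complex ^ 2 ^ 2) set" where
  "SL2 = {A. det A = 1}"

definition SU2 :: "(complex ^ 2 ^ 2) set" where
  "SU2 = {A. A ** adjoint_matrix A = mat 1 \<and> adjoint_matrix A ** A = mat 1 \<and> det A = 1}"

text \<open>
  The element \<open>-1\<close> of \<open>\<int>\<^sub>2\<close> acts trivially (\<open>act_minus\<close> below), so the orbits of
  \<open>G = (SL(2,\<complex>) \<times> (\<complex>\<^sup>*)\<^sup>n) / \<int>\<^sub>2\<close> are those of \<open>SL(2,\<complex>) \<times> (\<complex>\<^sup>*)\<^sup>n\<close>, and the orbits of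
  \<open>K = (SU(2) \<times> U(1)\<^sup>n) / \<int>\<^sub>2\<close> are those of \<open>SU(2) \<times> U(1)\<^sup>n\<close>.
\<close>

definition G_orbit :: "'n::finite point \<Rightarrow> 'n point set" where
  "G_orbit x = {act A e x | A e. A \<in> SL2 \<and> (\<forall>i. e $ i \<noteq> 0)}"

definition K_orbit :: "'n::finite point \<Rightarrow> 'n point set" where
  "K_orbit x = {act A e x | A e. A \<in> SU2 \<and> (\<forall>i. cmod (e $ i) = 1)}"

lemma act_minus:
  assumes "A \<in> SL2"
  shows "act (- A) (- e) x = act A e x"
proof -
  have mneg: "(- X) ** (- Y) = X ** Y" for X Y :: "complex ^ 2 ^ 2"
    by (simp add: matrix_matrix_mult_def)
  have inv: "X ** matrix_inv X = mat 1 \<and> matrix_inv X ** X = mat 1"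
    if "invertible X" for X :: "complex ^ 2 ^ 2"
    using that unfolding invertible_def matrix_inv_def by (rule someI_ex)
  have A: "A ** matrix_inv A = mat 1 \<and> matrix_inv A ** A = mat 1"
    using assms by (intro inv) (simp add: SL2_def invertible_det_nz)
  then have "(- A) ** (- matrix_inv A) = mat 1" "(- matrix_inv A) ** (- A) = mat 1"
    by (simp_all add: mneg)
  then have r: "(- A) ** (- matrix_inv A) = mat 1" and "invertible (- A)"
    unfolding invertible_def by blast+
  then have l: "matrix_inv (- A) ** (- A) = mat 1"
    using inv by blast
  have "matrix_inv (- A) = matrix_inv (- A) ** ((- A) ** (- matrix_inv A))"
    by (simp only: r matrix_mul_rid)
  also have "\<dots> = - matrix_inv A"
    by (simp only: matrix_mul_assoc l matrix_mul_lid)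
  finally have "matrix_inv (- A) = - matrix_inv A" .
  then show ?thesis
    by (simp add: act_def split_def vec_eq_iff vector_matrix_mult_def matrix_vector_mult_def
        sum_negf)
qed


section \<open>Moment maps\<close>

definition traceless :: "complex ^ 2 ^ 2 \<Rightarrow> complex ^ 2 ^ 2" where
  "traceless M = M - mat (trace M / 2)"

text \<open>The matrix product of the column \<open>q\<close> with the row \<open>p\<close>.\<close>

definition col_row :: "complex ^ 2 \<Rightarrow> complex ^ 2 \<Rightarrow> complex ^ 2 ^ 2" where
  "col_row q p = (\<chi> a b. q $ a * p $ b)"

text \<open>The matrix product of the row \<open>p\<close> with the column \<open>q\<close> (no conjugation is involved).\<close>

definition row_col :: "complex ^ 2 \<Rightarrow> complex ^ 2 \<Rightarrow> complex" where
  "row_col p q = (\<Sum>a\<in>UNIV. p $ a * q $ a)"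

text \<open>The conjugate transpose, turning columns into rows and vice versa.\<close>

definition vec_star :: "complex ^ 2 \<Rightarrow> complex ^ 2" where
  "vec_star x = (\<chi> a. cnj (x $ a))"

definition mu_R_level :: "('n::finite \<Rightarrow> real) \<Rightarrow> 'n point set" where
  "mu_R_level \<alpha> = {(p, q).
     (\<Sum>i\<in>UNIV. traceless (col_row (q $ i) (vec_star (q $ i))
                          - col_row (vec_star (p $ i)) (p $ i))) = 0 \<and>
     (\<forall>i. (1/2) * ((norm (q $ i))\<^sup>2 - (norm (p $ i))\<^sup>2) = \<alpha> i)}"

definition mu_C_zero :: "'n::finite point set" where
  "mu_C_zero = {(p, q).
     (\<Sum>i\<in>UNIV. traceless (col_row (q $ i) (p $ i))) = 0 \<and>
     (\<forall>i. row_col (p $ i) (q $ i) = 0)}"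


section \<open>Stability and the hyperpolygon space\<close>

definition generic :: "('n::finite \<Rightarrow> real) \<Rightarrow> bool" where
  "generic \<alpha> \<longleftrightarrow> \<not> (\<exists>S. (\<Sum>i\<in>S. \<alpha> i) = (\<Sum>j\<in>-S. \<alpha> j))"

definition short :: "('n::finite \<Rightarrow> real) \<Rightarrow> 'n set \<Rightarrow> bool" where
  "short \<alpha> S \<longleftrightarrow> (\<Sum>i\<in>S. \<alpha> i) < (\<Sum>j\<in>-S. \<alpha> j)"

text \<open>
  This is only ever used for \<open>q\<close> with all \<open>q\<^sub>i \<noteq> 0\<close>, where the proportionality factor is
  automatically nonzero.
\<close>

definition straight :: "'n set \<Rightarrow> 'n::finite point \<Rightarrow> bool" where
  "straight S = (\<lambda>(p, q). \<forall>i\<in>S. \<forall>j\<in>S. \<exists>c. q $ i = c *s (q $ j))"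

definition stable :: "('n::finite \<Rightarrow> real) \<Rightarrow> 'n point \<Rightarrow> bool" where
  "stable \<alpha> = (\<lambda>(p, q).
     (\<forall>i. q $ i \<noteq> 0) \<and>
     (\<forall>S. straight S (p, q) \<and> (\<forall>j\<in>-S. p $ j = 0) \<longrightarrow> short \<alpha> S))"

definition stable_points :: "('n::finite \<Rightarrow> real) \<Rightarrow> 'n point set" where
  "stable_points \<alpha> = {x \<in> mu_C_zero. stable \<alpha> x}"

text \<open>
  The two presentations of the hyperpolygon space: the quotient of the stable locus by \<open>G\<close>,
  whose points are the \<open>G\<close>-orbits \<open>[p, q]\<close>, and the quotient of the level set by \<open>K\<close>.
\<close>

definition hyperpolygon_space :: "('n::finite \<Rightarrow> real) \<Rightarrow> 'n point set topology" where
  "hyperpolygon_space \<alpha> = quotient_topology (top_of_set (stable_points \<alpha>)) G_orbit"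

definition hyperpolygon_space_K :: "('n::finite \<Rightarrow> real) \<Rightarrow> 'n point set topology" where
  "hyperpolygon_space_K \<alpha> =
     quotient_topology (top_of_set (mu_R_level \<alpha> \<inter> mu_C_zero)) K_orbit"


section \<open>Core components\<close>

definition rescale :: "complex \<Rightarrow> 'n::finite point \<Rightarrow> 'n point" where
  "rescale c = (\<lambda>(p, q). (\<chi> i. c *s (p $ i), q))"

definition X_fixed :: "('n::finite \<Rightarrow> real) \<Rightarrow> 'n set \<Rightarrow> 'n point set set" where
  "X_fixed \<alpha> S = {G_orbit (p, q) | p q. (p, q) \<in> stable_points \<alpha> \<and>
     straight S (p, q) \<and> straight (-S) (p, q) \<and> (\<forall>j\<in>-S. p $ j = 0)}"

definition U_core :: "('n::finite \<Rightarrow> real) \<Rightarrow> 'n set \<Rightarrow> 'n point set set" where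
  "U_core \<alpha> S = hyperpolygon_space \<alpha> closure_of
     {G_orbit x | x. x \<in> stable_points \<alpha> \<and>
        (\<exists>l\<in>X_fixed \<alpha> S.
           limitin (hyperpolygon_space \<alpha>) (\<lambda>c. G_orbit (rescale c x)) l at_infinity)}"

text \<open>
  The same subset in the presentation by \<open>K\<close>-orbits; the two quotients are identified through
  the inclusion of level sets, which sends the \<open>K\<close>-orbit of \<open>x\<close> to its \<open>G\<close>-orbit.
\<close>

definition U_core_K :: "('n::finite \<Rightarrow> real) \<Rightarrow> 'n set \<Rightarrow> 'n point set set" where
  "U_core_K \<alpha> S =
     {K_orbit x | x. x \<in> mu_R_level \<alpha> \<inter> mu_C_zero \<and> G_orbit x \<in> U_core \<alpha> S}"


section \<open>Moduli of vectors in 3-space\<close>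

text \<open>
  The \<open>n + 1\<close> vectors are stored as a pair \<open>(x, w)\<close>, where \<open>x\<^sub>i\<close> is \<open>u\<^sub>i\<close> for \<open>i \<in> S\<close> and
  \<open>v\<^sub>i\<close> for \<open>i \<notin> S\<close>.
\<close>

definition vector_configs ::
    "('n::finite \<Rightarrow> real) \<Rightarrow> 'n set \<Rightarrow> ((real ^ 3 ^ 'n) \<times> (real ^ 3)) set" where
  "vector_configs \<alpha> S = {(x, w).
     w + (\<Sum>j\<in>-S. x $ j) = 0 \<and>
     (\<Sum>i\<in>S. x $ i) = 0 \<and>
     (\<forall>i\<in>S. x $ i \<bullet> w = 0) \<and>
     (\<forall>j\<in>-S. norm (x $ j) = \<alpha> j) \<and>
     norm w = (\<Sum>i\<in>S. sqrt ((\<alpha> i)\<^sup>2 + (norm (x $ i))\<^sup>2))}"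

definition rotation_orbit ::
    "(real ^ 3 ^ 'n::finite) \<times> (real ^ 3) \<Rightarrow> ((real ^ 3 ^ 'n) \<times> (real ^ 3)) set" where
  "rotation_orbit = (\<lambda>(x, w). {(\<chi> i. R *v (x $ i), R *v w) | R. rotation_matrix R})"

definition vector_moduli ::
    "('n::finite \<Rightarrow> real) \<Rightarrow> 'n set \<Rightarrow> ((real ^ 3 ^ 'n) \<times> (real ^ 3)) set topology" where
  "vector_moduli \<alpha> S = quotient_topology (top_of_set (vector_configs \<alpha> S)) rotation_orbit"

end

theory Submission
  imports Defs
begin

text \<open>
  The core component has a simple description upstairs.  Let \<open>Z\<close> (\<open>core_points\<close>) be the set of
  stable points for which \<open>S\<close> is straight and \<open>p\<close> vanishes off \<open>S\<close>.  It is closed and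
  invariant, and its image in \<open>X\<close> is \<open>U\<^sub>S\<close> (\<open>U_core_eq\<close>).  On the one hand, a point flowing into
  \<open>X\<^sub>S\<close> lies in \<open>Z\<close>, because suitable combinations of the invariants \<open>q\<^sub>i \<and> q\<^sub>j\<close> and
  \<open>p\<^sub>i q\<^sub>j\<close> grow with \<open>\<lambda>\<close> unless they vanish.  On the other hand, in coordinates in which the
  common line of the \<open>q\<^sub>i\<close> with \<open>i \<in> S\<close> is an axis, a point of \<open>Z\<close> in general position visibly
  flows into \<open>X\<^sub>S\<close>, and since \<open>|S| \<ge> 2\<close> such points are dense in \<open>Z\<close>.

  All spaces in the theorem are then quotients of the compact set \<open>L\<close> (\<open>core_level\<close>) of points of
  \<open>Z\<close> on the level set of the real moment map, and it suffices that the three quotient maps have the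
  same fibres (\<open>homeomorphic_quotients\<close>).

  The map to vectors (\<open>to_vectors\<close>) regards the \<open>q\<^sub>i\<close> as spinors.  For \<open>j \<notin> S\<close> the vector \<open>v\<^sub>j\<close> is
  the image of \<open>q\<^sub>j\<close> under the Hopf map, \<open>w\<close> is the total real moment of the indices in \<open>S\<close>, and
  \<open>u\<^sub>i\<close> is the nilpotent matrix \<open>q\<^sub>i p\<^sub>i\<close> in Pauli coordinates.  The moment map equations become
  the two closing conditions.  As \<open>S\<close> is straight, the moments of its elements lie on one ray, so
  that their lengths add up to that of \<open>w\<close>; and \<open>p\<^sub>i q\<^sub>i = 0\<close> makes \<open>u\<^sub>i\<close> orthogonal to \<open>w\<close>.
  The configuration determines the point up to phases, and \<open>SU(2)\<close> acts through its surjection onto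
  the rotation group, so the fibres over the moduli space are the \<open>K\<close>-orbits
  (\<open>to_vectors_image\<close>, \<open>rotation_orbit_to_vectors_eq_iff\<close>).

  The comparison of \<open>G\<close>-orbits with \<open>K\<close>-orbits is the Kempf-Ness argument.  By the polar
  decomposition (\<open>SL2_KAK\<close>) each of its three ingredients reduces to diagonal matrices.  Every stable
  orbit contains a minimum of the energy, which is a level point (\<open>stable_orbit_meets_level\<close>);
  convexity makes this point unique up to \<open>K\<close> (\<open>level_G_orbit_imp_K_orbit\<close>); and orbit
  equivalence of stable points is preserved under limits (\<open>G_orbit_limit\<close>), so that the
  map from \<open>L\<close> to \<open>U\<^sub>S\<close> is closed.
\<close>



section \<open>Two-dimensional complex linear algebra\<close>

definition wedge :: "complex ^ 2 \<Rightarrow> complex ^ 2 \<Rightarrow> complex" where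
  "wedge x y = x $ 1 * y $ 2 - x $ 2 * y $ 1"

definition annihilator :: "complex ^ 2 \<Rightarrow> complex ^ 2" where
  "annihilator q = vector [- q $ 2, q $ 1]"

lemma annihilator_nth [simp]: "annihilator q $ 1 = - q $ 2" "annihilator q $ 2 = q $ 1"
  by (simp_all add: annihilator_def)

lemma vec2_eq_iff: "x = y \<longleftrightarrow> x $ 1 = y $ 1 \<and> x $ 2 = y $ 2" for x y :: "'a ^ 2"
  by (simp add: vec_eq_iff forall_2)

lemma matrix2_eq_iff:
  "A = B \<longleftrightarrow> A $ 1 $ 1 = B $ 1 $ 1 \<and> A $ 1 $ 2 = B $ 1 $ 2 \<and> A $ 2 $ 1 = B $ 2 $ 1 \<and> A $ 2 $ 2 = B $ 2 $ 2"
  for A B :: "'a ^ 2 ^ 2"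
  by (simp add: vec_eq_iff forall_2)

lemma norm_vec2_squared: "(norm x)\<^sup>2 = (cmod (x $ 1))\<^sup>2 + (cmod (x $ 2))\<^sup>2" for x :: "complex ^ 2"
  by (simp add: norm_vec_def L2_set_def sum_2)

lemma matrix_vector_mult_nth2:
  "(A *v x) $ i = A $ i $ 1 * x $ 1 + A $ i $ 2 * x $ 2" for A :: "'a::semiring_1 ^ 2 ^ 'm"
  by (simp add: matrix_vector_mult_def sum_2)

lemma vector_matrix_mult_nth2:
  "(x v* A) $ i = x $ 1 * A $ 1 $ i + x $ 2 * A $ 2 $ i" for A :: "'a::comm_semiring_1 ^ 'm ^ 2"
  by (simp add: vector_matrix_mult_def sum_2 mult.commute)

lemma matrix_mult_nth2:
  "(A ** B) $ i $ j = A $ i $ 1 * B $ 1 $ j + A $ i $ 2 * B $ 2 $ j"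
  for A :: "'a::semiring_1 ^ 2 ^ 'm"
  by (simp add: matrix_matrix_mult_def sum_2)

lemma mat_one_nth2: "(mat 1 :: 'a::zero_neq_one ^ 2 ^ 2) $ 1 $ 1 = 1" "(mat 1 :: 'a ^ 2 ^ 2) $ 1 $ 2 = 0"
  "(mat 1 :: 'a ^ 2 ^ 2) $ 2 $ 1 = 0" "(mat 1 :: 'a ^ 2 ^ 2) $ 2 $ 2 = 1"
  by (simp_all add: mat_def)

lemmas nth2_simps = matrix_vector_mult_nth2 vector_matrix_mult_nth2 matrix_mult_nth2 mat_one_nth2

lemma row_col_2: "row_col p q = p $ 1 * q $ 1 + p $ 2 * q $ 2"
  by (simp add: row_col_def sum_2)

lemma row_col_zero_imp_annihilator:
  assumes "row_col p q = 0" "q \<noteq> 0"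
  obtains c where "p = c *s annihilator q"
proof (cases "q $ 1 = 0")
  case True
  then have "q $ 2 \<noteq> 0" using assms(2) by (simp add: vec2_eq_iff)
  with True assms(1) show ?thesis
    by (intro that[of "- p $ 1 / q $ 2"]) (auto simp: vec2_eq_iff row_col_2 field_simps)
next
  case False
  with assms(1) show ?thesis
    by (intro that[of "p $ 2 / q $ 1"]) (auto simp: vec2_eq_iff row_col_2 field_simps add_eq_0_iff)
qed

lemma wedge_zero_iff_proportional:
  assumes "y \<noteq> 0"
  shows "wedge x y = 0 \<longleftrightarrow> (\<exists>c. x = c *s y)"
proof
  assume w: "wedge x y = 0"
  show "\<exists>c. x = c *s y"
  proof (cases "y $ 1 = 0")
    case True
    then have "y $ 2 \<noteq> 0" using assms by (simp add: vec2_eq_iff)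
    with True w show ?thesis
      by (intro exI[of _ "x $ 2 / y $ 2"]) (auto simp: vec2_eq_iff wedge_def field_simps)
  next
    case False
    with w show ?thesis
      by (intro exI[of _ "x $ 1 / y $ 1"]) (auto simp: vec2_eq_iff wedge_def field_simps)
  qed
qed (auto simp: wedge_def)

lemma straight_iff_wedge:
  assumes "\<And>i. q $ i \<noteq> 0"
  shows "straight T (p, q) \<longleftrightarrow> (\<forall>i\<in>T. \<forall>j\<in>T. wedge (q $ i) (q $ j) = 0)"
  using wedge_zero_iff_proportional assms by (auto simp: straight_def)

lemma wedge_zero_trans:
  assumes "wedge x y = 0" "wedge y z = 0" "y \<noteq> 0"
  shows "wedge x z = 0"
proof -
  obtain c where c: "x = c *s y" using assms wedge_zero_iff_proportional by blast
  have "wedge x z = c * wedge y z" unfolding c by (simp add: wedge_def algebra_simps)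
  then show ?thesis using assms by simp
qed

lemma wedge_commute_zero: "wedge x y = 0 \<longleftrightarrow> wedge y x = 0"
  by (auto simp: wedge_def algebra_simps)

lemma row_col_zero_of_not_proportional:
  assumes "row_col p x = 0" "row_col p y = 0" "wedge x y \<noteq> 0"
  shows "p = 0"
proof -
  have "p $ 1 * wedge x y = row_col p x * y $ 2 - row_col p y * x $ 2"
       "p $ 2 * wedge x y = row_col p y * x $ 1 - row_col p x * y $ 1"
    by (simp_all add: wedge_def row_col_2 algebra_simps)
  then show ?thesis using assms by (simp add: vec2_eq_iff)
qed

section \<open>Matrices of determinant one\<close>

lemma SL2_iff: "A \<in> SL2 \<longleftrightarrow> A $ 1 $ 1 * A $ 2 $ 2 - A $ 1 $ 2 * A $ 2 $ 1 = 1"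
  by (simp add: SL2_def det_2)

definition adjugate :: "complex ^ 2 ^ 2 \<Rightarrow> complex ^ 2 ^ 2" where
  "adjugate A = vector [vector [A $ 2 $ 2, - A $ 1 $ 2], vector [- A $ 2 $ 1, A $ 1 $ 1]]"

lemma adjugate_nth [simp]:
  "adjugate A $ 1 $ 1 = A $ 2 $ 2" "adjugate A $ 1 $ 2 = - A $ 1 $ 2"
  "adjugate A $ 2 $ 1 = - A $ 2 $ 1" "adjugate A $ 2 $ 2 = A $ 1 $ 1"
  by (simp_all add: adjugate_def)

lemma SL2_adjugate_mult:
  assumes "A \<in> SL2"
  shows "A ** adjugate A = mat 1" "adjugate A ** A = mat 1"
  using assms by (simp_all add: SL2_iff matrix2_eq_iff nth2_simps algebra_simps)

lemma matrix_inv_SL2: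
  assumes "A \<in> SL2"
  shows "matrix_inv A = adjugate A"
proof -
  have "\<exists>B. A ** B = mat 1 \<and> B ** A = mat 1" using SL2_adjugate_mult[OF assms] by blast
  then have "A ** matrix_inv A = mat 1 \<and> matrix_inv A ** A = mat 1"
    unfolding matrix_inv_def by (rule someI_ex)
  then have "adjugate A ** (A ** matrix_inv A) = adjugate A" by simp
  then show ?thesis by (simp add: matrix_mul_assoc SL2_adjugate_mult[OF assms])
qed

lemma SL2_one [simp]: "mat 1 \<in> SL2" by (simp add: SL2_iff mat_one_nth2)

lemma SL2_mult: "A \<in> SL2 \<Longrightarrow> B \<in> SL2 \<Longrightarrow> A ** B \<in> SL2"
  by (simp add: SL2_def det_mul)

lemma SL2_adjugate: "A \<in> SL2 \<Longrightarrow> adjugate A \<in> SL2"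
  by (simp add: SL2_iff algebra_simps)

lemma SU2_iff:
  "A \<in> SU2 \<longleftrightarrow> A \<in> SL2 \<and> A $ 2 $ 1 = - cnj (A $ 1 $ 2) \<and> A $ 2 $ 2 = cnj (A $ 1 $ 1)"
proof
  assume "A \<in> SU2"
  then have A: "A \<in> SL2" and "adjoint_matrix A ** A = mat 1"
    by (auto simp: SU2_def SL2_def)
  then have "adjoint_matrix A ** A ** adjugate A = adjugate A" by simp
  then have "adjoint_matrix A = adjugate A"
    by (metis A SL2_adjugate_mult(1) matrix_mul_assoc matrix_mul_rid)
  then have "cnj (A $ 1 $ 1) = A $ 2 $ 2" "cnj (A $ 2 $ 1) = - A $ 1 $ 2"
    by (auto simp: matrix2_eq_iff adjoint_matrix_def)
  then show "A \<in> SL2 \<and> A $ 2 $ 1 = - cnj (A $ 1 $ 2) \<and> A $ 2 $ 2 = cnj (A $ 1 $ 1)"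
    using A by (metis complex_cnj_cnj complex_cnj_minus)
next
  assume A: "A \<in> SL2 \<and> A $ 2 $ 1 = - cnj (A $ 1 $ 2) \<and> A $ 2 $ 2 = cnj (A $ 1 $ 1)"
  then have "adjoint_matrix A = adjugate A"
    by (auto simp: matrix2_eq_iff adjoint_matrix_def)
  then show "A \<in> SU2" using A SL2_adjugate_mult by (simp add: SU2_def SL2_def)
qed

lemma SU2_SL2: "A \<in> SU2 \<Longrightarrow> A \<in> SL2" by (simp add: SU2_iff)

lemma SU2_unit_row:
  assumes "A \<in> SU2"
  shows "(cmod (A $ 1 $ 1))\<^sup>2 + (cmod (A $ 1 $ 2))\<^sup>2 = 1"
proof -
  have "A $ 1 $ 1 * cnj (A $ 1 $ 1) + A $ 1 $ 2 * cnj (A $ 1 $ 2) = 1"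
    using assms by (auto simp: SU2_iff SL2_iff)
  then have "complex_of_real ((cmod (A $ 1 $ 1))\<^sup>2 + (cmod (A $ 1 $ 2))\<^sup>2) = 1"
    by (simp add: complex_norm_square[symmetric] flip: of_real_power)
  then show ?thesis by (simp only: of_real_eq_1_iff)
qed

definition spinor_matrix :: "complex \<Rightarrow> complex \<Rightarrow> complex ^ 2 ^ 2" where
  "spinor_matrix a b = vector [vector [a, b], vector [- cnj b, cnj a]]"

lemma spinor_matrix_nth [simp]:
  "spinor_matrix a b $ 1 $ 1 = a" "spinor_matrix a b $ 1 $ 2 = b"
  "spinor_matrix a b $ 2 $ 1 = - cnj b" "spinor_matrix a b $ 2 $ 2 = cnj a"
  by (simp_all add: spinor_matrix_def)

lemma spinor_matrix_SU2:
  assumes "(cmod a)\<^sup>2 + (cmod b)\<^sup>2 = 1"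
  shows "spinor_matrix a b \<in> SU2"
proof -
  have "a * cnj a + b * cnj b = complex_of_real ((cmod a)\<^sup>2 + (cmod b)\<^sup>2)"
    by (simp add: complex_norm_square[symmetric] flip: of_real_power)
  then show ?thesis using assms by (simp add: SU2_iff SL2_iff)
qed

lemma SU2_eq_spinor_matrix:
  assumes "A \<in> SU2"
  shows "A = spinor_matrix (A $ 1 $ 1) (A $ 1 $ 2)"
  using assms by (simp add: SU2_iff matrix2_eq_iff)

lemma SU2_one [simp]: "mat 1 \<in> SU2" by (simp add: SU2_iff mat_one_nth2)

lemma SU2_mult: "A \<in> SU2 \<Longrightarrow> B \<in> SU2 \<Longrightarrow> A ** B \<in> SU2"
  by (auto simp: SU2_iff SL2_mult nth2_simps algebra_simps)

lemma SU2_adjugate: "A \<in> SU2 \<Longrightarrow> adjugate A \<in> SU2"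
  by (simp add: SU2_iff SL2_adjugate)

lemma norm_SU2_row:
  assumes "A \<in> SU2"
  shows "norm (x v* A) = norm x"
proof -
  have r: "A $ 1 $ 1 * A $ 2 $ 2 - A $ 1 $ 2 * A $ 2 $ 1 = 1" "A $ 2 $ 1 = - cnj (A $ 1 $ 2)" "A $ 2 $ 2 = cnj (A $ 1 $ 1)"
    using assms by (auto simp: SU2_iff SL2_iff)
  have "complex_of_real ((norm (x v* A))\<^sup>2) = complex_of_real ((norm x)\<^sup>2) * (A $ 1 $ 1 * A $ 2 $ 2 - A $ 1 $ 2 * A $ 2 $ 1)"
    unfolding norm_vec2_squared of_real_add of_real_power[symmetric] complex_norm_square
    by (simp add: nth2_simps r(2,3) complex_norm_square algebra_simps del: of_real_power)
  then have "(norm (x v* A))\<^sup>2 = (norm x)\<^sup>2" unfolding r(1) by (simp only: mult_1_right of_real_eq_iff)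
  then show ?thesis by simp
qed

lemma norm_SU2_column:
  assumes "A \<in> SU2"
  shows "norm (A *v x) = norm x"
proof -
  have r: "A $ 1 $ 1 * A $ 2 $ 2 - A $ 1 $ 2 * A $ 2 $ 1 = 1" "A $ 2 $ 1 = - cnj (A $ 1 $ 2)" "A $ 2 $ 2 = cnj (A $ 1 $ 1)"
    using assms by (auto simp: SU2_iff SL2_iff)
  have "complex_of_real ((norm (A *v x))\<^sup>2) = complex_of_real ((norm x)\<^sup>2) * (A $ 1 $ 1 * A $ 2 $ 2 - A $ 1 $ 2 * A $ 2 $ 1)"
    unfolding norm_vec2_squared of_real_add of_real_power[symmetric] complex_norm_square
    by (simp add: nth2_simps r(2,3) complex_norm_square algebra_simps del: of_real_power)
  then have "(norm (A *v x))\<^sup>2 = (norm x)\<^sup>2" unfolding r(1) by (simp only: mult_1_right of_real_eq_iff)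
  then show ?thesis by simp
qed

definition dilation :: "real \<Rightarrow> complex ^ 2 ^ 2" where
  "dilation s = vector [vector [of_real s, 0], vector [0, of_real (inverse s)]]"

lemma dilation_nth [simp]:
  "dilation s $ 1 $ 1 = of_real s" "dilation s $ 1 $ 2 = 0"
  "dilation s $ 2 $ 1 = 0" "dilation s $ 2 $ 2 = of_real (inverse s)"
  by (simp_all add: dilation_def)

lemma dilation_SL2: "s \<noteq> 0 \<Longrightarrow> dilation s \<in> SL2"
  by (simp add: SL2_iff)


section \<open>The action in coordinates\<close>

lemma act_nth:
  "fst (act A e x) $ i = inverse (e $ i) *s (fst x $ i v* A)"
  "snd (act A e x) $ i = e $ i *s (matrix_inv A *v (snd x $ i))"
  by (simp_all add: act_def split_beta)

lemma act_SL2_nth: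
  assumes "A \<in> SL2"
  shows "snd (act A e x) $ i = e $ i *s (adjugate A *v (snd x $ i))"
  by (simp add: act_nth matrix_inv_SL2 assms)

lemma adjugate_mult: "adjugate (A ** B) = adjugate B ** adjugate A"
  by (simp add: matrix2_eq_iff nth2_simps algebra_simps)

lemma act_act:
  assumes "A \<in> SL2" "B \<in> SL2"
  shows "act B f (act A e x) = act (A ** B) (\<chi> i. e $ i * f $ i) x"
  using assms
  by (simp add: prod_eq_iff vec_eq_iff[where 'b='a] vec2_eq_iff act_nth matrix_inv_SL2 SL2_mult adjugate_mult
      nth2_simps algebra_simps)

lemma act_one: "act (mat 1) (\<chi> i. 1) x = x"
  by (simp add: prod_eq_iff vec_eq_iff[where 'b='a] vec2_eq_iff act_nth matrix_inv_SL2 nth2_simps)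

lemma act_cancel:
  assumes "A \<in> SL2" "\<And>i. e $ i \<noteq> 0"
  shows "act (adjugate A) (\<chi> i. inverse (e $ i)) (act A e x) = x"
  using assms by (simp add: act_act SL2_adjugate SL2_adjugate_mult act_one)

lemma G_orbitI: "A \<in> SL2 \<Longrightarrow> (\<And>i. e $ i \<noteq> 0) \<Longrightarrow> act A e x \<in> G_orbit x"
  by (auto simp: G_orbit_def)

lemma G_orbit_self: "x \<in> G_orbit x"
  using G_orbitI[OF SL2_one, of "\<chi> i. 1" x] by (simp add: act_one)

lemma G_orbit_subset:
  assumes "y \<in> G_orbit x"
  shows "G_orbit y \<subseteq> G_orbit x"
proof -
  obtain A e where A: "A \<in> SL2" "\<forall>i. e $ i \<noteq> 0" "y = act A e x"
    using assms by (auto simp: G_orbit_def)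
  have "act B f y \<in> G_orbit x" if B: "B \<in> SL2" "\<forall>i. f $ i \<noteq> 0" for B f
  proof -
    have "act B f y = act (A ** B) (\<chi> i. e $ i * f $ i) x"
      by (simp add: A(3) act_act A(1) B(1))
    also have "\<dots> \<in> G_orbit x"
      using A B by (intro G_orbitI SL2_mult) auto
    finally show ?thesis .
  qed
  then show ?thesis by (auto simp: G_orbit_def)
qed

lemma G_orbit_eq_iff: "G_orbit x = G_orbit y \<longleftrightarrow> x \<in> G_orbit y"
proof
  assume "x \<in> G_orbit y"
  then obtain A e where A: "A \<in> SL2" "\<forall>i. e $ i \<noteq> 0" "x = act A e y"
    by (auto simp: G_orbit_def)
  then have "y = act (adjugate A) (\<chi> i. inverse (e $ i)) x" by (simp add: act_cancel)
  then have "y \<in> G_orbit x" using A G_orbitI[OF SL2_adjugate[OF A(1)], of "\<chi> i. inverse (e $ i)" x] by simp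
  then show "G_orbit x = G_orbit y" using G_orbit_subset \<open>x \<in> G_orbit y\<close> by blast
qed (metis G_orbit_self)

lemma G_orbit_act:
  assumes "A \<in> SL2" "\<And>i. e $ i \<noteq> 0"
  shows "G_orbit (act A e x) = G_orbit x"
  using G_orbitI[of A e x] assms by (simp add: G_orbit_eq_iff)

lemma K_orbitI: "A \<in> SU2 \<Longrightarrow> (\<And>i. cmod (e $ i) = 1) \<Longrightarrow> act A e x \<in> K_orbit x"
  by (auto simp: K_orbit_def)

lemma K_orbit_subset_G_orbit: "K_orbit x \<subseteq> G_orbit x"
proof -
  have "act A e x \<in> G_orbit x" if "A \<in> SU2" "\<forall>i. cmod (e $ i) = 1" for A e
  proof (rule G_orbitI)
    show "A \<in> SL2" using that SU2_SL2 by blast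
    show "e $ i \<noteq> 0" for i using that(2)[rule_format, of i] by auto
  qed
  then show ?thesis by (auto simp: K_orbit_def)
qed

lemma K_orbit_self: "x \<in> K_orbit x"
  using K_orbitI[OF SU2_one, of "\<chi> i. 1" x] by (simp add: act_one)

lemma K_orbit_trans:
  assumes "y \<in> K_orbit x" "z \<in> K_orbit y"
  shows "z \<in> K_orbit x"
proof -
  obtain A e where A: "A \<in> SU2" "\<forall>i. cmod (e $ i) = 1" "y = act A e x"
    using assms(1) by (auto simp: K_orbit_def)
  obtain B f where B: "B \<in> SU2" "\<forall>i. cmod (f $ i) = 1" "z = act B f y"
    using assms(2) by (auto simp: K_orbit_def)
  have "z = act (A ** B) (\<chi> i. e $ i * f $ i) x"
    using A B by (simp add: act_act SU2_SL2)
  also have "\<dots> \<in> K_orbit x"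
    using A B by (intro K_orbitI SU2_mult) (auto simp: norm_mult)
  finally show ?thesis .
qed

lemma K_orbit_sym:
  assumes "x \<in> K_orbit y"
  shows "y \<in> K_orbit x"
proof -
  obtain A e where A: "A \<in> SU2" "\<forall>i. cmod (e $ i) = 1" "x = act A e y"
    using assms by (auto simp: K_orbit_def)
  have "e $ i \<noteq> 0" for i using A(2)[rule_format, of i] by auto
  then have "y = act (adjugate A) (\<chi> i. inverse (e $ i)) x" using A by (simp add: act_cancel SU2_SL2)
  also have "\<dots> \<in> K_orbit x" using A by (intro K_orbitI SU2_adjugate) (auto simp: norm_inverse)
  finally show ?thesis .
qed

lemma K_orbit_eq_iff: "K_orbit x = K_orbit y \<longleftrightarrow> x \<in> K_orbit y"
  using K_orbit_self K_orbit_trans K_orbit_sym by blast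

section \<open>Invariance of the complex moment map and of stability\<close>

lemma row_col_act:
  assumes "A \<in> SL2"
  shows "row_col (fst (act A e x) $ i) (snd (act A e x) $ j)
       = inverse (e $ i) * e $ j * row_col (fst x $ i) (snd x $ j)"
proof -
  have "row_col (fst (act A e x) $ i) (snd (act A e x) $ j)
      = inverse (e $ i) * e $ j * row_col (fst x $ i) (snd x $ j) * (A $ 1 $ 1 * A $ 2 $ 2 - A $ 1 $ 2 * A $ 2 $ 1)"
    by (simp add: row_col_2 act_nth matrix_inv_SL2 assms nth2_simps algebra_simps)
  then show ?thesis using assms by (simp add: SL2_iff)
qed

lemma wedge_act:
  assumes "A \<in> SL2"
  shows "wedge (snd (act A e x) $ i) (snd (act A e x) $ j)
       = e $ i * e $ j * wedge (snd x $ i) (snd x $ j)"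
proof -
  have "wedge (snd (act A e x) $ i) (snd (act A e x) $ j)
      = e $ i * e $ j * wedge (snd x $ i) (snd x $ j) * (A $ 1 $ 1 * A $ 2 $ 2 - A $ 1 $ 2 * A $ 2 $ 1)"
    by (simp add: wedge_def act_nth matrix_inv_SL2 assms nth2_simps algebra_simps)
  then show ?thesis using assms by (simp add: SL2_iff)
qed

lemma mu_C_zero_iff:
  "x \<in> mu_C_zero \<longleftrightarrow>
     (\<Sum>i\<in>UNIV. col_row (snd x $ i) (fst x $ i)) = 0 \<and> (\<forall>i. row_col (fst x $ i) (snd x $ i) = 0)"
proof -
  have "traceless (col_row q p) = col_row q p" if "row_col p q = 0" for p q
  proof -
    have "trace (col_row q p) = row_col p q"
      by (simp add: trace_def col_row_def row_col_2 sum_2 mult.commute)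
    then show ?thesis using that by (simp add: traceless_def matrix2_eq_iff mat_def)
  qed
  then show ?thesis
    by (cases x) (auto simp: mu_C_zero_def cong: sum.cong)
qed

lemma mu_C_zero_act:
  assumes "A \<in> SL2" "\<And>i. e $ i \<noteq> 0" "x \<in> mu_C_zero"
  shows "act A e x \<in> mu_C_zero"
proof -
  let ?M = "\<lambda>x. \<Sum>i\<in>UNIV. col_row (snd x $ i) (fst x $ i)"
  have cr: "col_row (snd (act A e x) $ i) (fst (act A e x) $ i)
      = adjugate A ** col_row (snd x $ i) (fst x $ i) ** A" for i
    using assms(2)[of i]
    by (simp add: matrix2_eq_iff col_row_def act_nth matrix_inv_SL2 assms(1) nth2_simps field_simps)
  have "?M (act A e x) = adjugate A ** ?M x ** A"
  proof -
    have "(\<Sum>i\<in>I. adjugate A ** f i ** A) = adjugate A ** (\<Sum>i\<in>I. f i) ** A" for I :: "'a set" and f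
      by (induction I rule: infinite_finite_induct)
         (auto simp: matrix2_eq_iff nth2_simps algebra_simps)
    then show ?thesis by (simp add: cr)
  qed
  also have "?M x = 0" using assms(3) by (simp add: mu_C_zero_iff)
  finally have "?M (act A e x) = 0" by simp
  then show ?thesis using assms by (simp add: mu_C_zero_iff row_col_act)
qed

lemma act_nonzero:
  assumes "A \<in> SL2" "e $ i \<noteq> 0"
  shows "snd (act A e x) $ i = 0 \<longleftrightarrow> snd x $ i = 0" "fst (act A e x) $ i = 0 \<longleftrightarrow> fst x $ i = 0"
proof -
  have zero: "v = 0" if "adjugate A *v v = 0" for v
  proof -
    have "A *v (adjugate A *v v) = v"
      by (simp add: matrix_vector_mul_assoc SL2_adjugate_mult assms)
    then show ?thesis using that by simp
  qed
  have zero': "v = 0" if "v v* A = 0" for v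
  proof -
    have "(v v* A) v* adjugate A = v"
      by (simp add: vector_matrix_mul_assoc SL2_adjugate_mult assms)
    then show ?thesis using that by simp
  qed
  show "snd (act A e x) $ i = 0 \<longleftrightarrow> snd x $ i = 0"
    using assms zero by (auto simp: act_SL2_nth)
  show "fst (act A e x) $ i = 0 \<longleftrightarrow> fst x $ i = 0"
    using assms zero' by (auto simp: act_nth)
qed

lemma stable_iff_wedge:
  "stable \<alpha> x \<longleftrightarrow> (\<forall>i. snd x $ i \<noteq> 0) \<and>
     (\<forall>T. (\<forall>i\<in>T. \<forall>j\<in>T. wedge (snd x $ i) (snd x $ j) = 0) \<and> (\<forall>j\<in>-T. fst x $ j = 0) \<longrightarrow> short \<alpha> T)"
  by (cases x) (auto simp: stable_def straight_iff_wedge)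

lemma stable_act:
  assumes "A \<in> SL2" "\<And>i. e $ i \<noteq> 0"
  shows "stable \<alpha> (act A e x) \<longleftrightarrow> stable \<alpha> x"
  using assms by (simp add: stable_iff_wedge act_nonzero wedge_act)

lemma stable_points_act:
  assumes "A \<in> SL2" "\<And>i. e $ i \<noteq> 0" "x \<in> stable_points \<alpha>"
  shows "act A e x \<in> stable_points \<alpha>"
  using assms by (simp add: stable_points_def stable_act mu_C_zero_act)


section \<open>Polar decomposition of matrices of determinant one\<close>

text \<open>
  Applied to \<open>A A\<^sup>*\<close>, this gives the first column of the left unitary factor of \<open>A\<close>.
\<close>

lemma hermitian_2_eigenvector:
  fixes b :: complex and a d :: real
  obtains v1 v2 :: complex and l :: real where "(cmod v1)\<^sup>2 + (cmod v2)\<^sup>2 = 1"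
    "a * v1 + b * v2 = l * v1" "cnj b * v1 + d * v2 = l * v2"
proof (cases "b = 0")
  case True
  then show ?thesis by (intro that[of 1 0 a]) auto
next
  case False
  define D where "D = (a - d)\<^sup>2 + 4 * (cmod b)\<^sup>2"
  define l where "l = (a + d + sqrt D) / 2"
  have "D \<ge> 0" by (simp add: D_def)
  then have sq: "sqrt D * sqrt D = D" by simp
  have "(l - a) * (l - d) = (sqrt D * sqrt D - (a - d)\<^sup>2) / 4"
    by (simp add: l_def field_simps power2_eq_square)
  then have l: "(l - a) * (l - d) = (cmod b)\<^sup>2" unfolding sq by (simp add: D_def)
  define N where "N = sqrt ((cmod b)\<^sup>2 + (l - a)\<^sup>2)"
  have N: "N > 0" "N\<^sup>2 = (cmod b)\<^sup>2 + (l - a)\<^sup>2"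
    using False by (auto simp: N_def add_pos_nonneg)
  show ?thesis
  proof (rule that[of "b / N" "(l - a) / N" l])
    have "(cmod (b / N))\<^sup>2 + (cmod (complex_of_real ((l - a) / N)))\<^sup>2 = ((cmod b)\<^sup>2 + (l - a)\<^sup>2) / N\<^sup>2"
      using N(1) by (simp add: norm_divide power_divide add_divide_distrib del: of_real_diff of_real_divide)
    also have "\<dots> = 1" using N by (simp add: flip: N(2))
    finally show "(cmod (b / N))\<^sup>2 + (cmod (complex_of_real ((l - a) / N)))\<^sup>2 = 1" .
    show "a * (b / N) + b * complex_of_real ((l - a) / N) = l * (b / N)"
      using N(1) by (simp add: field_simps)
    have "cnj b * b = complex_of_real ((l - a) * (l - d))"
      unfolding l complex_norm_square by (simp add: mult.commute)
    then show "cnj b * (b / N) + d * complex_of_real ((l - a) / N) = l * complex_of_real ((l - a) / N)"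
      using N(1) by (simp add: field_simps)
  qed
qed

lemma complex_mult_cnj_sum:
  "z * cnj z + w * cnj w = complex_of_real ((cmod z)\<^sup>2 + (cmod w)\<^sup>2)"
  by (simp add: complex_norm_square[symmetric] flip: of_real_power)

text \<open>
  Since the determinant is one, the lengths of two orthogonal rows are reciprocal to each other, so
  dividing them out leaves a unitary matrix.
\<close>

lemma SL2_orthogonal_rows:
  assumes B: "B \<in> SL2" and orth: "B $ 1 $ 1 * cnj (B $ 2 $ 1) + B $ 1 $ 2 * cnj (B $ 2 $ 2) = 0"
  obtains s V where "s > 0" "V \<in> SU2" "B = dilation s ** V"
proof -
  define s where "s = sqrt ((cmod (B $ 1 $ 1))\<^sup>2 + (cmod (B $ 1 $ 2))\<^sup>2)"
  have det: "B $ 1 $ 1 * B $ 2 $ 2 - B $ 1 $ 2 * B $ 2 $ 1 = 1" using B by (simp add: SL2_iff)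
  have "B $ 1 $ 1 \<noteq> 0 \<or> B $ 1 $ 2 \<noteq> 0" using det by auto
  then have s: "s > 0" "s\<^sup>2 = (cmod (B $ 1 $ 1))\<^sup>2 + (cmod (B $ 1 $ 2))\<^sup>2"
    by (auto simp: s_def add_pos_nonneg add_nonneg_pos)
  have ss: "complex_of_real (s\<^sup>2) = B $ 1 $ 1 * cnj (B $ 1 $ 1) + B $ 1 $ 2 * cnj (B $ 1 $ 2)"
    unfolding s(2) by (simp add: complex_mult_cnj_sum)
  have orth': "cnj (B $ 1 $ 1) * B $ 2 $ 1 + cnj (B $ 1 $ 2) * B $ 2 $ 2 = 0"
    using arg_cong[OF orth, of cnj] by simp
  have "complex_of_real (s\<^sup>2) * B $ 2 $ 2
      = cnj (B $ 1 $ 1) * (B $ 1 $ 1 * B $ 2 $ 2 - B $ 1 $ 2 * B $ 2 $ 1)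
        + B $ 1 $ 2 * (cnj (B $ 1 $ 1) * B $ 2 $ 1 + cnj (B $ 1 $ 2) * B $ 2 $ 2)"
    unfolding ss by (simp add: algebra_simps)
  then have b22: "complex_of_real (s\<^sup>2) * B $ 2 $ 2 = cnj (B $ 1 $ 1)" unfolding det orth' by simp
  have "complex_of_real (s\<^sup>2) * B $ 2 $ 1
      = B $ 1 $ 1 * (cnj (B $ 1 $ 1) * B $ 2 $ 1 + cnj (B $ 1 $ 2) * B $ 2 $ 2)
        - cnj (B $ 1 $ 2) * (B $ 1 $ 1 * B $ 2 $ 2 - B $ 1 $ 2 * B $ 2 $ 1)"
    unfolding ss by (simp add: algebra_simps)
  then have b21: "complex_of_real (s\<^sup>2) * B $ 2 $ 1 = - cnj (B $ 1 $ 2)" unfolding det orth' by simp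
  define V where "V = spinor_matrix (B $ 1 $ 1 / s) (B $ 1 $ 2 / s)"
  have "(cmod (B $ 1 $ 1 / s))\<^sup>2 + (cmod (B $ 1 $ 2 / s))\<^sup>2
      = ((cmod (B $ 1 $ 1))\<^sup>2 + (cmod (B $ 1 $ 2))\<^sup>2) / s\<^sup>2"
    using s(1) by (simp add: norm_divide power_divide add_divide_distrib)
  also have "\<dots> = s\<^sup>2 / s\<^sup>2" unfolding s(2) ..
  finally have "(cmod (B $ 1 $ 1 / s))\<^sup>2 + (cmod (B $ 1 $ 2 / s))\<^sup>2 = s\<^sup>2 / s\<^sup>2" .
  then have "V \<in> SU2" unfolding V_def using s(1) by (intro spinor_matrix_SU2) simp
  moreover have "B = dilation s ** V"
    using s(1) b21 b22 by (simp add: matrix2_eq_iff nth2_simps V_def field_simps power2_eq_square)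
  ultimately show ?thesis using s(1) that by blast
qed

lemma SL2_KAK:
  assumes A: "A \<in> SL2"
  obtains U t V where "U \<in> SU2" "V \<in> SU2" "0 < t" "t \<le> 1" "A = U ** dilation (inverse t) ** V"
proof -
  define a where "a = (cmod (A $ 1 $ 1))\<^sup>2 + (cmod (A $ 1 $ 2))\<^sup>2"
  define d where "d = (cmod (A $ 2 $ 1))\<^sup>2 + (cmod (A $ 2 $ 2))\<^sup>2"
  define b where "b = A $ 1 $ 1 * cnj (A $ 2 $ 1) + A $ 1 $ 2 * cnj (A $ 2 $ 2)"
  have a: "complex_of_real a = A $ 1 $ 1 * cnj (A $ 1 $ 1) + A $ 1 $ 2 * cnj (A $ 1 $ 2)"
    and d: "complex_of_real d = A $ 2 $ 1 * cnj (A $ 2 $ 1) + A $ 2 $ 2 * cnj (A $ 2 $ 2)"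
    by (simp_all add: a_def d_def complex_mult_cnj_sum)
  obtain v1 v2 :: complex and l :: real where v: "(cmod v1)\<^sup>2 + (cmod v2)\<^sup>2 = 1"
    "a * v1 + b * v2 = l * v1" "cnj b * v1 + d * v2 = l * v2"
    by (rule hermitian_2_eigenvector)
  define U where "U = spinor_matrix v1 (- cnj v2)"
  have U: "U \<in> SU2" unfolding U_def using v(1) by (intro spinor_matrix_SU2) simp
  define B where "B = adjugate U ** A"
  have AB: "A = U ** B"
    by (simp add: B_def matrix_mul_assoc SL2_adjugate_mult[OF SU2_SL2[OF U]])
  have "B \<in> SL2" using U A by (simp add: B_def SL2_mult SL2_adjugate SU2_SL2)
  moreover have "B $ 1 $ 1 * cnj (B $ 2 $ 1) + B $ 1 $ 2 * cnj (B $ 2 $ 2) = 0"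
  proof -
    have "cnj (B $ 1 $ 1 * cnj (B $ 2 $ 1) + B $ 1 $ 2 * cnj (B $ 2 $ 2))
        = v1 * (cnj b * v1 + d * v2) - v2 * (a * v1 + b * v2)"
      unfolding a d by (simp add: B_def U_def nth2_simps b_def algebra_simps)
    also have "\<dots> = 0" unfolding v(2,3) by simp
    finally show ?thesis by (metis complex_cnj_zero_iff)
  qed
  ultimately obtain s V where s: "s > 0" "V \<in> SU2" "B = dilation s ** V"
    by (rule SL2_orthogonal_rows)
  show ?thesis
  proof (cases "s \<ge> 1")
    case True
    then show ?thesis using U s AB
      by (intro that[of U V "inverse s"]) (auto simp: matrix_mul_assoc inverse_le_1_iff)
  next
    case False
    \<comment> \<open>The Weyl element exchanges the two diagonal entries.\<close>
    let ?W = "spinor_matrix 0 1"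
    have W: "?W \<in> SU2" by (intro spinor_matrix_SU2) simp
    have "dilation s = adjugate ?W ** dilation (inverse s) ** ?W"
      by (simp add: matrix2_eq_iff nth2_simps)
    then have "A = (U ** adjugate ?W) ** dilation (inverse s) ** (?W ** V)"
      by (simp add: AB s(3) matrix_mul_assoc)
    then show ?thesis using U s W False
      by (intro that[of "U ** adjugate ?W" "?W ** V" s]) (auto intro!: SU2_mult SU2_adjugate)
  qed
qed

lemma continuous_on_vecI:
  "(\<And>i. continuous_on X (\<lambda>x. f x $ i)) \<Longrightarrow> continuous_on X f"
  using continuous_on_vec_lambda[of X "\<lambda>i x. f x $ i"] by simp

lemma compact_SU2: "compact SU2"
proof -
  have "SU2 = (\<lambda>(a, b). spinor_matrix a b) ` {(a, b). (norm (a, b))\<^sup>2 = 1}"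
  proof -
    have "A \<in> (\<lambda>(a, b). spinor_matrix a b) ` {(a, b). (norm (a, b))\<^sup>2 = 1}" if "A \<in> SU2" for A
    proof (rule image_eqI[where x = "(A $ 1 $ 1, A $ 1 $ 2)"])
      show "A = (case (A $ 1 $ 1, A $ 1 $ 2) of (a, b) \<Rightarrow> spinor_matrix a b)"
        using SU2_eq_spinor_matrix[OF that] by simp
    qed (use SU2_unit_row[OF that] in \<open>simp add: norm_Pair\<close>)
    then show ?thesis by (auto simp: norm_Pair intro: spinor_matrix_SU2)
  qed
  also have "{(a, b). (norm (a, b))\<^sup>2 = 1} = sphere (0 :: complex \<times> complex) 1"
    by (auto simp: power2_eq_1_iff) (smt (verit) norm_ge_zero)+
  finally have SU2: "SU2 = (\<lambda>(a, b). spinor_matrix a b) ` sphere (0 :: complex \<times> complex) 1" .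
  have "continuous_on X (\<lambda>x. spinor_matrix (fst x) (snd x) $ i $ j)" for X i j
    using exhaust_2[of i] exhaust_2[of j] by (elim disjE; simp; intro continuous_intros)
  then have "continuous_on (sphere (0 :: complex \<times> complex) 1) (\<lambda>(a, b). spinor_matrix a b)"
    unfolding split_beta by (intro continuous_on_vecI)
  then show ?thesis unfolding SU2 by (rule compact_continuous_image) simp
qed


section \<open>Pauli coordinates and the double cover of the rotation group\<close>

text \<open>
  The coordinates of the traceless Hermitian part of a matrix with respect to the Pauli matrices.
\<close>

definition pauli :: "complex ^ 2 ^ 2 \<Rightarrow> real ^ 3" where
  "pauli M = vector [Re (M $ 1 $ 2 + M $ 2 $ 1) / 2, Im (M $ 2 $ 1 - M $ 1 $ 2) / 2,
                     Re (M $ 1 $ 1 - M $ 2 $ 2) / 2]"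

lemma pauli_nth:
  "pauli M $ 1 = Re (M $ 1 $ 2 + M $ 2 $ 1) / 2"
  "pauli M $ 2 = Im (M $ 2 $ 1 - M $ 1 $ 2) / 2"
  "pauli M $ 3 = Re (M $ 1 $ 1 - M $ 2 $ 2) / 2"
  by (simp_all add: pauli_def)

lemma vec3_eq_iff: "x = y \<longleftrightarrow> x $ 1 = y $ 1 \<and> x $ 2 = y $ 2 \<and> x $ 3 = y $ 3" for x y :: "'a ^ 3"
  by (simp add: vec_eq_iff forall_3)

lemma norm_vec3_squared: "(norm x)\<^sup>2 = (x $ 1)\<^sup>2 + (x $ 2)\<^sup>2 + (x $ 3)\<^sup>2" for x :: "real ^ 3"
  by (simp add: norm_vec_def L2_set_def sum_3)

lemma linear_pauli: "linear pauli"
  by (rule linearI) (simp_all add: vec3_eq_iff pauli_nth algebra_simps add_divide_distrib diff_divide_distrib)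

lemma pauli_surj: "\<exists>M. pauli M = v"
  by (rule exI[of _ "vector [vector [complex_of_real (v $ 3), Complex (v $ 1) (- v $ 2)],
        vector [Complex (v $ 1) (v $ 2), - complex_of_real (v $ 3)]]"])
     (simp add: vec3_eq_iff pauli_nth)

text \<open>
  The rotation by which conjugation \<open>M \<mapsto> A\<^sup>-\<^sup>1 M A\<close> acts on Pauli coordinates, in terms of the first
  row of \<open>A\<close>.
\<close>

definition spin_matrix :: "complex ^ 2 ^ 2 \<Rightarrow> real ^ 3 ^ 3" where
  "spin_matrix A = (let a = A $ 1 $ 1; b = A $ 1 $ 2 in
     vector [vector [Re (cnj a ^ 2 - b ^ 2), Im (cnj a ^ 2 + b ^ 2), 2 * Re (cnj a * b)],
             vector [- Im (cnj a ^ 2 - b ^ 2), Re (cnj a ^ 2 + b ^ 2), - 2 * Im (cnj a * b)],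
             vector [- 2 * Re (cnj a * cnj b), 2 * Im (a * b), (Re a)\<^sup>2 + (Im a)\<^sup>2 - (Re b)\<^sup>2 - (Im b)\<^sup>2]])"

lemma matrix3_vector_mult_nth:
  "(R *v x) $ i = R $ i $ 1 * x $ 1 + R $ i $ 2 * x $ 2 + R $ i $ 3 * x $ 3" for R :: "real ^ 3 ^ 'm"
  by (simp add: matrix_vector_mult_def sum_3)

lemma spin_matrix_pauli:
  assumes "A \<in> SU2"
  shows "pauli (adjugate A ** M ** A) = spin_matrix A *v pauli M"
proof -
  obtain a b where A: "A = spinor_matrix a b" using SU2_eq_spinor_matrix assms by blast
  show ?thesis
    unfolding A
    by (simp add: vec3_eq_iff pauli_nth matrix3_vector_mult_nth spin_matrix_def Let_def nth2_simps cmod_power2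
        power2_eq_square field_simps)
qed

lemma rotation_spin_matrix:
  assumes "A \<in> SU2"
  shows "rotation_matrix (spin_matrix A)"
proof -
  define x y z t where "x = Re (A $ 1 $ 1)" and "y = Im (A $ 1 $ 1)" and "z = Re (A $ 1 $ 2)" and "t = Im (A $ 1 $ 2)"
  have n: "x * x + y * y + z * z + t * t = 1"
    using SU2_unit_row[OF assms] unfolding cmod_power2 by (simp add: x_def y_def z_def t_def power2_eq_square)
  let ?n = "x * x + y * y + z * z + t * t"
  let ?R = "vector [vector [x*x-y*y-z*z+t*t, 2*z*t-2*x*y, 2*x*z+2*y*t],
       vector [2*x*y+2*z*t, x*x-y*y+z*z-t*t, 2*y*z-2*x*t],
       vector [2*y*t-2*x*z, 2*x*t+2*y*z, x*x+y*y-z*z-t*t]] :: real ^ 3 ^ 3"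
  have R: "spin_matrix A = ?R"
    by (simp add: vec3_eq_iff spin_matrix_def Let_def cmod_power2 x_def y_def z_def t_def power2_eq_square algebra_simps)
  have "det ?R = ?n ^ 3"
    by (simp add: det_3 algebra_simps power3_eq_cube)
  moreover have "transpose ?R ** ?R = mat (?n ^ 2)"
    by (simp add: vec3_eq_iff matrix_matrix_mult_def sum_3 transpose_def mat_def algebra_simps power2_eq_square)
  ultimately show ?thesis
    unfolding R n rotation_matrix_def orthogonal_matrix by simp
qed

text \<open>
  The order of the factors is reversed because the action is from the right.
\<close>

lemma spin_matrix_mult:
  assumes "A \<in> SU2" "B \<in> SU2"
  shows "spin_matrix (A ** B) = spin_matrix B ** spin_matrix A"
proof -
  have "spin_matrix (A ** B) *v v = (spin_matrix B ** spin_matrix A) *v v" for v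
  proof -
    obtain M where M: "v = pauli M" using pauli_surj by metis
    have "spin_matrix (A ** B) *v v = pauli (adjugate B ** (adjugate A ** M ** A) ** B)"
      unfolding M by (simp add: spin_matrix_pauli[symmetric] SU2_mult assms adjugate_mult matrix_mul_assoc)
    also have "\<dots> = spin_matrix B *v (spin_matrix A *v v)"
      unfolding M by (simp add: spin_matrix_pauli assms)
    finally show ?thesis by (simp add: matrix_vector_mul_assoc)
  qed
  then show ?thesis by (simp add: matrix_eq)
qed

lemma spin_matrix_to_axis:
  fixes v :: "real ^ 3"
  assumes "norm v = 1"
  obtains A where "A \<in> SU2" "spin_matrix A *v axis 3 1 = v"
proof -
  have v: "(v $ 1)\<^sup>2 + (v $ 2)\<^sup>2 + (v $ 3)\<^sup>2 = 1" using norm_vec3_squared[of v] assms by simp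
  show ?thesis
  proof (cases "v $ 3 = -1")
    case True
    have "spinor_matrix 0 1 \<in> SU2" by (intro spinor_matrix_SU2) simp
    moreover have "spin_matrix (spinor_matrix 0 1) *v axis 3 1 = v"
      using True v by (simp add: vec3_eq_iff matrix3_vector_mult_nth spin_matrix_def Let_def axis_def)
    ultimately show ?thesis by (rule that)
  next
    case False
    have "(v $ 3)\<^sup>2 \<le> 1" using v zero_le_power2[of "v $ 1"] zero_le_power2[of "v $ 2"] by linarith
    then have "\<bar>v $ 3\<bar> \<le> 1" by (simp add: abs_square_le_1)
    then have pos: "1 + v $ 3 > 0" using False by linarith
    define a where "a = sqrt ((1 + v $ 3) / 2)"
    have a: "a > 0" "a\<^sup>2 = (1 + v $ 3) / 2" using pos by (auto simp: a_def)
    define b where "b = Complex (v $ 1 / (2 * a)) (- v $ 2 / (2 * a))"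
    have "(cmod b)\<^sup>2 = ((v $ 1)\<^sup>2 + (v $ 2)\<^sup>2) / (4 * a\<^sup>2)"
      by (simp add: b_def cmod_power2 power_divide power_mult_distrib add_divide_distrib)
    also have "(v $ 1)\<^sup>2 + (v $ 2)\<^sup>2 = 1 - (v $ 3)\<^sup>2" using v by simp
    also have "(1 - (v $ 3)\<^sup>2) / (4 * a\<^sup>2) = (1 - (v $ 3)\<^sup>2) / (2 * (1 + v $ 3))"
      by (rule arg_cong[where f = "\<lambda>z. (1 - (v $ 3)\<^sup>2) / z"]) (simp add: a(2))
    also have "\<dots> = (1 - v $ 3) / 2" using pos by (simp add: field_simps power2_eq_square)
    finally have b: "(cmod b)\<^sup>2 = (1 - v $ 3) / 2" .
    let ?A = "spinor_matrix (complex_of_real a) b"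
    have bb: "(Re b)\<^sup>2 + (Im b)\<^sup>2 = (1 - v $ 3) / 2" using b by (simp add: cmod_power2)
    have "?A \<in> SU2" using a b by (intro spinor_matrix_SU2) (simp add: field_simps)
    moreover have "spin_matrix ?A *v axis 3 1 = v"
      unfolding vec3_eq_iff
    proof (intro conjI)
      show "(spin_matrix ?A *v axis 3 1) $ 3 = v $ 3"
        using a bb by (simp add: matrix3_vector_mult_nth spin_matrix_def Let_def axis_def field_simps)
    qed (use a in \<open>simp_all add: matrix3_vector_mult_nth spin_matrix_def Let_def axis_def b_def\<close>)
    ultimately show ?thesis by (rule that)
  qed
qed

text \<open>
  A diagonal unitary with entry \<open>c\<close> rotates by twice the argument of \<open>c\<close>, whence the square root.
\<close>

lemma rotation_fixing_axis:
  assumes Q: "rotation_matrix Q" and fix3: "Q *v axis 3 1 = axis 3 1"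
  obtains D where "D \<in> SU2" "spin_matrix D = Q"
proof -
  have c3: "Q $ 1 $ 3 = 0" "Q $ 2 $ 3 = 0" "Q $ 3 $ 3 = 1"
    using fix3 by (simp_all add: vec3_eq_iff matrix3_vector_mult_nth axis_def)
  have orth: "transpose Q ** Q = mat 1" "Q ** transpose Q = mat 1" and det: "det Q = 1"
    using Q by (simp_all add: rotation_matrix_def orthogonal_matrix_def)
  from orth(2) c3 have "Q $ 3 $ 1 * Q $ 3 $ 1 + Q $ 3 $ 2 * Q $ 3 $ 2 = 0"
    by (simp add: vec3_eq_iff matrix_matrix_mult_def sum_3 transpose_def mat_def)
  then have r3: "Q $ 3 $ 1 = 0" "Q $ 3 $ 2 = 0" by (simp_all add: sum_squares_eq_zero_iff)
  have o: "Q $ 1 $ 1 * Q $ 1 $ 1 + Q $ 1 $ 2 * Q $ 1 $ 2 = 1" "Q $ 1 $ 1 * Q $ 2 $ 1 + Q $ 1 $ 2 * Q $ 2 $ 2 = 0"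
    using orth(2) c3 by (simp_all add: vec3_eq_iff matrix_matrix_mult_def sum_3 transpose_def mat_def)
  have d: "Q $ 1 $ 1 * Q $ 2 $ 2 - Q $ 1 $ 2 * Q $ 2 $ 1 = 1"
    using det by (simp add: det_3 c3 r3)
  have q22: "Q $ 2 $ 2 = Q $ 1 $ 1" using o d by algebra
  have q21: "Q $ 2 $ 1 = - Q $ 1 $ 2" using o d by algebra
  define c where "c = csqrt (Complex (Q $ 1 $ 1) (Q $ 1 $ 2))"
  have c2: "c\<^sup>2 = Complex (Q $ 1 $ 1) (Q $ 1 $ 2)" by (simp add: c_def)
  have "(cmod (c\<^sup>2))\<^sup>2 = 1" unfolding c2 cmod_power2 using o(1) by (simp add: power2_eq_square)
  then have "(cmod c)\<^sup>2 = 1"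
    unfolding norm_power by (metis norm_ge_zero one_power2 power2_eq_iff_nonneg zero_le_one zero_le_power2)
  then have "spinor_matrix (cnj c) 0 \<in> SU2" "(cmod c)\<^sup>2 = 1" by (auto intro: spinor_matrix_SU2)
  moreover have "spin_matrix (spinor_matrix (cnj c) 0) = Q"
    using \<open>(cmod c)\<^sup>2 = 1\<close> unfolding cmod_power2 by (simp add: vec3_eq_iff spin_matrix_def Let_def c2 q21 q22 c3 r3)
  ultimately show ?thesis using that by blast
qed

text \<open>
  A rotation is determined up to a rotation about the third axis by its value on that axis.
\<close>

lemma spin_matrix_surj:
  assumes R: "rotation_matrix R"
  obtains A where "A \<in> SU2" "spin_matrix A = R"
proof -
  have "norm (R *v axis 3 1) = 1"
    using R by (metis norm_axis_1 orthogonal_transformation_matrix orthogonal_transformation_norm rotation_matrix_def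
        matrix_of_matrix_vector_mul matrix_vector_mul_linear)
  then obtain A where A: "A \<in> SU2" "spin_matrix A *v axis 3 1 = R *v axis 3 1"
    using spin_matrix_to_axis by metis
  let ?B = "spin_matrix A"
  have B: "orthogonal_matrix ?B" "det ?B = 1"
    using rotation_spin_matrix[OF A(1)] by (simp_all add: rotation_matrix_def)
  have "rotation_matrix (transpose ?B ** R)"
    using R B by (simp add: rotation_matrix_def det_mul orthogonal_matrix_mul orthogonal_matrix_transpose det_transpose)
  moreover have "(transpose ?B ** R) *v axis 3 1 = axis 3 1"
  proof -
    have "(transpose ?B ** R) *v axis 3 1 = (transpose ?B ** ?B) *v axis 3 1"
      by (simp add: A(2) flip: matrix_vector_mul_assoc)
    then show ?thesis using B by (simp add: orthogonal_matrix_def)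
  qed
  ultimately obtain D where D: "D \<in> SU2" "spin_matrix D = transpose ?B ** R"
    by (rule rotation_fixing_axis)
  have "spin_matrix (D ** A) = ?B ** (transpose ?B ** R)"
    by (simp add: spin_matrix_mult D A)
  also have "\<dots> = R" using B by (simp add: matrix_mul_assoc orthogonal_matrix_def)
  finally show ?thesis using that SU2_mult D(1) A(1) by blast
qed


section \<open>Spinors and vectors in 3-space\<close>

text \<open>
  The Hopf map, normalised so that \<open>|hopf q| = |q|\<^sup>2 / 2\<close>; on the level set with \<open>p = 0\<close> this
  length is \<open>\<alpha>\<close>.
\<close>

definition hopf :: "complex ^ 2 \<Rightarrow> real ^ 3" where
  "hopf q = pauli (col_row q (vec_star q))"

definition moment :: "complex ^ 2 \<Rightarrow> complex ^ 2 \<Rightarrow> real ^ 3" where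
  "moment p q = pauli (col_row q (vec_star q) - col_row (vec_star p) p)"

lemma col_row_nth [simp]: "col_row q p $ a $ b = q $ a * p $ b"
  by (simp add: col_row_def)

lemma vec_star_nth [simp]: "vec_star x $ a = cnj (x $ a)"
  by (simp add: vec_star_def)

lemma moment_hopf: "moment p q = hopf q - hopf (vec_star p)"
proof -
  have "vec_star (vec_star p) = p" by (simp add: vec_eq_iff)
  then show ?thesis by (simp add: moment_def hopf_def linear_diff[OF linear_pauli])
qed

lemma moment_0 [simp]: "moment 0 q = hopf q"
proof -
  have "col_row (vec_star 0) 0 = 0" by (simp add: matrix2_eq_iff)
  then show ?thesis by (simp add: moment_def hopf_def)
qed

lemma hopf_nth:
  "hopf q $ 1 = Re (q $ 1 * cnj (q $ 2))"
  "hopf q $ 2 = - Im (q $ 1 * cnj (q $ 2))"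
  "hopf q $ 3 = ((cmod (q $ 1))\<^sup>2 - (cmod (q $ 2))\<^sup>2) / 2"
  unfolding cmod_power2 by (simp_all add: hopf_def pauli_nth power2_eq_square)

lemma norm_hopf: "norm (hopf q) = (norm q)\<^sup>2 / 2"
proof -
  have "(norm (hopf q))\<^sup>2 = ((norm q)\<^sup>2 / 2)\<^sup>2"
    unfolding norm_vec3_squared norm_vec2_squared cmod_power2 hopf_nth
    by (simp add: power2_eq_square field_simps)
  then show ?thesis by (simp add: power2_eq_iff_nonneg)
qed

lemma hopf_surj:
  obtains q where "hopf q = v"
proof -
  let ?r = "norm v"
  have r2: "?r\<^sup>2 = (v $ 1)\<^sup>2 + (v $ 2)\<^sup>2 + (v $ 3)\<^sup>2" by (rule norm_vec3_squared)
  have "\<bar>v $ 3\<bar> \<le> ?r" by (rule component_le_norm_cart)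
  then consider "?r + v $ 3 = 0" | "?r + v $ 3 > 0" by linarith
  then show ?thesis
  proof cases
    case 1
    then have v3: "v $ 3 = - ?r" by simp
    then have "v $ 1 = 0" "v $ 2 = 0" using r2 by (simp_all add: sum_power2_eq_zero_iff)
    then have "hopf (vector [0, of_real (sqrt (2 * ?r))]) = v"
      using v3 by (simp add: vec3_eq_iff hopf_nth)
    then show ?thesis by (rule that)
  next
    case 2
    define a where "a = sqrt (?r + v $ 3)"
    have a: "a > 0" "a\<^sup>2 = ?r + v $ 3" using 2 by (simp_all add: a_def)
    have ne: "?r + v $ 3 \<noteq> 0" using 2 by simp
    let ?q = "vector [of_real a, Complex (v $ 1) (v $ 2) / of_real a] :: complex ^ 2"
    have "(cmod (?q $ 2))\<^sup>2 = (?r\<^sup>2 - (v $ 3)\<^sup>2) / a\<^sup>2"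
      using a by (simp add: norm_divide power_divide cmod_power2 r2)
    also have "\<dots> = ?r - v $ 3" unfolding a(2) using ne by (simp add: field_simps power2_eq_square)
    finally have "(cmod (?q $ 2))\<^sup>2 = ?r - v $ 3" .
    then have "hopf ?q $ 3 = v $ 3" using a by (simp only: hopf_nth) simp
    moreover have "hopf ?q $ 1 = v $ 1" "hopf ?q $ 2 = v $ 2"
      using a(1) by (simp_all add: hopf_nth)
    ultimately have "hopf ?q = v" by (simp add: vec3_eq_iff)
    then show ?thesis by (rule that)
  qed
qed

lemma hopf_eq_imp_phase:
  assumes h: "hopf q = hopf q'"
  obtains e where "cmod e = 1" "q' = e *s q"
proof -
  have n: "(norm q)\<^sup>2 = (norm q')\<^sup>2" using h norm_hopf[of q] norm_hopf[of q'] by simp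
  have off: "q $ 1 * cnj (q $ 2) = q' $ 1 * cnj (q' $ 2)"
    using h hopf_nth[of q] hopf_nth[of q'] by (simp add: complex_eq_iff)
  have "(cmod (q $ 1))\<^sup>2 = (cmod (q' $ 1))\<^sup>2" "(cmod (q $ 2))\<^sup>2 = (cmod (q' $ 2))\<^sup>2"
    using n hopf_nth(3)[of q] hopf_nth(3)[of q'] unfolding norm_vec2_squared h by argo+
  then have m: "cmod (q $ 1) = cmod (q' $ 1)" "cmod (q $ 2) = cmod (q' $ 2)"
    by (simp_all add: power2_eq_iff_nonneg)
  show ?thesis
  proof (cases "q $ 1 = 0")
    case True
    then have q1: "q' $ 1 = 0" using m by simp
    show ?thesis
    proof (cases "q $ 2 = 0")
      case True
      then show ?thesis using \<open>q $ 1 = 0\<close> q1 m by (intro that[of 1]) (auto simp: vec2_eq_iff)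
    next
      case False
      then show ?thesis using \<open>q $ 1 = 0\<close> q1 m
        by (intro that[of "q' $ 2 / q $ 2"]) (auto simp: vec2_eq_iff norm_divide)
    qed
  next
    case False
    define e where "e = q' $ 1 / q $ 1"
    have e: "cmod e = 1" "q' $ 1 = e * q $ 1" using False m by (auto simp: e_def norm_divide)
    then have ee: "e * cnj e = 1" by (metis complex_norm_square of_real_1 one_power2)
    have "q $ 1 * cnj (q $ 2) = e * q $ 1 * cnj (q' $ 2)" using off e by simp
    then have "cnj (q $ 2) = e * cnj (q' $ 2)" using False by simp
    then have "q $ 2 = cnj e * q' $ 2" by (metis complex_cnj_cnj complex_cnj_mult)
    then have "e * q $ 2 = (e * cnj e) * q' $ 2" by simp
    then have "q' $ 2 = e * q $ 2" by (simp add: ee)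
    then show ?thesis using e by (intro that[of e]) (auto simp: vec2_eq_iff)
  qed
qed

lemma hopf_scale: "hopf (c *s q) = (cmod c)\<^sup>2 *\<^sub>R hopf q"
  unfolding cmod_power2
  by (simp add: vec3_eq_iff hopf_nth[unfolded cmod_power2] power2_eq_square algebra_simps add_divide_distrib
      diff_divide_distrib)

lemma hopf_star_annihilator: "hopf (vec_star (annihilator q)) = - hopf q"
  by (simp add: vec3_eq_iff hopf_nth[unfolded cmod_power2] power2_eq_square field_simps)

lemma norm_annihilator: "norm (annihilator q) = norm q"
proof -
  have "(norm (annihilator q))\<^sup>2 = (norm q)\<^sup>2" by (simp add: norm_vec2_squared)
  then show ?thesis by simp
qed

lemma norm_smult_vec2: "norm (c *s x) = cmod c * norm x" for x :: "complex ^ 2"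
proof -
  have "(norm (c *s x))\<^sup>2 = (cmod c * norm x)\<^sup>2"
    unfolding power_mult_distrib norm_vec2_squared by (simp add: norm_mult power_mult_distrib algebra_simps)
  then show ?thesis by (simp add: power2_eq_iff_nonneg)
qed

text \<open>
  A row annihilating \<open>q\<close> has \<open>p\<^sup>*\<close> orthogonal to \<open>q\<close>, that is antipodal to it on the sphere, so the
  two contributions to the moment map reinforce one another.
\<close>

lemma moment_proportional_hopf:
  assumes "row_col p q = 0" "q \<noteq> 0"
  shows "moment p q = (((norm q)\<^sup>2 + (norm p)\<^sup>2) / (norm q)\<^sup>2) *\<^sub>R hopf q"
proof -
  obtain c where c: "p = c *s annihilator q" using assms by (rule row_col_zero_imp_annihilator)
  have "vec_star p = cnj c *s vec_star (annihilator q)" by (simp add: c vec_eq_iff)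
  then have "hopf (vec_star p) = - ((cmod c)\<^sup>2 *\<^sub>R hopf q)"
    by (simp add: hopf_scale hopf_star_annihilator)
  moreover have "((norm q)\<^sup>2 + (norm p)\<^sup>2) / (norm q)\<^sup>2 = 1 + (cmod c)\<^sup>2"
    using assms(2) by (simp add: c norm_smult_vec2 norm_annihilator field_simps)
  ultimately show ?thesis by (simp add: moment_hopf algebra_simps)
qed

lemma norm_moment:
  assumes "row_col p q = 0" "q \<noteq> 0"
  shows "norm (moment p q) = ((norm q)\<^sup>2 + (norm p)\<^sup>2) / 2"
  using assms(2) by (simp add: moment_proportional_hopf[OF assms] norm_hopf)

lemma norm_pauli_nilpotent:
  assumes "row_col p q = 0" "q \<noteq> 0"
  shows "norm (pauli (col_row q p)) = norm q * norm p / 2"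
proof -
  obtain c where c: "p = c *s annihilator q" using assms by (rule row_col_zero_imp_annihilator)
  \<comment> \<open>With a square root of \<open>c\<close> absorbed into \<open>q\<close>, the entries become quadratic monomials.\<close>
  define r where "r = csqrt c"
  define x y where "x = r * q $ 1" and "y = r * q $ 2"
  have rr: "c = r * r" by (simp add: r_def flip: power2_eq_square)
  have "(norm (pauli (col_row q p)))\<^sup>2
      = (((Re x)\<^sup>2 + (Im x)\<^sup>2 + (Re y)\<^sup>2 + (Im y)\<^sup>2) / 2)\<^sup>2"
  proof -
    have M: "q $ 1 * p $ 1 = - (x * y)" "q $ 1 * p $ 2 = x * x" "q $ 2 * p $ 1 = - (y * y)" "q $ 2 * p $ 2 = x * y"
      by (simp_all add: c rr x_def y_def algebra_simps)
    show ?thesis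
      unfolding norm_vec3_squared pauli_nth col_row_nth M by (simp add: power2_eq_square field_simps)
  qed
  also have "(Re x)\<^sup>2 + (Im x)\<^sup>2 + (Re y)\<^sup>2 + (Im y)\<^sup>2 = (cmod x)\<^sup>2 + (cmod y)\<^sup>2"
    by (simp add: cmod_power2)
  also have "\<dots> = (cmod r * norm q)\<^sup>2"
    by (simp add: x_def y_def norm_vec2_squared norm_mult power_mult_distrib distrib_left)
  also have "(cmod r * norm q)\<^sup>2 = norm q * norm p"
    by (simp add: c rr norm_smult_vec2 norm_annihilator norm_mult power2_eq_square)
  finally show ?thesis by (simp add: power2_eq_iff_nonneg)
qed

lemma pauli_nilpotent_orthogonal:
  assumes "row_col p q = 0" "q \<noteq> 0"
  shows "pauli (col_row q p) \<bullet> hopf q = 0"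
proof -
  obtain c where c: "p = c *s annihilator q" using assms by (rule row_col_zero_imp_annihilator)
  show ?thesis
    unfolding c inner_vec_def sum_3 pauli_nth hopf_nth col_row_nth cmod_power2
    by (simp add: power2_eq_square field_simps)
qed

text \<open>
  The rows annihilating \<open>q\<close> form a complex line, on which \<open>p \<mapsto> q p\<close> is conformal.
\<close>

lemma annihilator_inj:
  assumes "pauli (col_row q p) = pauli (col_row q p')" "row_col p q = 0" "row_col p' q = 0" "q \<noteq> 0"
  shows "p = p'"
proof -
  have "row_col (p - p') q = 0" using assms(2,3) unfolding row_col_2 vector_minus_component by algebra
  moreover have "pauli (col_row q (p - p')) = 0"
  proof -
    have "col_row q (p - p') = col_row q p - col_row q p'" by (simp add: matrix2_eq_iff algebra_simps)
    then show ?thesis using assms(1) by (simp add: linear_diff[OF linear_pauli])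
  qed
  ultimately show ?thesis using norm_pauli_nilpotent[of "p - p'" q] assms(4) by simp
qed

section \<open>The level set of the moment maps\<close>

lemma mu_R_level_iff:
  "x \<in> mu_R_level \<alpha> \<longleftrightarrow> (\<Sum>i\<in>UNIV. moment (fst x $ i) (snd x $ i)) = 0 \<and>
     (\<forall>i. (norm (snd x $ i))\<^sup>2 - (norm (fst x $ i))\<^sup>2 = 2 * \<alpha> i)"
proof -
  define H where "H i = col_row (snd x $ i) (vec_star (snd x $ i)) - col_row (vec_star (fst x $ i)) (fst x $ i)" for i
  define M where "M = (\<Sum>i\<in>UNIV. H i)"
  have "H i $ 2 $ 1 = cnj (H i $ 1 $ 2)" "Im (H i $ 1 $ 1) = 0" "Im (H i $ 2 $ 2) = 0" for i
    by (simp_all add: H_def)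
  then have herm: "M $ 2 $ 1 = cnj (M $ 1 $ 2)" "Im (M $ 1 $ 1) = 0" "Im (M $ 2 $ 2) = 0"
    by (simp_all add: M_def sum_component)
  have "(\<Sum>i\<in>UNIV. traceless (H i)) = traceless M"
  proof -
    have "linear traceless"
      by (rule linearI) (simp_all add: matrix2_eq_iff traceless_def trace_def sum_2 mat_def complex_eq_iff field_simps)
    then show ?thesis by (simp add: M_def linear_sum)
  qed
  moreover have "(\<Sum>i\<in>UNIV. moment (fst x $ i) (snd x $ i)) = pauli M"
    by (simp add: moment_def M_def H_def linear_sum[OF linear_pauli])
  moreover have "traceless M = 0 \<longleftrightarrow> pauli M = 0"
    using herm
    by (auto simp: matrix2_eq_iff vec3_eq_iff traceless_def trace_def sum_2 mat_def pauli_nth complex_eq_iff field_simps)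
  ultimately show ?thesis
    by (cases x) (auto simp: mu_R_level_def H_def)
qed

lemma moment_act:
  assumes "A \<in> SU2" "cmod (e $ i) = 1"
  shows "moment (fst (act A e x) $ i) (snd (act A e x) $ i) = spin_matrix A *v moment (fst x $ i) (snd x $ i)"
proof -
  let ?H = "\<lambda>x. col_row (snd x $ i) (vec_star (snd x $ i)) - col_row (vec_star (fst x $ i)) (fst x $ i)"
  have ee: "e $ i * cnj (e $ i) = 1" using assms(2) by (metis complex_norm_square of_real_1 one_power2)
  have ii: "inverse (e $ i) * inverse (cnj (e $ i)) = 1" using ee by (metis inverse_1 inverse_mult_distrib)
  have A: "A $ 2 $ 1 = - cnj (A $ 1 $ 2)" "A $ 2 $ 2 = cnj (A $ 1 $ 1)" using assms(1) by (auto simp: SU2_iff)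
  have star: "vec_star (c *s (adjugate A *v q)) = cnj c *s (vec_star q v* A)"
    "vec_star (c *s (p v* A)) = cnj c *s (adjugate A *v vec_star p)" for c p q
    by (simp_all add: vec2_eq_iff nth2_simps A)
  have smult: "col_row (c *s q) (d *s p) = (\<chi> a b. (c * d) * col_row q p $ a $ b)" for c d p q
    by (simp add: matrix2_eq_iff algebra_simps)
  have "?H (act A e x) = adjugate A ** ?H x ** A"
    unfolding act_nth matrix_inv_SL2[OF SU2_SL2[OF assms(1)]] star smult
    by (simp add: ee ii mult.commute[of "inverse (cnj (e $ i))"])
       (simp add: matrix2_eq_iff nth2_simps algebra_simps)
  then show ?thesis by (simp add: moment_def spin_matrix_pauli assms)
qed

lemma pauli_col_row_act:
  assumes "A \<in> SU2" "cmod (e $ i) = 1"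
  shows "pauli (col_row (snd (act A e x) $ i) (fst (act A e x) $ i)) = spin_matrix A *v pauli (col_row (snd x $ i) (fst x $ i))"
proof -
  have "e $ i \<noteq> 0" using assms by auto
  then have "col_row (snd (act A e x) $ i) (fst (act A e x) $ i) = adjugate A ** col_row (snd x $ i) (fst x $ i) ** A"
    by (simp add: matrix2_eq_iff act_nth matrix_inv_SL2 SU2_SL2[OF assms(1)] nth2_simps field_simps)
  then show ?thesis by (simp add: spin_matrix_pauli assms)
qed

lemma norm_act:
  assumes "A \<in> SU2"
  shows "norm (snd (act A e x) $ i) = cmod (e $ i) * norm (snd x $ i)"
    "norm (fst (act A e x) $ i) = norm (fst x $ i) / cmod (e $ i)"
  using assms by (simp_all add: act_nth matrix_inv_SL2 SU2_SL2 norm_smult_vec2 norm_SU2_column norm_SU2_row SU2_adjugate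
      norm_inverse divide_inverse mult.commute)

lemma mu_R_level_act:
  assumes "A \<in> SU2" "\<And>i. cmod (e $ i) = 1" "x \<in> mu_R_level \<alpha>"
  shows "act A e x \<in> mu_R_level \<alpha>"
proof -
  have "(\<Sum>i\<in>UNIV. moment (fst (act A e x) $ i) (snd (act A e x) $ i))
      = spin_matrix A *v (\<Sum>i\<in>UNIV. moment (fst x $ i) (snd x $ i))"
    by (simp add: moment_act assms linear_sum[OF matrix_vector_mul_linear])
  then show ?thesis using assms by (simp add: mu_R_level_iff norm_act)
qed

text \<open>
  When the \<open>q\<^sub>i\<close> are proportional, their moment vectors are positive multiples of one vector.
\<close>

lemma straight_moment_sum:
  assumes rc: "\<And>i. row_col (p i) (q i) = 0" and q0: "\<And>i. q i \<noteq> 0" and T: "finite T"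
    and w: "\<And>i j. i \<in> T \<Longrightarrow> j \<in> T \<Longrightarrow> wedge (q i) (q j) = 0" and k: "k \<in> T"
  obtains c where "c > 0" "(\<Sum>i\<in>T. moment (p i) (q i)) = c *\<^sub>R hopf (q k)"
    "norm (\<Sum>i\<in>T. moment (p i) (q i)) = (\<Sum>i\<in>T. norm (moment (p i) (q i)))"
proof -
  have "\<exists>c>0. moment (p i) (q i) = c *\<^sub>R hopf (q k)" if "i \<in> T" for i
  proof -
    have "wedge (q i) (q k) = 0" using w that k by blast
    then obtain c where c: "q i = c *s q k" using wedge_zero_iff_proportional[OF q0] by blast
    then have c0: "c \<noteq> 0" using q0[of i] by auto
    define d where "d = ((norm (q i))\<^sup>2 + (norm (p i))\<^sup>2) / (norm (q i))\<^sup>2"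
    have d: "d > 0" unfolding d_def using q0[of i] by (intro divide_pos_pos add_pos_nonneg) simp_all
    have "moment (p i) (q i) = d *\<^sub>R hopf (c *s q k)"
      unfolding c[symmetric] d_def by (rule moment_proportional_hopf[OF rc q0])
    then have "moment (p i) (q i) = (d * (cmod c)\<^sup>2) *\<^sub>R hopf (q k)" by (simp add: hopf_scale)
    moreover have "d * (cmod c)\<^sup>2 > 0" using d c0 by simp
    ultimately show ?thesis by blast
  qed
  then obtain c where c: "\<And>i. i \<in> T \<Longrightarrow> c i > 0" "\<And>i. i \<in> T \<Longrightarrow> moment (p i) (q i) = c i *\<^sub>R hopf (q k)" by metis
  have pos: "sum c T > 0" using c(1) k T by (intro sum_pos) auto
  have sum: "(\<Sum>i\<in>T. moment (p i) (q i)) = sum c T *\<^sub>R hopf (q k)"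
    by (simp add: c(2) flip: scaleR_left.sum)
  have "(\<Sum>i\<in>T. norm (moment (p i) (q i))) = sum c T * norm (hopf (q k))"
    unfolding sum_distrib_right using c(1) by (intro sum.cong) (auto simp: c(2) less_imp_le)
  then have "norm (\<Sum>i\<in>T. moment (p i) (q i)) = (\<Sum>i\<in>T. norm (moment (p i) (q i)))"
    using pos by (simp add: sum)
  then show ?thesis using pos sum that by blast
qed

text \<open>
  If \<open>T\<close> is straight and \<open>p\<close> vanishes off \<open>T\<close>, the moment vectors of \<open>T\<close> are parallel and balance
  those off \<open>T\<close>; the triangle inequality gives \<open>\<Sum>\<^sub>T \<alpha> \<le> \<Sum>\<^sub>T\<^sup>c \<alpha>\<close>, and
  genericity makes it strict.
\<close>

lemma level_imp_stable:
  fixes x :: "'n::finite point"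
  assumes gen: "generic \<alpha>" and pos: "\<And>i. \<alpha> i > 0"
    and x: "x \<in> mu_R_level \<alpha>" "x \<in> mu_C_zero"
  shows "stable \<alpha> x"
proof -
  define p q where "p i = fst x $ i" and "q i = snd x $ i" for i
  have lev: "(\<Sum>i\<in>UNIV. moment (p i) (q i)) = 0" "(norm (q i))\<^sup>2 - (norm (p i))\<^sup>2 = 2 * \<alpha> i" for i
    using x(1) by (simp_all add: mu_R_level_iff p_def q_def)
  have rc: "row_col (p i) (q i) = 0" for i using x(2) by (simp add: mu_C_zero_iff p_def q_def)
  have q0: "q i \<noteq> 0" for i
  proof
    assume "q i = 0"
    then have "- (norm (p i))\<^sup>2 = 2 * \<alpha> i" using lev(2)[of i] by simp
    then show False using pos[of i] zero_le_power2[of "norm (p i)"] by linarith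
  qed
  have nm: "norm (moment (p i) (q i)) = ((norm (q i))\<^sup>2 + (norm (p i))\<^sup>2) / 2" for i
    by (rule norm_moment[OF rc q0])
  have le: "\<alpha> i \<le> norm (moment (p i) (q i))" for i
    unfolding nm using lev(2)[of i] zero_le_power2[of "norm (p i)"] by argo
  have "short \<alpha> T" if T: "\<forall>i\<in>T. \<forall>j\<in>T. wedge (q i) (q j) = 0" "\<forall>j\<in>-T. p j = 0" for T
  proof (cases "T = {}")
    case True
    then show ?thesis
      using pos sum_pos[of "UNIV :: 'n set" \<alpha>] by (simp add: short_def)
  next
    case False
    then obtain k where k: "k \<in> T" by blast
    have wT: "\<And>i j. i \<in> T \<Longrightarrow> j \<in> T \<Longrightarrow> wedge (q i) (q j) = 0" using T(1) by blast
    have "(\<Sum>i\<in>T. \<alpha> i) \<le> (\<Sum>i\<in>T. norm (moment (p i) (q i)))"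
      by (intro sum_mono le)
    also have "\<dots> = norm (\<Sum>i\<in>T. moment (p i) (q i))"
      by (rule straight_moment_sum[where p = p and q = q and T = T and k = k]) (use rc q0 wT k in auto)
    also have "(\<Sum>i\<in>T. moment (p i) (q i)) = - (\<Sum>j\<in>-T. moment (p j) (q j))"
      using lev(1) sum.subset_diff[of T UNIV "\<lambda>i. moment (p i) (q i)"]
      by (simp add: Compl_eq_Diff_UNIV eq_neg_iff_add_eq_0 add.commute)
    also have "norm \<dots> \<le> (\<Sum>j\<in>-T. norm (moment (p j) (q j)))" by (simp add: norm_sum)
    also have "\<dots> = (\<Sum>j\<in>-T. \<alpha> j)"
    proof (rule sum.cong[OF refl])
      fix j assume "j \<in> - T"
      then have "p j = 0" using T(2) by blast
      then show "norm (moment (p j) (q j)) = \<alpha> j" using lev(2)[of j] by (simp add: norm_hopf)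
    qed
    finally have "(\<Sum>i\<in>T. \<alpha> i) \<le> (\<Sum>j\<in>-T. \<alpha> j)" .
    then show ?thesis using gen by (auto simp: generic_def short_def less_le)
  qed
  then show ?thesis using q0 by (auto simp: stable_iff_wedge p_def q_def)
qed


section \<open>Orbits with convergent representatives\<close>

lemma tendsto_act:
  fixes x :: "'b \<Rightarrow> 'n::finite point"
  assumes A: "(A \<longlongrightarrow> A0) F" "\<And>k. A k \<in> SL2" "A0 \<in> SL2"
    and e: "(e \<longlongrightarrow> e0) F" "\<And>i. e0 $ i \<noteq> 0" and x: "(x \<longlongrightarrow> x0) F"
  shows "((\<lambda>k. act (A k) (e k) (x k)) \<longlongrightarrow> act A0 e0 x0) F"
proof -
  have "((\<lambda>k. fst (act (A k) (e k) (x k)) $ i $ a) \<longlongrightarrow> fst (act A0 e0 x0) $ i $ a) F" for i a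
    by (simp add: act_nth nth2_simps; intro tendsto_intros A(1) e x)
  moreover have "((\<lambda>k. snd (act (A k) (e k) (x k)) $ i $ a) \<longlongrightarrow> snd (act A0 e0 x0) $ i $ a) F" for i a
    using exhaust_2[of a]
    by (elim disjE; simp add: act_SL2_nth A(2,3) nth2_simps; intro tendsto_intros A(1) e x)
  ultimately have "((\<lambda>k. (fst (act (A k) (e k) (x k)), snd (act (A k) (e k) (x k))))
      \<longlongrightarrow> (fst (act A0 e0 x0), snd (act A0 e0 x0))) F"
    by (intro tendsto_Pair vec_tendstoI)
  then show ?thesis by simp
qed

lemma dilation_act_nth:
  assumes "t > 0"
  shows "snd (act (dilation (inverse t)) e x) $ i $ 1 = e $ i * t * snd x $ i $ 1"
    "snd (act (dilation (inverse t)) e x) $ i $ 2 = e $ i * snd x $ i $ 2 / t"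
    "fst (act (dilation (inverse t)) e x) $ i $ 1 = fst x $ i $ 1 / (e $ i * t)"
    "fst (act (dilation (inverse t)) e x) $ i $ 2 = t * fst x $ i $ 2 / e $ i"
  using assms by (simp_all add: act_nth matrix_inv_SL2 dilation_SL2 nth2_simps divide_inverse)

lemma short_sets_not_cover:
  fixes \<alpha> :: "'n::finite \<Rightarrow> real"
  assumes "\<And>i. \<alpha> i > 0" "short \<alpha> T" "short \<alpha> T'"
  shows "T \<union> T' \<noteq> UNIV"
proof
  assume U: "T \<union> T' = UNIV"
  have s: "sum \<alpha> T + sum \<alpha> (- T) = sum \<alpha> UNIV" for T
    using sum.subset_diff[of T UNIV \<alpha>] by (simp add: Compl_eq_Diff_UNIV)
  have "sum \<alpha> (- T) \<le> sum \<alpha> T'"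
    using U assms(1) by (intro sum_mono2) (auto simp: less_imp_le)
  then show False using s[of T] s[of T'] assms(2,3) by (simp add: short_def)
qed

text \<open>
  The reason the stable quotient is separated: if a pair of convergent families is matched by
  dilations tending to infinity, the coordinates which are contracted vanish in one limit and those
  which are expanded vanish in the other.  Each index is then aligned with the first axis in the
  limit of \<open>x\<close>, or with the second axis in the limit of \<open>y\<close>, and stability of the two limits makes
  the two resulting sets short, although they cover all indices.
\<close>

lemma no_degenerating_dilation:
  fixes x y :: "nat \<Rightarrow> 'n::finite point"
  assumes pos: "\<And>i. \<alpha> i > 0"
    and x: "x \<longlonglongrightarrow> x0" "x0 \<in> stable_points \<alpha>" and y: "y \<longlonglongrightarrow> y0" "y0 \<in> stable_points \<alpha>"
    and t: "\<And>k. t k > 0" and e: "\<And>k i. e k $ i \<noteq> 0"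
    and xy: "\<And>k. y k = act (dilation (inverse (t k))) (e k) (x k)"
  shows "\<not> t \<longlonglongrightarrow> 0"
proof
  assume t0: "t \<longlonglongrightarrow> 0"
  then have t0': "(\<lambda>k. complex_of_real (t k)) \<longlonglongrightarrow> 0" using tendsto_of_real by fastforce
  have t2: "(\<lambda>k. complex_of_real (t k * t k)) \<longlonglongrightarrow> 0" using tendsto_mult[OF t0' t0'] by simp
  have tn: "complex_of_real (t k) \<noteq> 0" for k using t[of k] by simp
  have lim: "(\<lambda>k. snd (x k) $ i $ a) \<longlonglongrightarrow> snd x0 $ i $ a" "(\<lambda>k. fst (x k) $ i $ a) \<longlonglongrightarrow> fst x0 $ i $ a"
    "(\<lambda>k. snd (y k) $ i $ a) \<longlonglongrightarrow> snd y0 $ i $ a" "(\<lambda>k. fst (y k) $ i $ a) \<longlonglongrightarrow> fst y0 $ i $ a" for i a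
    by (intro tendsto_intros x y)+
  have uniq: "a = b" if "f \<longlonglongrightarrow> a" "f \<longlonglongrightarrow> b" for f :: "nat \<Rightarrow> complex" and a b
    using LIMSEQ_unique that by blast
  have c: "snd (y k) $ i $ 1 = e k $ i * t k * snd (x k) $ i $ 1" "snd (y k) $ i $ 2 = e k $ i * snd (x k) $ i $ 2 / t k"
    "fst (y k) $ i $ 1 = fst (x k) $ i $ 1 / (e k $ i * t k)" "fst (y k) $ i $ 2 = t k * fst (x k) $ i $ 2 / e k $ i" for k i
    unfolding xy by (rule dilation_act_nth[OF t])+
  have rc: "fst z $ i $ 1 * snd z $ i $ 1 + fst z $ i $ 2 * snd z $ i $ 2 = 0" if "z \<in> stable_points \<alpha>" for z i
    using that by (simp add: stable_points_def mu_C_zero_iff row_col_2)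
  define T where "T = {i. snd x0 $ i $ 2 = 0}"
  define T' where "T' = {i. snd y0 $ i $ 1 = 0}"
  have off_T: "snd y0 $ i $ 1 = 0 \<and> fst x0 $ i = 0" if "i \<notin> T" for i
  proof -
    have n: "snd x0 $ i $ 2 \<noteq> 0" using that by (simp add: T_def)
    have ev: "eventually (\<lambda>k. snd (x k) $ i $ 2 \<noteq> 0) sequentially"
      by (rule tendsto_imp_eventually_ne[OF lim(1) n])
    have "(\<lambda>k. snd (y k) $ i $ 2 / snd (x k) $ i $ 2 * (t k * t k)) \<longlonglongrightarrow> snd y0 $ i $ 2 / snd x0 $ i $ 2 * 0"
      by (intro tendsto_divide tendsto_mult lim n t2)
    then have et: "(\<lambda>k. e k $ i * t k) \<longlonglongrightarrow> 0"
      unfolding mult_zero_right by (rule Lim_transform_eventually)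
         (use ev in \<open>eventually_elim, use tn in \<open>simp add: c field_simps\<close>\<close>)
    have "(\<lambda>k. snd (y k) $ i $ 1) \<longlonglongrightarrow> 0 * snd x0 $ i $ 1"
      unfolding c(1) by (intro tendsto_intros lim et)
    then have "snd y0 $ i $ 1 = 0" using uniq[OF lim(3)] by simp
    moreover have "(\<lambda>k. fst (x k) $ i $ 1) \<longlonglongrightarrow> 0 * fst y0 $ i $ 1"
    proof -
      have "fst (x k) $ i $ 1 = e k $ i * t k * fst (y k) $ i $ 1" for k
        using e[of k i] tn[of k] by (simp add: c)
      then show ?thesis by simp (use tendsto_mult[OF et lim(4)[of i 1]] in simp)
    qed
    then have "fst x0 $ i $ 1 = 0" using uniq[OF lim(2)] by simp
    ultimately show ?thesis using rc[OF x(2), of i] n by (simp add: vec2_eq_iff)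
  qed
  have off_T': "fst y0 $ i = 0" if "i \<notin> T'" for i
  proof -
    have n: "snd y0 $ i $ 1 \<noteq> 0" using that by (simp add: T'_def)
    have ev: "eventually (\<lambda>k. snd (y k) $ i $ 1 \<noteq> 0) sequentially"
      by (rule tendsto_imp_eventually_ne[OF lim(3) n])
    have "(\<lambda>k. (t k * t k) * (snd (x k) $ i $ 1 / snd (y k) $ i $ 1) * fst (x k) $ i $ 2)
        \<longlonglongrightarrow> 0 * (snd x0 $ i $ 1 / snd y0 $ i $ 1) * fst x0 $ i $ 2"
      by (intro tendsto_divide tendsto_mult lim n t2)
    then have "(\<lambda>k. fst (y k) $ i $ 2) \<longlonglongrightarrow> 0"
      unfolding mult_zero_left by (rule Lim_transform_eventually)
         (use ev in \<open>eventually_elim, use tn e in \<open>simp add: c field_simps\<close>\<close>)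
    then have "fst y0 $ i $ 2 = 0" using uniq[OF lim(4)] by simp
    then show ?thesis using rc[OF y(2), of i] n by (simp add: vec2_eq_iff)
  qed
  have "short \<alpha> T" using x(2) off_T by (auto simp: stable_points_def stable_iff_wedge wedge_def T_def)
  moreover have "short \<alpha> T'" using y(2) off_T' by (auto simp: stable_points_def stable_iff_wedge wedge_def T'_def)
  moreover have "T \<union> T' = UNIV" using off_T by (auto simp: T'_def)
  ultimately show False using short_sets_not_cover pos by blast
qed

text \<open>
  By the polar decomposition the only way for matching group elements to leave every compact set is
  through the dilation factor; once that converges, the scalars converge as well because every
  \<open>q\<^sub>i\<close> is nonzero in both limits.
\<close>

lemma G_orbit_limit:
  fixes x y :: "nat \<Rightarrow> 'n::finite point"
  assumes pos: "\<And>i. \<alpha> i > 0"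
    and x: "x \<longlonglongrightarrow> x0" "x0 \<in> stable_points \<alpha>" and y: "y \<longlonglongrightarrow> y0" "y0 \<in> stable_points \<alpha>"
    and xy: "\<And>k. y k \<in> G_orbit (x k)"
  shows "y0 \<in> G_orbit x0"
proof -
  let ?D = "\<lambda>t. dilation (inverse t)"
  let ?one = "\<chi> i. 1 :: complex ^ 'n"
  have "\<exists>U V t e. U \<in> SU2 \<and> V \<in> SU2 \<and> 0 < t \<and> t \<le> 1 \<and> (\<forall>i. e $ i \<noteq> 0) \<and>
      act V (\<chi> i. 1) (y k) = act (?D t) e (act U (\<chi> i. 1) (x k))" for k
  proof -
    obtain A e where A: "A \<in> SL2" "\<forall>i. e $ i \<noteq> 0" "y k = act A e (x k)"
      using xy[of k] by (auto simp: G_orbit_def)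
    obtain U t V where d: "U \<in> SU2" "V \<in> SU2" "0 < t" "t \<le> 1" "A = U ** ?D t ** V"
      using SL2_KAK[OF A(1)] .
    have sl: "U \<in> SL2" "?D t \<in> SL2" "V \<in> SL2" "adjugate V \<in> SL2"
      using d by (auto simp: SU2_SL2 dilation_SL2 SL2_adjugate)
    have "A ** adjugate V = U ** ?D t"
      by (simp add: d(5) SL2_adjugate_mult sl flip: matrix_mul_assoc)
    then have "act (adjugate V) (\<chi> i. 1) (y k) = act (?D t) e (act U (\<chi> i. 1) (x k))"
      by (simp add: A(3) act_act A(1) sl)
    then show ?thesis using d A(2) SU2_adjugate by blast
  qed
  then obtain U V t e where
    UV: "\<And>k. U k \<in> SU2" "\<And>k. V k \<in> SU2" and t: "\<And>k. 0 < t k" "\<And>k. t k \<le> 1" and e: "\<And>k i. e k $ i \<noteq> 0"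
    and eq: "\<And>k. act (V k) (\<chi> i. 1) (y k) = act (?D (t k)) (e k) (act (U k) (\<chi> i. 1) (x k))"
    by metis
  have "seq_compact (SU2 \<times> SU2 \<times> {0..1::real})"
    using compact_SU2 by (intro compact_imp_seq_compact compact_Times) auto
  moreover have "\<forall>k. (U k, V k, t k) \<in> SU2 \<times> SU2 \<times> {0..1::real}" using UV t by (auto simp: less_imp_le)
  ultimately obtain l r where l: "l \<in> SU2 \<times> SU2 \<times> {0..1::real}" "strict_mono r"
      "((\<lambda>k. (U k, V k, t k)) \<circ> r) \<longlonglongrightarrow> l"
    by (rule seq_compactE)
  obtain U0 V0 t0 where l0: "l = (U0, V0, t0)" by (cases l)
  have UV0: "U0 \<in> SU2" "V0 \<in> SU2" using l(1) l0 by auto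
  have lims: "(\<lambda>k. U (r k)) \<longlonglongrightarrow> U0" "(\<lambda>k. V (r k)) \<longlonglongrightarrow> V0" "(\<lambda>k. t (r k)) \<longlonglongrightarrow> t0"
    using tendsto_fst[OF l(3)] tendsto_fst[OF tendsto_snd[OF l(3)]] tendsto_snd[OF tendsto_snd[OF l(3)]]
    by (simp_all add: l0 o_def)
  have xr: "(\<lambda>k. x (r k)) \<longlonglongrightarrow> x0" and yr: "(\<lambda>k. y (r k)) \<longlonglongrightarrow> y0"
    using LIMSEQ_subseq_LIMSEQ[OF x(1) l(2)] LIMSEQ_subseq_LIMSEQ[OF y(1) l(2)] by (simp_all add: o_def)
  define x' where "x' k = act (U (r k)) (\<chi> i. 1) (x (r k))" for k
  define y' where "y' k = act (V (r k)) (\<chi> i. 1) (y (r k))" for k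
  define x1 where "x1 = act U0 (\<chi> i. 1) x0"
  define y1 where "y1 = act V0 (\<chi> i. 1) y0"
  have x': "x' \<longlonglongrightarrow> x1" unfolding x'_def x1_def by (rule tendsto_act[OF lims(1) _ _ tendsto_const _ xr]) (auto simp: SU2_SL2 UV UV0)
  have y': "y' \<longlonglongrightarrow> y1" unfolding y'_def y1_def by (rule tendsto_act[OF lims(2) _ _ tendsto_const _ yr]) (auto simp: SU2_SL2 UV UV0)
  have st: "x1 \<in> stable_points \<alpha>" "y1 \<in> stable_points \<alpha>"
    unfolding x1_def y1_def by (auto intro!: stable_points_act SU2_SL2 UV0 x y)
  have xy': "y' k = act (?D (t (r k))) (e (r k)) (x' k)" for k by (simp add: x'_def y'_def eq)
  have "t0 \<noteq> 0" using no_degenerating_dilation[OF pos x' st(1) y' st(2) t(1) e xy'] lims(3) by auto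
  then have t0: "t0 > 0" using l(1) l0 by auto
  have "\<exists>c. (\<lambda>k. e (r k) $ i) \<longlonglongrightarrow> c \<and> c \<noteq> 0" for i
  proof -
    have q: "snd x1 $ i \<noteq> 0" "snd y1 $ i \<noteq> 0" using st by (auto simp: stable_points_def stable_iff_wedge)
    have lim: "(\<lambda>k. snd (x' k) $ i $ a) \<longlonglongrightarrow> snd x1 $ i $ a" "(\<lambda>k. snd (y' k) $ i $ a) \<longlonglongrightarrow> snd y1 $ i $ a" for a
      by (intro tendsto_intros x' y')+
    define w where "w k a = (if a = 1 then complex_of_real (t (r k)) else inverse (t (r k)))" for k and a :: 2
    define w0 where "w0 a = (if a = 1 then complex_of_real t0 else inverse t0)" for a :: 2
    have w: "(\<lambda>k. w k a) \<longlonglongrightarrow> w0 a" "w0 a \<noteq> 0" for a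
      unfolding w_def w0_def using t0 by (auto intro!: tendsto_intros lims(3))
    have yx: "snd (y' k) $ i $ a = e (r k) $ i * (w k a * snd (x' k) $ i $ a)" for k a
      using exhaust_2[of a] by (auto simp: xy' dilation_act_nth[OF t(1)] w_def divide_inverse)
    obtain a where a: "snd x1 $ i $ a \<noteq> 0" using q(1) by (auto simp: vec_eq_iff)
    have ne: "w0 a * snd x1 $ i $ a \<noteq> 0" using a w(2) by simp
    have wx: "(\<lambda>k. w k b * snd (x' k) $ i $ b) \<longlonglongrightarrow> w0 b * snd x1 $ i $ b" for b by (intro tendsto_intros w lim)
    have ev: "eventually (\<lambda>k. w k a * snd (x' k) $ i $ a \<noteq> 0) sequentially"
      by (rule tendsto_imp_eventually_ne[OF wx ne])
    have "(\<lambda>k. snd (y' k) $ i $ a / (w k a * snd (x' k) $ i $ a)) \<longlonglongrightarrow> snd y1 $ i $ a / (w0 a * snd x1 $ i $ a)"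
      by (intro tendsto_divide lim wx ne)
    then have c: "(\<lambda>k. e (r k) $ i) \<longlonglongrightarrow> snd y1 $ i $ a / (w0 a * snd x1 $ i $ a)" (is "_ \<longlonglongrightarrow> ?c")
      by (rule Lim_transform_eventually) (use ev in \<open>eventually_elim, simp add: yx\<close>)
    moreover have "?c \<noteq> 0"
    proof
      assume z: "?c = 0"
      have "snd y1 $ i $ b = 0" for b
      proof -
        have "(\<lambda>k. snd (y' k) $ i $ b) \<longlonglongrightarrow> 0 * (w0 b * snd x1 $ i $ b)"
          unfolding yx using c[unfolded z] by (intro tendsto_mult wx)
        then show ?thesis using LIMSEQ_unique[OF lim(2)] by fastforce
      qed
      then show False using q(2) by (simp add: vec_eq_iff)
    qed
    ultimately show ?thesis by blast
  qed
  then obtain c where c: "\<And>i. (\<lambda>k. e (r k) $ i) \<longlonglongrightarrow> c i" "\<And>i. c i \<noteq> 0" by metis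
  have "(\<lambda>k. e (r k)) \<longlonglongrightarrow> (\<chi> i. c i)" using c by (intro vec_tendstoI) simp
  moreover have "(\<lambda>k. ?D (t (r k))) \<longlonglongrightarrow> ?D t0"
  proof (intro vec_tendstoI)
    fix a b show "(\<lambda>k. ?D (t (r k)) $ a $ b) \<longlonglongrightarrow> ?D t0 $ a $ b"
      using exhaust_2[of a] exhaust_2[of b] t0 by (elim disjE; simp; intro tendsto_intros lims(3)) simp_all
  qed
  ultimately have "(\<lambda>k. act (?D (t (r k))) (e (r k)) (x' k)) \<longlonglongrightarrow> act (?D t0) (\<chi> i. c i) x1"
    using t0 c(2) t(1) by (intro tendsto_act x') (auto simp: dilation_SL2 less_imp_neq[symmetric])
  then have "y1 = act (?D t0) (\<chi> i. c i) x1"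
    using y' LIMSEQ_unique unfolding xy'[symmetric] by blast
  then have "G_orbit y1 = G_orbit x1" using t0 c(2) by (simp add: G_orbit_act dilation_SL2)
  moreover have "G_orbit x1 = G_orbit x0" "G_orbit y1 = G_orbit y0"
    unfolding x1_def y1_def by (rule G_orbit_act; simp add: UV0 SU2_SL2)+
  ultimately show ?thesis using G_orbit_eq_iff by metis
qed


section \<open>Uniqueness of level points in an orbit\<close>

text \<open>
  The contribution of a coordinate with squared norm \<open>a\<close>, scaled by a factor with square \<open>X\<close>, to the
  difference of the derivatives of the energy at the two ends of a one-parameter family.
\<close>

lemma ln_weight_nonneg:
  fixes X a :: real
  assumes "X > 0" "a \<ge> 0"
  shows "ln X * (X * a - a) \<ge> 0" "ln X * (X * a - a) = 0 \<Longrightarrow> a = 0 \<or> X = 1"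
proof -
  have *: "ln X * (X * a - a) = (ln X * (X - 1)) * a" by (simp add: algebra_simps)
  have "ln X * (X - 1) \<ge> 0"
    using assms(1) by (cases "X \<ge> 1") (auto intro!: mult_nonneg_nonneg mult_nonpos_nonpos)
  then show "ln X * (X * a - a) \<ge> 0" unfolding * using assms(2) by simp
  show "ln X * (X * a - a) = 0 \<Longrightarrow> a = 0 \<or> X = 1" unfolding * using assms(1) by auto
qed

lemma moment_nth3:
  "moment p q $ 3 = ((cmod (q $ 1))\<^sup>2 - (cmod (q $ 2))\<^sup>2 - (cmod (p $ 1))\<^sup>2 + (cmod (p $ 2))\<^sup>2) / 2"
  by (simp add: moment_hopf hopf_nth diff_divide_distrib add_divide_distrib)

text \<open>
  Along the one-parameter family joining the two points the energy is a sum of exponentials and a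
  linear term, hence convex, and the level equations say that its derivative vanishes at both ends.
  So every coordinate which is not zero has weight zero, and the two points coincide.
\<close>

lemma level_dilation_trivial:
  fixes x y :: "'n::finite point"
  assumes x: "x \<in> mu_R_level \<alpha>" and y: "y \<in> mu_R_level \<alpha>"
    and t: "t > 0" and r: "\<And>i. r i > 0"
    and xy: "y = act (dilation (inverse t)) (\<chi> i. complex_of_real (r i)) x"
  shows "y = x"
proof -
  define a b c d where "a i = (cmod (snd x $ i $ 1))\<^sup>2" and "b i = (cmod (snd x $ i $ 2))\<^sup>2"
    and "c i = (cmod (fst x $ i $ 1))\<^sup>2" and "d i = (cmod (fst x $ i $ 2))\<^sup>2" for i
  define P where "P i = (r i * t)\<^sup>2" for i
  define Q where "Q i = (r i / t)\<^sup>2" for i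
  have PQ: "P i > 0" "Q i > 0" for i using r[of i] t by (simp_all add: P_def Q_def)
  have coords: "snd y $ i $ 1 = complex_of_real (r i * t) * snd x $ i $ 1"
    "snd y $ i $ 2 = complex_of_real (r i / t) * snd x $ i $ 2"
    "fst y $ i $ 1 = complex_of_real (inverse (r i * t)) * fst x $ i $ 1"
    "fst y $ i $ 2 = complex_of_real (inverse (r i / t)) * fst x $ i $ 2" for i
    by (simp_all add: xy dilation_act_nth t divide_inverse algebra_simps)
  have y': "(cmod (snd y $ i $ 1))\<^sup>2 = P i * a i" "(cmod (snd y $ i $ 2))\<^sup>2 = Q i * b i"
    "(cmod (fst y $ i $ 1))\<^sup>2 = inverse (P i) * c i" "(cmod (fst y $ i $ 2))\<^sup>2 = inverse (Q i) * d i" for i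
    unfolding coords norm_mult norm_of_real power_mult_distrib power2_abs
    by (simp_all add: P_def Q_def a_def b_def c_def d_def power_mult_distrib power_divide power_inverse)
  have lx: "(a i + b i) - (c i + d i) = 2 * \<alpha> i" for i
    using x by (simp add: mu_R_level_iff norm_vec2_squared a_def b_def c_def d_def)
  have ly: "(P i * a i + Q i * b i) - (inverse (P i) * c i + inverse (Q i) * d i) = 2 * \<alpha> i" for i
    using y unfolding mu_R_level_iff norm_vec2_squared y' by simp
  have "(\<Sum>i\<in>UNIV. moment (fst x $ i) (snd x $ i) $ 3) = 0"
    using x by (simp add: mu_R_level_iff flip: sum_component)
  then have mx: "(\<Sum>i\<in>UNIV. a i - b i - c i + d i) = 0"
    unfolding moment_nth3 a_def b_def c_def d_def by (simp flip: sum_divide_distrib)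
  have "(\<Sum>i\<in>UNIV. moment (fst y $ i) (snd y $ i) $ 3) = 0"
    using y by (simp add: mu_R_level_iff flip: sum_component)
  then have my: "(\<Sum>i\<in>UNIV. P i * a i - Q i * b i - inverse (P i) * c i + inverse (Q i) * d i) = 0"
    unfolding moment_nth3 y' by (simp flip: sum_divide_distrib)
  define w where "w i = ln (P i) * (P i * a i - a i) + ln (Q i) * (Q i * b i - b i)
      + ln (inverse (P i)) * (inverse (P i) * c i - c i) + ln (inverse (Q i)) * (inverse (Q i) * d i - d i)" for i
  have lnP: "ln (P i) = 2 * ln (r i) + 2 * ln t" and lnQ: "ln (Q i) = 2 * ln (r i) - 2 * ln t" for i
    using r[of i] t by (simp_all add: P_def Q_def ln_realpow ln_mult ln_div)
  have "w i = 2 * ln t * ((P i * a i - Q i * b i - inverse (P i) * c i + inverse (Q i) * d i) - (a i - b i - c i + d i))" for i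
  proof -
    have "w i = 2 * ln (r i) * (((P i * a i + Q i * b i) - (inverse (P i) * c i + inverse (Q i) * d i)) - ((a i + b i) - (c i + d i)))
      + 2 * ln t * ((P i * a i - Q i * b i - inverse (P i) * c i + inverse (Q i) * d i) - (a i - b i - c i + d i))"
      unfolding w_def ln_inverse lnP lnQ by (simp add: algebra_simps)
    then show ?thesis unfolding lx ly by simp
  qed
  then have "(\<Sum>i\<in>UNIV. w i) = 0"
    by (simp only: sum_distrib_left[symmetric] sum_subtractf mx my) (simp add: mx my flip: sum_subtractf)
  moreover have pos: "0 \<le> ln (P i) * (P i * a i - a i)" "0 \<le> ln (Q i) * (Q i * b i - b i)"
    "0 \<le> ln (inverse (P i)) * (inverse (P i) * c i - c i)" "0 \<le> ln (inverse (Q i)) * (inverse (Q i) * d i - d i)" for i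
    by (intro ln_weight_nonneg(1); simp add: PQ a_def b_def c_def d_def)+
  moreover have "w i \<ge> 0" for i unfolding w_def using pos[of i] by linarith
  ultimately have w0: "w i = 0" for i by (simp add: sum_nonneg_eq_0_iff)
  have z: "ln (P i) * (P i * a i - a i) = 0" "ln (Q i) * (Q i * b i - b i) = 0"
    "ln (inverse (P i)) * (inverse (P i) * c i - c i) = 0" "ln (inverse (Q i)) * (inverse (Q i) * d i - d i) = 0" for i
    using w0[of i] pos[of i] unfolding w_def by linarith+
  have fixed: "of_real u * z = z" if "ln X * (X * A - A) = 0" "X > 0" "A = (cmod z)\<^sup>2" "X = u\<^sup>2" "u > 0"
    for X A u :: real and z :: complex
  proof -
    have "A = 0 \<or> X = 1" using ln_weight_nonneg(2)[OF that(2) _ that(1)] that(3) by simp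
    then show ?thesis using that(3,4,5) by (auto simp: power2_eq_1_iff)
  qed
  have rt: "r i * t > 0" "r i / t > 0" for i using r[of i] t by simp_all
  have "snd y $ i $ 1 = snd x $ i $ 1" for i
    unfolding coords by (rule fixed[OF z(1)[of i]]) (use rt[of i] PQ[of i] in \<open>simp_all add: a_def P_def\<close>)
  moreover have "snd y $ i $ 2 = snd x $ i $ 2" for i
    unfolding coords by (rule fixed[OF z(2)[of i]]) (use rt[of i] PQ[of i] in \<open>simp_all add: b_def Q_def\<close>)
  moreover have "fst y $ i $ 1 = fst x $ i $ 1" for i
    unfolding coords by (rule fixed[OF z(3)[of i]])
      (use rt[of i] PQ[of i] in \<open>simp_all only: c_def P_def power_inverse positive_imp_inverse_positive\<close>)
  moreover have "fst y $ i $ 2 = fst x $ i $ 2" for i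
    unfolding coords by (rule fixed[OF z(4)[of i]])
      (use rt[of i] PQ[of i] in \<open>simp_all only: d_def Q_def power_inverse positive_imp_inverse_positive\<close>)
  ultimately show ?thesis by (simp add: prod_eq_iff vec_eq_iff[where 'b='n] vec2_eq_iff)
qed

lemma act_split_phase:
  assumes "A \<in> SL2" "B \<in> SL2"
  shows "act (A ** B) e x = act B (\<chi> i. complex_of_real (cmod (e $ i))) (act A (\<chi> i. sgn (e $ i)) x)"
proof -
  have "(\<chi> i. sgn (e $ i) * complex_of_real (cmod (e $ i))) = e"
    by (simp add: vec_eq_iff sgn_eq)
  then show ?thesis by (simp add: act_act assms)
qed

lemma level_G_orbit_imp_K_orbit:
  fixes x y :: "'n::finite point"
  assumes x: "x \<in> mu_R_level \<alpha>" and y: "y \<in> mu_R_level \<alpha>" and xy: "y \<in> G_orbit x"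
  shows "y \<in> K_orbit x"
proof -
  obtain A e where A: "A \<in> SL2" "\<forall>i. e $ i \<noteq> 0" "y = act A e x"
    using xy by (auto simp: G_orbit_def)
  obtain U t V where d: "U \<in> SU2" "V \<in> SU2" "0 < t" "t \<le> 1" "A = U ** dilation (inverse t) ** V"
    using SL2_KAK[OF A(1)] .
  have sl: "U \<in> SL2" "dilation (inverse t) \<in> SL2" "V \<in> SL2" "adjugate V \<in> SL2"
    using d by (auto simp: SU2_SL2 dilation_SL2 SL2_adjugate)
  define x' where "x' = act U (\<chi> i. sgn (e $ i)) x"
  define y' where "y' = act (adjugate V) (\<chi> i. 1) y"
  have "A ** adjugate V = U ** dilation (inverse t)"
    by (simp add: d(5) SL2_adjugate_mult sl flip: matrix_mul_assoc)
  then have "y' = act (U ** dilation (inverse t)) e x"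
    by (simp add: y'_def A(3) act_act A(1) sl)
  then have "y' = act (dilation (inverse t)) (\<chi> i. complex_of_real (cmod (e $ i))) x'"
    by (simp add: x'_def act_split_phase sl)
  moreover have "x' \<in> mu_R_level \<alpha>" unfolding x'_def
    using A(2) by (intro mu_R_level_act d x) (simp add: norm_sgn)
  moreover have "y' \<in> mu_R_level \<alpha>" unfolding y'_def
    by (intro mu_R_level_act SU2_adjugate d y) simp
  ultimately have "y' = x'" using level_dilation_trivial[of x' \<alpha> y' t "\<lambda>i. cmod (e $ i)"] d(3) A(2) by simp
  moreover have "x' \<in> K_orbit x" unfolding x'_def using A(2) by (intro K_orbitI d) (simp add: norm_sgn)
  moreover have "y' \<in> K_orbit y" unfolding y'_def by (intro K_orbitI SU2_adjugate d) simp
  ultimately show ?thesis using K_orbit_sym K_orbit_trans by blast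
qed

section \<open>Existence of level points in stable orbits\<close>

definition sum_squares :: "'n::finite point \<Rightarrow> real" where
  "sum_squares x = (\<Sum>i\<in>UNIV. (norm (snd x $ i))\<^sup>2 + (norm (fst x $ i))\<^sup>2) / 2"

definition exp_vec :: "real ^ 'n \<Rightarrow> complex ^ 'n" where
  "exp_vec r = (\<chi> i. complex_of_real (exp (r $ i)))"

text \<open>The Kempf-Ness function of an orbit: its critical points are the level points.\<close>

definition energy :: "('n::finite \<Rightarrow> real) \<Rightarrow> 'n point \<Rightarrow> complex ^ 2 ^ 2 \<Rightarrow> real ^ 'n \<Rightarrow> real" where
  "energy \<alpha> x A r = sum_squares (act A (exp_vec r) x) - 2 * (\<Sum>i\<in>UNIV. \<alpha> i * r $ i)"

lemma exp_vec_nonzero [simp]: "exp_vec r $ i \<noteq> 0"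
  by (simp add: exp_vec_def)

lemma exp_vec_0: "exp_vec 0 = (\<chi> i. 1)"
  by (simp add: exp_vec_def vec_eq_iff)

lemma energy_unitary:
  assumes "A \<in> SL2" "V \<in> SU2"
  shows "energy \<alpha> x (A ** V) r = energy \<alpha> x A r"
proof -
  have "act (A ** V) (exp_vec r) x = act V (\<chi> i. 1) (act A (exp_vec r) x)"
    using assms by (simp add: act_act SU2_SL2)
  then show ?thesis using assms by (simp add: energy_def sum_squares_def norm_act)
qed

text \<open>
  The contribution of one index to the energy at the matrix with entries \<open>1 / t\<close> and \<open>t\<close>.
\<close>

definition energy_term :: "real \<Rightarrow> complex ^ 2 \<Rightarrow> complex ^ 2 \<Rightarrow> real \<Rightarrow> real \<Rightarrow> real" where
  "energy_term a p q t r =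
     (exp (2 * r) * (t\<^sup>2 * (cmod (q $ 1))\<^sup>2 + (cmod (q $ 2))\<^sup>2 / t\<^sup>2)
      + exp (- 2 * r) * ((cmod (p $ 1))\<^sup>2 / t\<^sup>2 + t\<^sup>2 * (cmod (p $ 2))\<^sup>2)) / 2 - 2 * a * r"

lemma energy_dilation:
  assumes t: "t > 0" and U: "U \<in> SL2"
  shows "energy \<alpha> x (U ** dilation (inverse t)) r
       = (\<Sum>i\<in>UNIV. energy_term (\<alpha> i) (fst x $ i v* U) (adjugate U *v snd x $ i) t (r $ i))"
proof -
  define y where "y = act U (\<chi> i. 1) x"
  have y: "snd y $ i = adjugate U *v snd x $ i" "fst y $ i = fst x $ i v* U" for i
    by (simp_all add: y_def act_nth matrix_inv_SL2 U)
  have "act (U ** dilation (inverse t)) (exp_vec r) x = act (dilation (inverse t)) (exp_vec r) y"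
    using t U by (simp add: y_def act_act dilation_SL2)
  moreover have "((norm (snd (act (dilation (inverse t)) (exp_vec r) y) $ i))\<^sup>2
      + (norm (fst (act (dilation (inverse t)) (exp_vec r) y) $ i))\<^sup>2) / 2 - 2 * (\<alpha> i * r $ i)
      = energy_term (\<alpha> i) (fst y $ i) (snd y $ i) t (r $ i)" for i
  proof -
    have e: "(exp (r $ i))\<^sup>2 = exp (2 * r $ i)" by (simp add: exp_double)
    have e': "exp (- 2 * r $ i) = inverse ((exp (r $ i))\<^sup>2)" by (simp add: exp_minus e)
    show ?thesis unfolding energy_term_def e' unfolding e[symmetric] norm_vec2_squared
      by (simp add: dilation_act_nth t exp_vec_def norm_mult norm_divide power_mult_distrib power_divide)
         (simp add: field_simps t)
  qed
  ultimately show ?thesis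
    by (simp add: energy_def sum_squares_def sum_divide_distrib sum_distrib_left sum_subtractf[symmetric] flip: y)
qed

lemma linear_minus_ln_bound:
  fixes a c X :: real
  assumes "a > 0" "c > 0" "X > 0"
  shows "c * X - a * ln X \<ge> a + a * ln (c / a)"
proof -
  have "ln (c * X / a) \<le> c * X / a - 1" using assms by (intro ln_le_minus_one) simp
  then have "a * ln (c * X / a) \<le> a * (c * X / a - 1)" using assms by (intro mult_left_mono) auto
  moreover have "ln (c * X / a) = ln (c / a) + ln X" using assms by (simp add: ln_mult ln_div)
  ultimately show ?thesis using assms by (simp add: algebra_simps)
qed

text \<open>
  Minimising over the scalar \<open>exp r\<close> leaves a multiple of \<open>ln t\<close> whose sign depends on which
  coordinate of \<open>q\<close> is bounded away from zero.
\<close>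

lemma energy_term_lower_1:
  assumes a: "a > 0" and t: "t > 0" and q: "q $ 1 \<noteq> 0"
  shows "energy_term a p q t r \<ge> a + a * ln ((cmod (q $ 1))\<^sup>2 / 2 / a) + 2 * a * ln t"
proof -
  let ?X = "exp (2 * r) * t\<^sup>2"
  have "(cmod (q $ 1))\<^sup>2 / 2 * ?X - a * ln ?X \<ge> a + a * ln ((cmod (q $ 1))\<^sup>2 / 2 / a)"
    using a t q by (intro linear_minus_ln_bound) auto
  moreover have "ln ?X = 2 * r + 2 * ln t" using t by (simp add: ln_mult ln_realpow)
  moreover have "energy_term a p q t r + 2 * a * r \<ge> (cmod (q $ 1))\<^sup>2 / 2 * ?X"
  proof -
    have "0 \<le> exp (2 * r) * ((cmod (q $ 2))\<^sup>2 / t\<^sup>2)"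
      "0 \<le> exp (- 2 * r) * ((cmod (p $ 1))\<^sup>2 / t\<^sup>2 + t\<^sup>2 * (cmod (p $ 2))\<^sup>2)" by simp_all
    then show ?thesis unfolding energy_term_def by (simp add: algebra_simps add_divide_distrib)
  qed
  ultimately show ?thesis by (simp add: algebra_simps)
qed

text \<open>
  When both the expanding coordinate of \<open>q\<close> and that of \<open>p\<close> are present the scalar cannot
  compensate for both, which yields the last summand.
\<close>

lemma energy_term_lower_2:
  assumes a: "a > 0" and t: "t > 0" and q: "q $ 2 \<noteq> 0"
  shows "energy_term a p q t r \<ge> a + a * ln ((cmod (q $ 2))\<^sup>2 / 4 / a) - 2 * a * ln t
           + cmod (q $ 2) * cmod (p $ 1) / 2 / t\<^sup>2"
proof -
  define s where "s = exp r / t"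
  have s: "s > 0" using t by (simp add: s_def)
  let ?m = "cmod (q $ 2)" and ?n = "cmod (p $ 1)"
  have "?m\<^sup>2 / 4 * s\<^sup>2 - a * ln (s\<^sup>2) \<ge> a + a * ln (?m\<^sup>2 / 4 / a)"
    using a s q by (intro linear_minus_ln_bound) auto
  moreover have "ln (s\<^sup>2) = 2 * r - 2 * ln t" using t by (simp add: s_def ln_realpow ln_div)
  then have "a * ln (s\<^sup>2) = 2 * a * r - 2 * a * ln t" by (simp add: right_diff_distrib)
  moreover have "?m\<^sup>2 / 4 * s\<^sup>2 + (?n / (s * t\<^sup>2))\<^sup>2 / 4 \<ge> ?m * ?n / 2 / t\<^sup>2"
  proof -
    have "0 \<le> (?m * s / 2 - ?n / (s * t\<^sup>2) / 2)\<^sup>2" by simp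
    also have "\<dots> = ?m\<^sup>2 / 4 * s\<^sup>2 + (?n / (s * t\<^sup>2))\<^sup>2 / 4 - ?m * ?n / 2 / t\<^sup>2"
      using s t by (simp add: power2_diff power_mult_distrib power_divide)
    finally show ?thesis by simp
  qed
  moreover have "energy_term a p q t r + 2 * a * r \<ge> ?m\<^sup>2 / 2 * s\<^sup>2 + (?n / (s * t\<^sup>2))\<^sup>2 / 2"
  proof -
    have e: "exp (2 * r) = (exp r)\<^sup>2" "exp (- 2 * r) = inverse ((exp r)\<^sup>2)" by (simp_all add: exp_double exp_minus)
    have "?m\<^sup>2 * s\<^sup>2 = exp (2 * r) * (?m\<^sup>2 / t\<^sup>2)" "(?n / (s * t\<^sup>2))\<^sup>2 = exp (- 2 * r) * (?n\<^sup>2 / t\<^sup>2)"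
      unfolding s_def e using t by (simp_all add: power_divide power_mult_distrib field_simps)
    moreover have "0 \<le> exp (2 * r) * (t\<^sup>2 * (cmod (q $ 1))\<^sup>2)" "0 \<le> exp (- 2 * r) * (t\<^sup>2 * (cmod (p $ 2))\<^sup>2)" by simp_all
    ultimately show ?thesis unfolding energy_term_def by (simp add: algebra_simps add_divide_distrib)
  qed
  moreover have "(?n / (s * t\<^sup>2))\<^sup>2 \<ge> 0" by simp
  ultimately show ?thesis by linarith
qed


text \<open>
  As the dilation factor degenerates, indices aligned with the contracted axis contribute
  \<open>2 \<alpha>\<^sub>i ln t\<close> and the others \<open>- 2 \<alpha>\<^sub>i ln t\<close>.  If \<open>p\<close> vanishes at the latter, stability says that
  the sum tends to infinity; otherwise the term with \<open>1 / t\<^sup>2\<close> dominates.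
\<close>

lemma energy_coercive_dilation:
  fixes x :: "'n::finite point"
  assumes pos: "\<And>i. \<alpha> i > 0" and x: "x \<in> stable_points \<alpha>"
  shows "\<exists>\<delta>>0. \<forall>U t r. U \<in> SU2 \<longrightarrow> 0 < t \<longrightarrow> t \<le> 1 \<longrightarrow> energy \<alpha> x (U ** dilation (inverse t)) r \<le> C \<longrightarrow> \<delta> \<le> t"
proof (rule ccontr)
  assume no: "\<not> ?thesis"
  have "\<exists>U t r. U \<in> SU2 \<and> 0 < t \<and> t \<le> 1 \<and> energy \<alpha> x (U ** dilation (inverse t)) r \<le> C \<and> t < inverse (real (Suc k))" for k
    using no[unfolded not_ex, rule_format, of "inverse (real (Suc k))"] by (auto simp: not_le)
  then obtain U t r where U: "\<And>k. U k \<in> SU2" and t: "\<And>k. 0 < t k" "\<And>k. t k < inverse (real (Suc k))"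
    and en: "\<And>k. energy \<alpha> x (U k ** dilation (inverse (t k))) (r k) \<le> C"
    by metis
  obtain U0 f where f: "U0 \<in> SU2" "strict_mono f" "(U \<circ> f) \<longlonglongrightarrow> U0"
    using compact_imp_seq_compact[OF compact_SU2] U by (metis seq_compactE)
  define s where "s k = t (f k)" for k
  have s: "s k > 0" for k by (simp add: s_def t)
  have "t \<longlonglongrightarrow> 0"
    by (rule tendsto_sandwich[OF _ _ tendsto_const LIMSEQ_inverse_real_of_nat])
       (use t in \<open>auto intro!: always_eventually less_imp_le\<close>)
  from LIMSEQ_subseq_LIMSEQ[OF this f(2)] have s0: "s \<longlonglongrightarrow> 0" by (simp add: s_def[abs_def] o_def)
  then have s_at: "filterlim s (at_right 0) sequentially"
    using s by (simp add: filterlim_at less_imp_neq[symmetric])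
  define q where "q k i = adjugate (U (f k)) *v snd x $ i" for k i
  define p where "p k i = fst x $ i v* U (f k)" for k i
  define q0 where "q0 i = adjugate U0 *v snd x $ i" for i
  define p0 where "p0 i = fst x $ i v* U0" for i
  have Ulim: "(\<lambda>k. U (f k) $ a $ b) \<longlonglongrightarrow> U0 $ a $ b" for a b
    using f(3) by (intro tendsto_vec_nth) (simp add: o_def)
  have plim: "(\<lambda>k. p k i $ a) \<longlonglongrightarrow> p0 i $ a" for i a
    unfolding p_def p0_def nth2_simps by (intro tendsto_intros Ulim)
  have qlim: "(\<lambda>k. q k i $ a) \<longlonglongrightarrow> q0 i $ a" for i a
    using exhaust_2[of a] unfolding q_def q0_def nth2_simps
    by (elim disjE; simp; intro tendsto_intros Ulim)
  define y where "y = act U0 (\<chi> i. 1) x"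
  have y: "snd y $ i = q0 i" "fst y $ i = p0 i" for i
    using f(1) by (simp_all add: y_def q0_def p0_def act_nth matrix_inv_SL2 SU2_SL2)
  have yst: "y \<in> stable_points \<alpha>" unfolding y_def by (rule stable_points_act) (simp_all add: f SU2_SL2 x)
  have q0n: "q0 i \<noteq> 0" for i using yst by (auto simp: stable_points_def stable_iff_wedge y)
  have rc: "p0 i $ 1 * q0 i $ 1 + p0 i $ 2 * q0 i $ 2 = 0" for i
    using yst by (simp add: stable_points_def mu_C_zero_iff row_col_2 y)
  define T where "T = {i. q0 i $ 2 = 0}"
  have q1: "q0 i $ 1 \<noteq> 0" if "i \<in> T" for i using that q0n[of i] by (auto simp: T_def vec2_eq_iff)
  have q2: "q0 i $ 2 \<noteq> 0" if "i \<in> - T" for i using that by (auto simp: T_def)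
  define \<beta> where "\<beta> k i = \<alpha> i + \<alpha> i * ln (if i \<in> T then (cmod (q k i $ 1))\<^sup>2 / 2 / \<alpha> i else (cmod (q k i $ 2))\<^sup>2 / 4 / \<alpha> i)" for k i
  define \<beta>0 where "\<beta>0 i = \<alpha> i + \<alpha> i * ln (if i \<in> T then (cmod (q0 i $ 1))\<^sup>2 / 2 / \<alpha> i else (cmod (q0 i $ 2))\<^sup>2 / 4 / \<alpha> i)" for i
  have \<beta>: "(\<lambda>k. \<beta> k i) \<longlonglongrightarrow> \<beta>0 i" for i
  proof (cases "i \<in> T")
    case True
    then show ?thesis using pos[of i] q1[of i] unfolding \<beta>_def \<beta>0_def
      by (simp; intro tendsto_intros qlim) simp_all
  next
    case False
    then show ?thesis using pos[of i] q2[of i] unfolding \<beta>_def \<beta>0_def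
      by (simp; intro tendsto_intros qlim) simp_all
  qed
  define \<kappa> where "\<kappa> k = (\<Sum>i\<in>-T. cmod (q k i $ 2) * cmod (p k i $ 1) / 2)" for k
  define \<kappa>0 where "\<kappa>0 = (\<Sum>i\<in>-T. cmod (q0 i $ 2) * cmod (p0 i $ 1) / 2)"
  have \<kappa>: "\<kappa> \<longlonglongrightarrow> \<kappa>0" unfolding \<kappa>_def[abs_def] \<kappa>0_def by (intro tendsto_intros qlim plim) simp
  have \<kappa>n: "\<kappa> k \<ge> 0" for k unfolding \<kappa>_def by (intro sum_nonneg) simp
  define m where "m = 2 * (sum \<alpha> T - sum \<alpha> (- T))"
  define B where "B k = sum (\<beta> k) UNIV" for k
  have B: "B \<longlonglongrightarrow> sum \<beta>0 UNIV" unfolding B_def[abs_def] by (intro tendsto_sum \<beta>)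
  have lower: "eventually (\<lambda>k. B k + m * ln (s k) + \<kappa> k / (s k)\<^sup>2 \<le> C) sequentially"
  proof -
    have "eventually (\<lambda>k. \<forall>i. (i \<in> T \<longrightarrow> q k i $ 1 \<noteq> 0) \<and> (i \<in> - T \<longrightarrow> q k i $ 2 \<noteq> 0)) sequentially"
    proof (rule eventually_all_finite)
      fix i
      show "eventually (\<lambda>k. (i \<in> T \<longrightarrow> q k i $ 1 \<noteq> 0) \<and> (i \<in> - T \<longrightarrow> q k i $ 2 \<noteq> 0)) sequentially"
        using tendsto_imp_eventually_ne[OF qlim q1[of i]] tendsto_imp_eventually_ne[OF qlim q2[of i]]
        by (cases "i \<in> T") auto
    qed
    then show ?thesis
    proof eventually_elim
      case (elim k)
      have "B k + m * ln (s k) + \<kappa> k / (s k)\<^sup>2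
          = (\<Sum>i\<in>T. \<beta> k i + 2 * \<alpha> i * ln (s k))
            + (\<Sum>i\<in>-T. \<beta> k i - 2 * \<alpha> i * ln (s k) + cmod (q k i $ 2) * cmod (p k i $ 1) / 2 / (s k)\<^sup>2)"
        using sum.subset_diff[of T UNIV "\<beta> k"]
        by (simp add: B_def m_def \<kappa>_def sum.distrib sum_subtractf sum_divide_distrib sum_distrib_left sum_distrib_right
            Compl_eq_Diff_UNIV algebra_simps)
      also have "\<dots> \<le> (\<Sum>i\<in>T. energy_term (\<alpha> i) (p k i) (q k i) (s k) (r (f k) $ i))
            + (\<Sum>i\<in>-T. energy_term (\<alpha> i) (p k i) (q k i) (s k) (r (f k) $ i))"
      proof (intro add_mono sum_mono)
        fix i assume "i \<in> T"
        then show "\<beta> k i + 2 * \<alpha> i * ln (s k) \<le> energy_term (\<alpha> i) (p k i) (q k i) (s k) (r (f k) $ i)"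
          unfolding \<beta>_def using energy_term_lower_1[OF pos s, of "q k i" i k "p k i"] elim by simp
      next
        fix i assume "i \<in> -T"
        then show "\<beta> k i - 2 * \<alpha> i * ln (s k) + cmod (q k i $ 2) * cmod (p k i $ 1) / 2 / (s k)\<^sup>2
            \<le> energy_term (\<alpha> i) (p k i) (q k i) (s k) (r (f k) $ i)"
          unfolding \<beta>_def using energy_term_lower_2[OF pos s, of "q k i" i k "p k i"] elim by simp
      qed
      also have "\<dots> = (\<Sum>i\<in>UNIV. energy_term (\<alpha> i) (p k i) (q k i) (s k) (r (f k) $ i))"
        using sum.subset_diff[of T UNIV "\<lambda>i. energy_term (\<alpha> i) (p k i) (q k i) (s k) (r (f k) $ i)"]
        by (simp add: Compl_eq_Diff_UNIV)
      also have "\<dots> = energy \<alpha> x (U (f k) ** dilation (inverse (s k))) (r (f k))"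
        by (simp add: energy_dilation s U SU2_SL2 p_def q_def)
      also have "\<dots> \<le> C" unfolding s_def by (rule en)
      finally show ?case .
    qed
  qed
  show False
  proof (cases "\<kappa>0 = 0")
    case True
    have "p0 i = 0" if "i \<in> - T" for i
    proof -
      have "cmod (q0 i $ 2) * cmod (p0 i $ 1) / 2 = 0"
        using True that unfolding \<kappa>0_def by (subst (asm) sum_nonneg_eq_0_iff) auto
      then have "p0 i $ 1 = 0" using q2[OF that] by simp
      then show ?thesis using rc[of i] q2[OF that] by (simp add: vec2_eq_iff)
    qed
    then have "short \<alpha> T" using yst by (auto simp: stable_points_def stable_iff_wedge y wedge_def T_def)
    then have m: "m < 0" by (simp add: m_def short_def)
    have "filterlim (\<lambda>k. ln (s k)) at_bot sequentially"
      using filterlim_compose[OF ln_at_0 s_at] .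
    then have "filterlim (\<lambda>k. - ln (s k)) at_top sequentially" by (simp add: filterlim_uminus_at_top)
    then have "filterlim (\<lambda>k. (- m) * (- ln (s k))) at_top sequentially"
      using m by (intro filterlim_tendsto_pos_mult_at_top[OF tendsto_const]) auto
    then have "filterlim (\<lambda>k. m * ln (s k)) at_top sequentially" by simp
    then have "filterlim (\<lambda>k. B k + m * ln (s k)) at_top sequentially"
      by (rule filterlim_tendsto_add_at_top[OF B])
    then have "eventually (\<lambda>k. B k + m * ln (s k) > C) sequentially"
      by (simp add: filterlim_at_top_dense)
    with lower have "eventually (\<lambda>k. False) sequentially"
    proof eventually_elim
      case (elim k)
      have "\<kappa> k / (s k)\<^sup>2 \<ge> 0" using \<kappa>n by simp
      then show False using elim by linarith
    qed
    then show False by simp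
  next
    case False
    then have k0: "\<kappa>0 > 0" unfolding \<kappa>0_def by (simp add: sum_nonneg less_le)
    have ll: "((\<lambda>t::real. t\<^sup>2 * ln t) \<longlongrightarrow> 0) (at_right 0)"
    proof (rule Lim_transform_eventually)
      have "((\<lambda>t::real. - (t * (ln (inverse t) / inverse t))) \<longlongrightarrow> - (0 * 0)) (at_right 0)"
        by (intro tendsto_intros filterlim_compose[OF ln_x_over_x_tendsto_0 filterlim_inverse_at_top_right])
      then show "((\<lambda>t::real. - (t * (ln (inverse t) / inverse t))) \<longlongrightarrow> 0) (at_right 0)" by simp
      show "eventually (\<lambda>t::real. - (t * (ln (inverse t) / inverse t)) = t\<^sup>2 * ln t) (at_right 0)"
        by (auto simp: eventually_at_right_field ln_inverse power2_eq_square divide_inverse intro: exI[of _ 1])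
    qed
    have "(\<lambda>k. (s k)\<^sup>2 * B k + m * ((s k)\<^sup>2 * ln (s k)) + \<kappa> k) \<longlonglongrightarrow> 0\<^sup>2 * sum \<beta>0 UNIV + m * 0 + \<kappa>0"
      by (intro tendsto_intros s0 B \<kappa> filterlim_compose[OF ll s_at])
    moreover have "(\<lambda>k. (s k)\<^sup>2 * C) \<longlonglongrightarrow> 0\<^sup>2 * C" by (intro tendsto_intros s0)
    moreover have "eventually (\<lambda>k. (s k)\<^sup>2 * B k + m * ((s k)\<^sup>2 * ln (s k)) + \<kappa> k \<le> (s k)\<^sup>2 * C) sequentially"
      using lower
    proof eventually_elim
      case (elim k)
      have "(s k)\<^sup>2 * (B k + m * ln (s k) + \<kappa> k / (s k)\<^sup>2) \<le> (s k)\<^sup>2 * C"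
        using elim by (intro mult_left_mono) auto
      then show ?case using s[of k] by (simp add: algebra_simps)
    qed
    ultimately have "0\<^sup>2 * sum \<beta>0 UNIV + m * 0 + \<kappa>0 \<le> 0\<^sup>2 * C" by (intro tendsto_le[OF sequentially_bot]) auto
    then show False using k0 by simp
  qed
qed

lemma exp_minus_linear_coercive:
  fixes a c M :: real
  assumes "a > 0" "c > 0"
  obtains R where "R \<ge> 0" "\<And>r. c * exp (2 * r) - 2 * a * r \<le> M \<Longrightarrow> \<bar>r\<bar> \<le> R"
proof -
  define R where "R = \<bar>M\<bar> / (2 * a) + 1 + (\<bar>M\<bar> + 2 * a) / (2 * c)"
  have R: "R \<ge> \<bar>M\<bar> / (2 * a)" "R \<ge> 1" "R \<ge> (\<bar>M\<bar> + 2 * a) / (2 * c)" "R \<ge> 0"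
    using assms by (auto simp: R_def)
  have "\<bar>r\<bar> \<le> R" if r: "c * exp (2 * r) - 2 * a * r \<le> M" for r
  proof (cases "r \<le> 1")
    case True
    have "0 \<le> c * exp (2 * r)" using assms by simp
    then have "- r * (2 * a) \<le> \<bar>M\<bar>" using r by (simp add: algebra_simps)
    then have "- r \<le> \<bar>M\<bar> / (2 * a)" using assms by (simp add: pos_le_divide_eq)
    then show ?thesis using R True by linarith
  next
    case False
    then have r1: "r > 1" by simp
    have "2 * r * r \<le> exp (2 * r)" using exp_lower_Taylor_quadratic[of "2 * r"] r1 by (simp add: power2_eq_square)
    then have "c * (2 * r * r) \<le> c * exp (2 * r)" using assms by (intro mult_left_mono) auto
    also have "\<dots> \<le> \<bar>M\<bar> + 2 * a * r" using r by simp
    also have "\<dots> \<le> \<bar>M\<bar> * r + 2 * a * r" using r1 mult_left_mono[of 1 r "\<bar>M\<bar>"] by simp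
    finally have "(r * (2 * c)) * r \<le> (\<bar>M\<bar> + 2 * a) * r" by (simp add: algebra_simps)
    then have "r * (2 * c) \<le> \<bar>M\<bar> + 2 * a" using r1 mult_le_cancel_right_pos[of r] by simp
    then have "r \<le> (\<bar>M\<bar> + 2 * a) / (2 * c)" using assms by (simp add: pos_le_divide_eq)
    then show ?thesis using R r1 by linarith
  qed
  then show ?thesis using R(4) that by blast
qed

lemma energy_term_lower_scalar:
  assumes "0 < \<delta>" "\<delta> \<le> t" "t \<le> 1"
  shows "energy_term a p q t r \<ge> \<delta>\<^sup>2 * (norm q)\<^sup>2 / 2 * exp (2 * r) - 2 * a * r"
proof -
  have t2: "\<delta>\<^sup>2 \<le> t\<^sup>2" "t\<^sup>2 \<le> 1" "t\<^sup>2 > 0" using assms by (auto simp: power_le_one intro: power_mono)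
  have "(cmod (q $ 2))\<^sup>2 * (\<delta>\<^sup>2 * t\<^sup>2) \<le> (cmod (q $ 2))\<^sup>2 * 1"
    using t2 mult_mono[of "\<delta>\<^sup>2" 1 "t\<^sup>2" 1] by (intro mult_left_mono) auto
  then have "\<delta>\<^sup>2 * (cmod (q $ 2))\<^sup>2 \<le> (cmod (q $ 2))\<^sup>2 / t\<^sup>2"
    using t2 by (simp add: pos_le_divide_eq algebra_simps)
  moreover have "\<delta>\<^sup>2 * (cmod (q $ 1))\<^sup>2 \<le> t\<^sup>2 * (cmod (q $ 1))\<^sup>2" using t2 by (intro mult_right_mono) auto
  ultimately have "\<delta>\<^sup>2 * (norm q)\<^sup>2 \<le> t\<^sup>2 * (cmod (q $ 1))\<^sup>2 + (cmod (q $ 2))\<^sup>2 / t\<^sup>2"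
    by (simp add: norm_vec2_squared distrib_left)
  then have "exp (2 * r) * (\<delta>\<^sup>2 * (norm q)\<^sup>2) \<le> exp (2 * r) * (t\<^sup>2 * (cmod (q $ 1))\<^sup>2 + (cmod (q $ 2))\<^sup>2 / t\<^sup>2)"
    by (intro mult_left_mono) auto
  also have "\<dots> \<le> \<dots> + exp (- 2 * r) * ((cmod (p $ 1))\<^sup>2 / t\<^sup>2 + t\<^sup>2 * (cmod (p $ 2))\<^sup>2)" by simp
  also have "\<dots> = 2 * (energy_term a p q t r + 2 * a * r)" by (simp add: energy_term_def)
  finally show ?thesis by (simp add: algebra_simps)
qed

text \<open>
  With the dilation bounded, each term is bounded below by \<open>c exp (2 r) - 2 \<alpha> r\<close>, which tends to
  infinity as \<open>r \<rightarrow> \<plusminus>\<infinity>\<close> because \<open>q\<^sub>i \<noteq> 0\<close> and \<open>\<alpha>\<^sub>i > 0\<close>.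
\<close>

lemma energy_coercive_scalars:
  fixes x :: "'n::finite point"
  assumes pos: "\<And>i. \<alpha> i > 0" and q: "\<And>i. snd x $ i \<noteq> 0" and \<delta>: "0 < \<delta>"
  shows "\<exists>R. \<forall>U t r. U \<in> SU2 \<longrightarrow> \<delta> \<le> t \<longrightarrow> t \<le> 1 \<longrightarrow>
    energy \<alpha> x (U ** dilation (inverse t)) r \<le> C \<longrightarrow> (\<forall>i. \<bar>r $ i\<bar> \<le> R)"
proof -
  define c where "c i = \<delta>\<^sup>2 * (norm (snd x $ i))\<^sup>2 / 2" for i
  have c: "c i > 0" for i using \<delta> q[of i] by (simp add: c_def)
  define m where "m i = \<alpha> i + \<alpha> i * ln (c i / \<alpha> i)" for i
  have m: "c i * exp (2 * r) - 2 * \<alpha> i * r \<ge> m i" for i r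
    using linear_minus_ln_bound[OF pos c, of "exp (2 * r)" i i] by (simp add: m_def algebra_simps)
  have "\<exists>R\<ge>0. \<forall>r. c i * exp (2 * r) - 2 * \<alpha> i * r \<le> C - (\<Sum>j\<in>-{i}. m j) \<longrightarrow> \<bar>r\<bar> \<le> R" for i
    using exp_minus_linear_coercive[OF pos c] by metis
  then obtain R where R: "\<And>i. R i \<ge> 0"
    "\<And>i r. c i * exp (2 * r) - 2 * \<alpha> i * r \<le> C - (\<Sum>j\<in>-{i}. m j) \<Longrightarrow> \<bar>r\<bar> \<le> R i" by metis
  have "\<bar>r $ i\<bar> \<le> sum R UNIV" if U: "U \<in> SU2" and t: "\<delta> \<le> t" "t \<le> 1" and en: "energy \<alpha> x (U ** dilation (inverse t)) r \<le> C" for U t r i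
  proof -
    have "(\<Sum>j\<in>UNIV. c j * exp (2 * r $ j) - 2 * \<alpha> j * r $ j)
        \<le> (\<Sum>j\<in>UNIV. energy_term (\<alpha> j) (fst x $ j v* U) (adjugate U *v snd x $ j) t (r $ j))"
      unfolding c_def using energy_term_lower_scalar[OF \<delta> t] norm_SU2_column[OF SU2_adjugate[OF U]]
      by (intro sum_mono) metis
    also have "\<dots> \<le> C" using en t \<delta> U by (simp add: energy_dilation SU2_SL2)
    finally have "(\<Sum>j\<in>UNIV. c j * exp (2 * r $ j) - 2 * \<alpha> j * r $ j) \<le> C" .
    moreover have "(\<Sum>j\<in>UNIV. c j * exp (2 * r $ j) - 2 * \<alpha> j * r $ j)
       = (c i * exp (2 * r $ i) - 2 * \<alpha> i * r $ i) + (\<Sum>j\<in>-{i}. c j * exp (2 * r $ j) - 2 * \<alpha> j * r $ j)"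
      by (simp add: Compl_eq_Diff_UNIV sum.remove[of UNIV i])
    moreover have "(\<Sum>j\<in>-{i}. m j) \<le> (\<Sum>j\<in>-{i}. c j * exp (2 * r $ j) - 2 * \<alpha> j * r $ j)"
      by (intro sum_mono m)
    ultimately have "c i * exp (2 * r $ i) - 2 * \<alpha> i * r $ i \<le> C - (\<Sum>j\<in>-{i}. m j)" by linarith
    then have "\<bar>r $ i\<bar> \<le> R i" by (rule R(2))
    also have "\<dots> \<le> sum R UNIV" using R(1) by (intro member_le_sum) auto
    finally show ?thesis .
  qed
  then show ?thesis by blast
qed

lemma energy_attains_minimum:
  fixes x :: "'n::finite point"
  assumes pos: "\<And>i. \<alpha> i > 0" and x: "x \<in> stable_points \<alpha>"
  obtains A r where "A \<in> SL2" "\<And>B s. B \<in> SL2 \<Longrightarrow> energy \<alpha> x A r \<le> energy \<alpha> x B s"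
proof -
  have q: "snd x $ i \<noteq> 0" for i using x by (simp add: stable_points_def stable_iff_wedge)
  define C where "C = energy \<alpha> x (mat 1 ** dilation (inverse 1)) 0"
  define E where "E = (\<lambda>(U, t, r). energy \<alpha> x (U ** dilation (inverse t)) r)"
  obtain \<delta> where \<delta>: "\<delta> > 0" "\<And>U t r. U \<in> SU2 \<Longrightarrow> 0 < t \<Longrightarrow> t \<le> 1 \<Longrightarrow> E (U, t, r) \<le> C \<Longrightarrow> \<delta> \<le> t"
    using energy_coercive_dilation[where \<alpha> = \<alpha> and C = C, OF pos x] by (auto simp: E_def)
  obtain R where R: "\<And>U t r i. U \<in> SU2 \<Longrightarrow> \<delta> \<le> t \<Longrightarrow> t \<le> 1 \<Longrightarrow> E (U, t, r) \<le> C \<Longrightarrow> \<bar>r $ i\<bar> \<le> R"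
    using energy_coercive_scalars[where \<alpha> = \<alpha> and C = C, OF pos q \<delta>(1)] unfolding E_def prod.case by metis
  let ?K = "SU2 \<times> {\<delta>..1} \<times> cbox (\<chi> i. - R) (\<chi> i. R :: real ^ 'n)"
  have inK: "(U, t, r) \<in> ?K" if "U \<in> SU2" "0 < t" "t \<le> 1" "E (U, t, r) \<le> C" for U t r
    using \<delta>(2)[OF that] R[OF that(1) _ that(3,4)] that by (auto simp: mem_box_cart abs_le_iff minus_le_iff)
  have base: "(mat 1, 1, 0) \<in> ?K" by (rule inK) (simp_all add: C_def E_def)
  have "continuous_on ?K E"
  proof -
    let ?F = "\<lambda>z. \<Sum>i\<in>UNIV. energy_term (\<alpha> i) (fst x $ i v* fst z) (adjugate (fst z) *v snd x $ i) (fst (snd z)) (snd (snd z) $ i)"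
    have "continuous_on ?K ?F"
      unfolding energy_term_def nth2_simps adjugate_nth using \<delta>(1) by (intro continuous_intros) auto
    moreover have "E z = ?F z" if "z \<in> ?K" for z
      using that \<delta>(1) by (auto simp: E_def energy_dilation SU2_SL2)
    ultimately show ?thesis by (metis (no_types, lifting) continuous_on_cong)
  qed
  moreover have "compact ?K" by (intro compact_Times compact_SU2 compact_Icc compact_cbox)
  ultimately obtain z where z: "z \<in> ?K" "\<And>w. w \<in> ?K \<Longrightarrow> E z \<le> E w"
    using continuous_attains_inf[of ?K E] base by blast
  obtain U t r where zt: "z = (U, t, r)" by (cases z)
  have zC: "E z \<le> C" using z(2)[OF base] by (simp add: C_def E_def)
  show ?thesis
  proof (rule that[of "U ** dilation (inverse t)" r])
    show "U ** dilation (inverse t) \<in> SL2"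
      using z(1) zt \<delta>(1) by (auto simp: SL2_mult dilation_SL2 SU2_SL2)
    fix B s assume "B \<in> SL2"
    then obtain U' t' V where B: "U' \<in> SU2" "V \<in> SU2" "0 < t'" "t' \<le> 1" "B = U' ** dilation (inverse t') ** V"
      using SL2_KAK by blast
    then have "energy \<alpha> x B s = E (U', t', s)"
      by (simp add: E_def energy_unitary SL2_mult SU2_SL2 dilation_SL2)
    moreover have "E z \<le> E (U', t', s)"
      using z(2)[OF inK[OF B(1,3,4), of s]] zC by linarith
    ultimately show "energy \<alpha> x (U ** dilation (inverse t)) r \<le> energy \<alpha> x B s"
      by (simp add: E_def zt)
  qed
qed

lemma exp_minimum_at_0:
  fixes a b c :: real
  assumes "\<And>s. a * exp (2 * s) + b * exp (- 2 * s) - c * s \<ge> a + b"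
  shows "2 * a - 2 * b = c"
proof -
  let ?f = "\<lambda>s. a * exp (2 * s) + b * exp (- 2 * s) - c * s"
  have "(?f has_real_derivative (2 * a - 2 * b - c)) (at 0)"
    by (auto intro!: derivative_eq_intros)
  moreover have "\<forall>y. \<bar>0 - y\<bar> < 1 \<longrightarrow> ?f 0 \<le> ?f y" using assms by simp
  ultimately have "2 * a - 2 * b - c = 0" by (intro DERIV_local_min[of ?f _ 0 1]) auto
  then show ?thesis by simp
qed

text \<open>
  Stationarity in the scalars gives the equations for the norms.  Stationarity along the dilations,
  conjugated by an arbitrary unitary \<open>V\<close>, says that the third coordinate of the total moment rotated
  by \<open>V\<close> is zero; choosing \<open>V\<close> to turn the total moment into the third axis shows that it vanishes.
\<close>

lemma energy_minimum_imp_level: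
  fixes y :: "'n::finite point"
  assumes min: "\<And>B s. B \<in> SL2 \<Longrightarrow> energy \<alpha> y (mat 1) 0 \<le> energy \<alpha> y B s"
  shows "y \<in> mu_R_level \<alpha>"
proof -
  have e0: "energy \<alpha> y (mat 1) 0 = sum_squares y"
    by (simp add: energy_def exp_vec_0 act_one)
  have "(norm (snd y $ i))\<^sup>2 - (norm (fst y $ i))\<^sup>2 = 2 * \<alpha> i" for i
  proof -
    define Q where "Q j = (norm (snd y $ j))\<^sup>2" for j
    define P where "P j = (norm (fst y $ j))\<^sup>2" for j
    define rest where "rest = (\<Sum>j\<in>-{i}. Q j + P j) / 2"
    have split: "(\<Sum>j\<in>UNIV. g j) = g i + (\<Sum>j\<in>-{i}. g j)" for g :: "'n \<Rightarrow> real"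
      by (simp add: Compl_eq_Diff_UNIV sum.remove[of UNIV i])
    have "Q i / 2 * exp (2 * s) + P i / 2 * exp (- 2 * s) - 2 * \<alpha> i * s \<ge> Q i / 2 + P i / 2" for s
    proof -
      have act1: "act (mat 1) e y = (\<chi> j. inverse (e $ j) *s (fst y $ j), \<chi> j. e $ j *s (snd y $ j))" for e
        by (simp add: prod_eq_iff vec_eq_iff[where 'b='n] vec2_eq_iff act_nth matrix_inv_SL2 nth2_simps)
      let ?g = "\<lambda>j. (Q j * (exp (axis i s $ j))\<^sup>2 + P j * (inverse (exp (axis i s $ j)))\<^sup>2) / 2
          - 2 * \<alpha> j * axis i s $ j"
      have "energy \<alpha> y (mat 1) (axis i s) = (\<Sum>j\<in>UNIV. ?g j)"
        unfolding energy_def act1 sum_squares_def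
        by (simp add: norm_smult_vec2 norm_mult norm_inverse exp_vec_def Q_def P_def power_mult_distrib
            sum_divide_distrib sum_distrib_left sum_subtractf mult.commute mult.left_commute)
      also have "\<dots> = ?g i + (\<Sum>j\<in>-{i}. ?g j)" by (rule split)
      also have "(\<Sum>j\<in>-{i}. ?g j) = (\<Sum>j\<in>-{i}. (Q j + P j) / 2)"
        by (rule sum.cong) (auto simp: axis_def)
      also have "\<dots> = rest" by (simp add: rest_def sum_divide_distrib)
      finally have "energy \<alpha> y (mat 1) (axis i s) = (Q i * (exp s)\<^sup>2 + P i * (inverse (exp s))\<^sup>2) / 2 + rest - 2 * \<alpha> i * s"
        by (simp add: axis_def)
      also have "\<dots> = Q i / 2 * exp (2 * s) + P i / 2 * exp (- 2 * s) + rest - 2 * \<alpha> i * s"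
        by (simp add: exp_double exp_minus power_inverse add_divide_distrib)
      finally show ?thesis using min[OF SL2_one, of "axis i s"] unfolding e0
        by (simp add: sum_squares_def split Q_def P_def rest_def add_divide_distrib)
    qed
    then have "2 * (Q i / 2) - 2 * (P i / 2) = 2 * \<alpha> i" by (rule exp_minimum_at_0)
    then show ?thesis by (simp add: Q_def P_def)
  qed
  moreover have third: "(spin_matrix V *v (\<Sum>i\<in>UNIV. moment (fst y $ i) (snd y $ i))) $ 3 = 0" if V: "V \<in> SU2" for V
  proof -
    define z where "z = act V (\<chi> i. 1) y"
    define Q where "Q = (\<Sum>i\<in>UNIV. (cmod (snd z $ i $ 2))\<^sup>2 + (cmod (fst z $ i $ 1))\<^sup>2) / 2"
    define P where "P = (\<Sum>i\<in>UNIV. (cmod (snd z $ i $ 1))\<^sup>2 + (cmod (fst z $ i $ 2))\<^sup>2) / 2"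
    have "Q * exp (2 * s) + P * exp (- 2 * s) - 0 * s \<ge> Q + P" for s
    proof -
      let ?t = "exp (- s)"
      have "energy \<alpha> y (V ** dilation (inverse ?t)) 0
          = (\<Sum>i\<in>UNIV. energy_term (\<alpha> i) (fst z $ i) (snd z $ i) ?t 0)"
        using V by (simp add: energy_dilation SU2_SL2 z_def act_nth matrix_inv_SL2)
      also have "\<dots> = (\<Sum>i\<in>UNIV. ((cmod (snd z $ i $ 2))\<^sup>2 + (cmod (fst z $ i $ 1))\<^sup>2) / 2 * exp (2 * s)
          + ((cmod (snd z $ i $ 1))\<^sup>2 + (cmod (fst z $ i $ 2))\<^sup>2) / 2 * exp (- 2 * s))"
      proof (rule sum.cong[OF refl])
        fix i
        have "?t\<^sup>2 = exp (- 2 * s)" by (simp flip: exp_double)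
        moreover have "inverse (exp (- 2 * s)) = exp (2 * s)" by (simp flip: exp_minus)
        ultimately show "energy_term (\<alpha> i) (fst z $ i) (snd z $ i) ?t 0
          = ((cmod (snd z $ i $ 2))\<^sup>2 + (cmod (fst z $ i $ 1))\<^sup>2) / 2 * exp (2 * s)
          + ((cmod (snd z $ i $ 1))\<^sup>2 + (cmod (fst z $ i $ 2))\<^sup>2) / 2 * exp (- 2 * s)"
          unfolding energy_term_def divide_inverse by (simp add: algebra_simps)
      qed
      also have "\<dots> = Q * exp (2 * s) + P * exp (- 2 * s)"
        by (simp add: Q_def P_def sum.distrib flip: sum_distrib_right sum_divide_distrib)
      finally have "Q * exp (2 * s) + P * exp (- 2 * s) \<ge> sum_squares y"
        using min[of "V ** dilation (inverse ?t)" 0] V by (simp add: e0 SL2_mult SU2_SL2 dilation_SL2)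
      also have "sum_squares y = sum_squares z"
        using V by (simp add: z_def sum_squares_def norm_act)
      also have "\<dots> = Q + P"
        by (simp add: sum_squares_def Q_def P_def norm_vec2_squared algebra_simps flip: add_divide_distrib sum.distrib)
      finally show ?thesis by simp
    qed
    then have "2 * Q - 2 * P = 0" by (rule exp_minimum_at_0)
    then have "(\<Sum>i\<in>UNIV. moment (fst z $ i) (snd z $ i) $ 3) = 0"
      unfolding moment_nth3 Q_def P_def by (simp add: sum.distrib sum_subtractf flip: sum_divide_distrib)
    moreover have "moment (fst z $ i) (snd z $ i) = spin_matrix V *v moment (fst y $ i) (snd y $ i)" for i
      unfolding z_def using V by (simp add: moment_act)
    ultimately show ?thesis
      by (simp add: linear_sum[OF matrix_vector_mul_linear] sum_component)
  qed
  moreover have "(\<Sum>i\<in>UNIV. moment (fst y $ i) (snd y $ i)) = 0" (is "?m = 0")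
  proof (rule ccontr)
    assume m: "?m \<noteq> 0"
    then have "norm (inverse (norm ?m) *\<^sub>R ?m) = 1" by simp
    then obtain A where A: "A \<in> SU2" "spin_matrix A *v axis 3 1 = inverse (norm ?m) *\<^sub>R ?m"
      by (rule spin_matrix_to_axis)
    have "?m = norm ?m *\<^sub>R (spin_matrix A *v axis 3 1)" using m by (simp add: A(2))
    then have "spin_matrix (adjugate A) *v ?m = spin_matrix (adjugate A) *v (norm ?m *\<^sub>R (spin_matrix A *v axis 3 1))"
      by simp
    also have "\<dots> = norm ?m *\<^sub>R (spin_matrix (A ** adjugate A) *v axis 3 1)"
      using A(1) by (simp add: spin_matrix_mult SU2_adjugate matrix_vector_mul_assoc matrix_vector_mult_scaleR)
    also have "spin_matrix (A ** adjugate A) *v axis 3 1 = axis 3 1"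
      using A(1) by (simp add: SL2_adjugate_mult SU2_SL2 vec3_eq_iff matrix3_vector_mult_nth spin_matrix_def mat_one_nth2 Let_def axis_def)
    finally have "(spin_matrix (adjugate A) *v ?m) $ 3 = norm ?m" by (simp add: axis_def)
    then show False using third[OF SU2_adjugate[OF A(1)]] m by simp
  qed
  ultimately show ?thesis by (simp add: mu_R_level_iff)
qed

lemma stable_orbit_meets_level:
  fixes x :: "'n::finite point"
  assumes pos: "\<And>i. \<alpha> i > 0" and x: "x \<in> stable_points \<alpha>"
  obtains y where "y \<in> G_orbit x" "y \<in> mu_R_level \<alpha>"
proof -
  obtain A r where A: "A \<in> SL2" "\<And>B s. B \<in> SL2 \<Longrightarrow> energy \<alpha> x A r \<le> energy \<alpha> x B s"
    using energy_attains_minimum[OF pos x] by blast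
  define y where "y = act A (exp_vec r) x"
  have "energy \<alpha> y B s = energy \<alpha> x (A ** B) (r + s) + 2 * (\<Sum>i\<in>UNIV. \<alpha> i * r $ i)" if "B \<in> SL2" for B s
  proof -
    have "(\<chi> i. exp_vec r $ i * exp_vec s $ i) = exp_vec (r + s)"
      by (simp add: exp_vec_def vec_eq_iff exp_add)
    then show ?thesis
      using A(1) that by (simp add: energy_def y_def act_act distrib_left sum.distrib)
  qed
  moreover from this have "energy \<alpha> y (mat 1) 0 = energy \<alpha> x A r + 2 * (\<Sum>i\<in>UNIV. \<alpha> i * r $ i)" by simp
  ultimately have "y \<in> mu_R_level \<alpha>" using A by (intro energy_minimum_imp_level) (simp add: SL2_mult)
  moreover have "y \<in> G_orbit x" unfolding y_def by (rule G_orbitI[OF A(1)]) simp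
  ultimately show ?thesis using that by blast
qed


section \<open>The core component upstairs\<close>

definition core_points :: "('n::finite \<Rightarrow> real) \<Rightarrow> 'n set \<Rightarrow> 'n point set" where
  "core_points \<alpha> S = {x \<in> stable_points \<alpha>. straight S x \<and> (\<forall>j\<in>-S. fst x $ j = 0)}"

lemma core_points_iff:
  "x \<in> core_points \<alpha> S \<longleftrightarrow> x \<in> stable_points \<alpha> \<and>
     (\<forall>i\<in>S. \<forall>j\<in>S. wedge (snd x $ i) (snd x $ j) = 0) \<and> (\<forall>j\<in>-S. fst x $ j = 0)"
proof (cases "x \<in> stable_points \<alpha>")
  case True
  then have "snd x $ i \<noteq> 0" for i by (simp add: stable_points_def stable_iff_wedge)
  then show ?thesis using straight_iff_wedge[of "snd x" S "fst x"] by (simp add: core_points_def)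
qed (simp add: core_points_def)

lemma core_points_G_orbit: "x \<in> core_points \<alpha> S \<Longrightarrow> y \<in> G_orbit x \<Longrightarrow> y \<in> core_points \<alpha> S"
  by (auto simp: core_points_iff G_orbit_def stable_points_act wedge_act act_nonzero)

lemma closedin_core_points: "closedin (top_of_set (stable_points \<alpha>)) (core_points \<alpha> S)"
proof -
  have "core_points \<alpha> S = stable_points \<alpha> \<inter>
     ((\<Inter>i\<in>S. \<Inter>j\<in>S. {x. wedge (snd x $ i) (snd x $ j) = 0}) \<inter> (\<Inter>j\<in>-S. {x. fst x $ j = 0}))"
    by (auto simp: core_points_iff)
  moreover have "closed ((\<Inter>i\<in>S. \<Inter>j\<in>S. {x :: 'a point. wedge (snd x $ i) (snd x $ j) = 0}) \<inter> (\<Inter>j\<in>-S. {x. fst x $ j = 0}))"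
    unfolding wedge_def by (intro closed_Int closed_INT ballI closed_Collect_eq continuous_intros)
  ultimately show ?thesis by (simp only: closedin_closed_Int)
qed

lemma quotient_map_G_orbit: "quotient_map (top_of_set (stable_points \<alpha>)) (hyperpolygon_space \<alpha>) G_orbit"
  unfolding hyperpolygon_space_def by (rule quotient_map_quotient_topology)

lemma topspace_hyperpolygon_space: "topspace (hyperpolygon_space \<alpha>) = G_orbit ` stable_points \<alpha>"
  by (simp add: hyperpolygon_space_def topspace_quotient_topology)

lemma G_orbit_mem_image_core: "G_orbit x \<in> G_orbit ` core_points \<alpha> S \<longleftrightarrow> x \<in> core_points \<alpha> S"
  by (auto simp: G_orbit_eq_iff intro: core_points_G_orbit)

lemma closedin_core_image: "closedin (hyperpolygon_space \<alpha>) (G_orbit ` core_points \<alpha> S)"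
proof -
  have pre: "{x \<in> topspace (top_of_set (stable_points \<alpha>)). G_orbit x \<in> G_orbit ` core_points \<alpha> S} = core_points \<alpha> S"
    by (auto simp: G_orbit_mem_image_core) (simp add: core_points_def)
  have "G_orbit ` core_points \<alpha> S \<subseteq> topspace (hyperpolygon_space \<alpha>)"
    by (auto simp: topspace_hyperpolygon_space core_points_def)
  from quotient_map_G_orbit[of \<alpha>, unfolded quotient_map_closedin, THEN conjunct2, rule_format, OF this]
  show ?thesis unfolding pre by (rule iffD1) (rule closedin_core_points)
qed

section \<open>Points flowing into the fixed component\<close>

definition flows_into :: "('n::finite \<Rightarrow> real) \<Rightarrow> 'n set \<Rightarrow> 'n point \<Rightarrow> bool" where
  "flows_into \<alpha> S x \<longleftrightarrow>
     (\<exists>l\<in>X_fixed \<alpha> S. limitin (hyperpolygon_space \<alpha>) (\<lambda>c. G_orbit (rescale c x)) l at_infinity)"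

lemma limit_in_invariant_open:
  assumes lim: "limitin (hyperpolygon_space \<alpha>) (\<lambda>c. G_orbit (f c)) (G_orbit z) F"
    and z: "z \<in> stable_points \<alpha>" "z \<in> W" and W: "open W" "\<And>x y. x \<in> W \<Longrightarrow> y \<in> G_orbit x \<Longrightarrow> y \<in> W"
  shows "eventually (\<lambda>c. f c \<in> W) F"
proof -
  let ?U = "G_orbit ` (stable_points \<alpha> \<inter> W)"
  have "{x \<in> stable_points \<alpha>. G_orbit x \<in> ?U} = stable_points \<alpha> \<inter> W"
    using W(2) by (auto simp: G_orbit_eq_iff)
  then have "openin (hyperpolygon_space \<alpha>) ?U"
    using W(1) by (auto simp: hyperpolygon_space_def openin_quotient_topology openin_open_Int)
  then have "eventually (\<lambda>c. G_orbit (f c) \<in> ?U) F" using lim z by (auto simp: limitin_def)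
  then show ?thesis
  proof eventually_elim
    case (elim c)
    then obtain w where "w \<in> W" "f c \<in> G_orbit w" by (auto simp: G_orbit_eq_iff)
    then show ?case by (rule W(2))
  qed
qed

lemma eventually_at_infinity_scaled_bound:
  fixes K B :: real
  assumes "eventually (\<lambda>c::complex. cmod c * K < B) at_infinity" "K \<ge> 0"
  shows "K = 0"
proof (rule ccontr)
  assume "K \<noteq> 0"
  then have K: "K > 0" using assms(2) by simp
  obtain b where b: "\<And>c. cmod c \<ge> b \<Longrightarrow> cmod c * K < B" using assms(1) by (auto simp: eventually_at_infinity)
  define M where "M = max \<bar>b\<bar> (\<bar>B\<bar> / K)"
  have M: "M \<ge> \<bar>b\<bar>" "M \<ge> \<bar>B\<bar> / K" by (simp_all add: M_def)
  let ?c = "complex_of_real M"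
  have "cmod ?c = M" using M(1) by simp
  then have "cmod ?c \<ge> b" "cmod ?c \<ge> \<bar>B\<bar> / K" using M by linarith+
  then have "cmod ?c * K \<ge> \<bar>B\<bar>" using K by (simp add: pos_divide_le_eq)
  then show False using b[OF \<open>cmod ?c \<ge> b\<close>] by simp
qed

text \<open>
  Near a point of \<open>X\<^sub>S\<close> with \<open>p\<^sub>l \<noteq> 0\<close>, where \<open>l \<in> S\<close>, the inequalities
  \<open>|(q\<^sub>l \<and> q\<^sub>i) (p\<^sub>l q\<^sub>j)| < |q\<^sub>i \<and> q\<^sub>j|\<close> and \<open>|(p\<^sub>l q\<^sub>j) (p\<^sub>j q\<^sub>l)| < 1\<close> hold for
  \<open>i \<in> S\<close> and \<open>j \<notin> S\<close>.  They are invariant, but along the flow the left-hand sides scale with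
  \<open>\<lambda>\<close> and \<open>\<lambda>\<^sup>2\<close> while the right-hand sides are constant.  So the left-hand sides vanish
  identically, and since \<open>p\<^sub>l q\<^sub>j \<noteq> 0\<close> this gives \<open>q\<^sub>l \<and> q\<^sub>i = 0\<close> and \<open>p\<^sub>j = 0\<close>.
  Such an \<open>l\<close> exists because otherwise \<open>S\<^sup>c\<close> would be short as well as \<open>S\<close>.
\<close>

lemma flows_into_imp_core:
  fixes x :: "'n::finite point"
  assumes pos: "\<And>i. \<alpha> i > 0" and S: "short \<alpha> S"
    and x: "x \<in> stable_points \<alpha>" and flow: "flows_into \<alpha> S x"
  shows "x \<in> core_points \<alpha> S"
proof -
  obtain z where z: "z \<in> stable_points \<alpha>" "straight S z" "straight (- S) z" "\<forall>j\<in>-S. fst z $ j = 0"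
    and lim: "limitin (hyperpolygon_space \<alpha>) (\<lambda>c. G_orbit (rescale c x)) (G_orbit z) at_infinity"
    using flow by (auto simp: flows_into_def X_fixed_def)
  have nz: "snd y $ i \<noteq> 0" if "y \<in> stable_points \<alpha>" for y i
    using that by (simp add: stable_points_def stable_iff_wedge)
  have stable: "short \<alpha> T" if "\<forall>i\<in>T. \<forall>j\<in>T. wedge (snd z $ i) (snd z $ j) = 0" "\<forall>j\<in>-T. fst z $ j = 0" for T
    using z(1) that by (simp add: stable_points_def stable_iff_wedge)
  have rc: "row_col (fst y $ i) (snd y $ i) = 0" if "y \<in> stable_points \<alpha>" for y i
    using that by (simp add: stable_points_def mu_C_zero_iff)
  have wS: "wedge (snd z $ i) (snd z $ j) = 0" if "i \<in> S \<and> j \<in> S \<or> i \<in> - S \<and> j \<in> - S" for i j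
    using z(2,3) that straight_iff_wedge[of "snd z" _ "fst z"] nz[OF z(1)] by auto
  have long: "\<not> short \<alpha> UNIV" using pos by (simp add: short_def not_less sum_nonneg less_imp_le)
  have wn: "wedge (snd z $ i) (snd z $ j) \<noteq> 0" if "i \<in> S" "j \<in> - S" for i j
  proof
    assume w: "wedge (snd z $ i) (snd z $ j) = 0"
    have "wedge (snd z $ i) (snd z $ k) = 0" for k
      using wS[of i k] wedge_zero_trans[OF w wS[of j k] nz[OF z(1)]] that by (cases "k \<in> S") auto
    then have "wedge (snd z $ k) (snd z $ m) = 0" for k m
      using wedge_zero_trans[of "snd z $ k" "snd z $ i" "snd z $ m"] wedge_commute_zero nz[OF z(1)] by metis
    then have "short \<alpha> UNIV" by (intro stable) auto
    then show False using long by simp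
  qed
  have "\<exists>l\<in>S. fst z $ l \<noteq> 0"
  proof (rule ccontr)
    assume "\<not> ?thesis"
    then have "short \<alpha> (- S)" using wS by (intro stable) auto
    then show False using S by (simp add: short_def)
  qed
  then obtain l where l: "l \<in> S" "fst z $ l \<noteq> 0" by blast
  have rn: "row_col (fst z $ l) (snd z $ j) \<noteq> 0" if "j \<in> - S" for j
    using row_col_zero_of_not_proportional[OF rc[OF z(1)] _ wn[OF l(1) that]] l(2) by blast
  obtain j0 where j0: "j0 \<in> - S" using S long by (cases "S = UNIV") auto
  have resc: "snd (rescale c x) $ i = snd x $ i" "row_col (fst (rescale c x) $ i) v = c * row_col (fst x $ i) v" for c i v
    by (simp_all add: rescale_def split_beta row_col_2 algebra_simps)
  have inv: "open W \<Longrightarrow> z \<in> W \<Longrightarrow> (\<And>y A e. A \<in> SL2 \<Longrightarrow> (\<And>i. e $ i \<noteq> 0) \<Longrightarrow> y \<in> W \<Longrightarrow> act A e y \<in> W) \<Longrightarrow>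
      eventually (\<lambda>c. rescale c x \<in> W) at_infinity" for W
    by (rule limit_in_invariant_open[OF lim z(1)]) (auto simp: G_orbit_def)
  have e1: "eventually (\<lambda>c. cmod c * cmod (wedge (snd x $ l) (snd x $ i) * row_col (fst x $ l) (snd x $ j))
      < cmod (wedge (snd x $ i) (snd x $ j))) at_infinity" if i: "i \<in> S" and j: "j \<in> - S" for i j
  proof -
    let ?W = "{y :: 'n point. cmod (wedge (snd y $ l) (snd y $ i) * row_col (fst y $ l) (snd y $ j)) < cmod (wedge (snd y $ i) (snd y $ j))}"
    have "eventually (\<lambda>c. rescale c x \<in> ?W) at_infinity"
    proof (rule inv)
      show "open ?W" unfolding wedge_def row_col_2 by (intro open_Collect_less continuous_intros)
      show "z \<in> ?W" using wS[of l i] l(1) i wn[OF i j] by simp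
      fix y :: "'n point" and A and e :: "complex ^ 'n" assume "A \<in> SL2" and e: "\<And>i. e $ i \<noteq> 0" and y: "y \<in> ?W"
      have "cmod (e $ i) * cmod (e $ j) * cmod (wedge (snd y $ l) (snd y $ i) * row_col (fst y $ l) (snd y $ j))
          < cmod (e $ i) * cmod (e $ j) * cmod (wedge (snd y $ i) (snd y $ j))"
        using y e by (intro mult_strict_left_mono) auto
      then show "act A e y \<in> ?W" using e[of l] \<open>A \<in> SL2\<close>
        by (simp add: wedge_act row_col_act norm_mult norm_inverse norm_divide field_simps)
    qed
    then show ?thesis by eventually_elim (simp add: resc norm_mult mult_ac)
  qed
  have e2: "eventually (\<lambda>c. c * row_col (fst x $ l) (snd x $ j) \<noteq> 0) at_infinity" if j: "j \<in> - S" for j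
  proof -
    let ?W = "{y :: 'n point. row_col (fst y $ l) (snd y $ j) \<noteq> 0}"
    have "eventually (\<lambda>c. rescale c x \<in> ?W) at_infinity"
    proof (rule inv)
      show "open ?W" unfolding row_col_2 by (intro open_Collect_neq continuous_intros)
    qed (auto simp: rn[OF j] row_col_act)
    then show ?thesis by eventually_elim (simp add: resc)
  qed
  have e3: "eventually (\<lambda>c. (cmod c)\<^sup>2 * cmod (row_col (fst x $ l) (snd x $ j) * row_col (fst x $ j) (snd x $ l)) < 1) at_infinity"
    if j: "j \<in> - S" for j
  proof -
    let ?W = "{y :: 'n point. cmod (row_col (fst y $ l) (snd y $ j) * row_col (fst y $ j) (snd y $ l)) < 1}"
    have "eventually (\<lambda>c. rescale c x \<in> ?W) at_infinity"
    proof (rule inv)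
      show "open ?W" unfolding row_col_2 by (intro open_Collect_less continuous_intros)
      show "z \<in> ?W" using z(4) j by (simp add: row_col_2)
      fix y :: "'n point" and A and e :: "complex ^ 'n" assume "A \<in> SL2" "\<And>i. e $ i \<noteq> 0" "y \<in> ?W"
      then show "act A e y \<in> ?W" by (simp add: row_col_act norm_mult norm_inverse norm_divide field_simps)
    qed
    then show ?thesis by eventually_elim (simp add: resc norm_mult power2_eq_square mult_ac)
  qed
  have n2: "row_col (fst x $ l) (snd x $ j) \<noteq> 0" if "j \<in> - S" for j
    using eventually_happens'[OF trivial_limit_at_infinity e2[OF that]] by auto
  have w1: "wedge (snd x $ l) (snd x $ i) = 0" if "i \<in> S" for i
    using eventually_at_infinity_scaled_bound[OF e1[OF that j0]] n2[OF j0] by simp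
  have w2: "wedge (snd x $ l) (snd x $ j) \<noteq> 0" if "j \<in> - S" for j
    using eventually_happens'[OF trivial_limit_at_infinity e1[OF l(1) that]] w1[OF l(1)] by auto
  have "fst x $ j = 0" if j: "j \<in> - S" for j
  proof -
    have "cmod (row_col (fst x $ l) (snd x $ j) * row_col (fst x $ j) (snd x $ l)) = 0" (is "?K = 0")
    proof (rule eventually_at_infinity_scaled_bound)
      have "eventually (\<lambda>c::complex. cmod c \<ge> 1) at_infinity" by (auto simp: eventually_at_infinity)
      with e3[OF j] show "eventually (\<lambda>c. cmod c * ?K < 1) at_infinity"
      proof eventually_elim
        case (elim c)
        have "cmod c * ?K \<le> (cmod c)\<^sup>2 * ?K"
          using elim(2) by (intro mult_right_mono) (auto simp: self_le_power)
        then show ?case using elim by simp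
      qed
    qed simp
    then have "row_col (fst x $ j) (snd x $ l) = 0" using n2[OF j] by simp
    then show ?thesis using row_col_zero_of_not_proportional[OF _ rc[OF x] w2[OF j]] by blast
  qed
  moreover have "wedge (snd x $ i) (snd x $ j) = 0" if "i \<in> S" "j \<in> S" for i j
    using wedge_zero_trans[OF _ w1[OF that(2)] nz[OF x]] w1[OF that(1)] wedge_commute_zero by blast
  ultimately show ?thesis using x by (simp add: core_points_iff)
qed


section \<open>Density of the flow\<close>

text \<open>
  The common line of the \<open>q\<^sub>i\<close> with \<open>i \<in> S\<close> is the first axis.  The last condition is what remains
  of the complex moment map equation.
\<close>

definition in_normal_form :: "'n set \<Rightarrow> 'n::finite point \<Rightarrow> bool" where
  "in_normal_form S x \<longleftrightarrow>
     (\<forall>i\<in>S. snd x $ i $ 2 = 0 \<and> snd x $ i $ 1 \<noteq> 0 \<and> fst x $ i $ 1 = 0) \<and> (\<forall>j\<in>-S. fst x $ j = 0) \<and>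
     (\<Sum>i\<in>S. snd x $ i $ 1 * fst x $ i $ 2) = 0"

definition in_general_position :: "'n set \<Rightarrow> 'n::finite point \<Rightarrow> bool" where
  "in_general_position S x \<longleftrightarrow> in_normal_form S x \<and> (\<forall>j\<in>-S. snd x $ j $ 2 \<noteq> 0) \<and> (\<exists>i\<in>S. fst x $ i $ 2 \<noteq> 0)"

lemma normal_form_mu_C_zero:
  assumes "in_normal_form S x"
  shows "x \<in> mu_C_zero"
proof -
  have r: "row_col (fst x $ i) (snd x $ i) = 0" for i
    using assms by (cases "i \<in> S") (auto simp: in_normal_form_def row_col_2)
  have "(\<Sum>i\<in>UNIV. snd x $ i $ a * fst x $ i $ b) = 0" for a b
  proof -
    have "(\<Sum>i\<in>UNIV. snd x $ i $ a * fst x $ i $ b) = (\<Sum>i\<in>S. snd x $ i $ a * fst x $ i $ b)"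
      using assms by (intro sum.mono_neutral_right) (auto simp: in_normal_form_def)
    also have "\<dots> = 0"
      using assms exhaust_2[of a] exhaust_2[of b] by (auto simp: in_normal_form_def)
    finally show ?thesis .
  qed
  then have "(\<Sum>i\<in>UNIV. col_row (snd x $ i) (fst x $ i)) = 0"
    by (simp add: vec_eq_iff sum_component)
  then show ?thesis using r by (simp add: mu_C_zero_iff)
qed

lemma short_subset:
  fixes \<alpha> :: "'n::finite \<Rightarrow> real"
  assumes "\<And>i. \<alpha> i > 0" "short \<alpha> S" "T \<subseteq> S"
  shows "short \<alpha> T"
proof -
  have "sum \<alpha> T \<le> sum \<alpha> S" "sum \<alpha> (- S) \<le> sum \<alpha> (- T)"
    using assms(1,3) by (auto intro!: sum_mono2 simp: less_imp_le)
  then show ?thesis using assms(2) by (simp add: short_def)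
qed

text \<open>
  A straight set off which \<open>p\<close> vanishes must contain an index \<open>i \<in> S\<close> with \<open>p\<^sub>i \<noteq> 0\<close>, and then, as
  the \<open>q\<^sub>j\<close> with \<open>j \<notin> S\<close> point in other directions, it is contained in the short set \<open>S\<close>.
\<close>

lemma general_position_core:
  fixes x :: "'n::finite point"
  assumes pos: "\<And>i. \<alpha> i > 0" and S: "short \<alpha> S" and x: "in_general_position S x"
  shows "x \<in> core_points \<alpha> S"
proof -
  have nf: "snd x $ i $ 2 = 0" "snd x $ i $ 1 \<noteq> 0" if "i \<in> S" for i
    using x that by (auto simp: in_general_position_def in_normal_form_def)
  have y: "snd x $ j $ 2 \<noteq> 0" "fst x $ j = 0" if "j \<notin> S" for j
    using x that by (auto simp: in_general_position_def in_normal_form_def)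
  have nz: "snd x $ i \<noteq> 0" for i
    using nf[of i] y[of i] by (cases "i \<in> S") auto
  have "short \<alpha> T" if T: "\<forall>i\<in>T. \<forall>j\<in>T. wedge (snd x $ i) (snd x $ j) = 0" "\<forall>j\<in>-T. fst x $ j = 0" for T
  proof -
    obtain i where i: "i \<in> S" "fst x $ i $ 2 \<noteq> 0" using x by (auto simp: in_general_position_def)
    then have "fst x $ i \<noteq> 0" by auto
    then have "i \<in> T" using T(2) by blast
    have "T \<subseteq> S"
    proof
      fix j assume "j \<in> T"
      then have "wedge (snd x $ i) (snd x $ j) = 0" using T(1) \<open>i \<in> T\<close> by blast
      then have "snd x $ j $ 2 = 0" using nf[OF i(1)] by (simp add: wedge_def)
      then show "j \<in> S" using y by blast
    qed
    then show ?thesis using short_subset pos S by blast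
  qed
  moreover have "x \<in> mu_C_zero"
    by (rule normal_form_mu_C_zero[of S]) (use x in \<open>simp add: in_general_position_def\<close>)
  ultimately have "x \<in> stable_points \<alpha>"
    using nz by (simp add: stable_points_def stable_iff_wedge)
  then show ?thesis using nf y by (auto simp: core_points_iff wedge_def)
qed

lemma core_normal_form:
  fixes x :: "'n::finite point"
  assumes x: "x \<in> core_points \<alpha> S" and S: "S \<noteq> {}"
  obtains y where "y \<in> G_orbit x" "in_normal_form S y"
proof -
  obtain k where k: "k \<in> S" using S by blast
  have nz: "snd z $ i \<noteq> 0" if "z \<in> core_points \<alpha> S" for z i
    using that by (simp add: core_points_def stable_points_def stable_iff_wedge)
  let ?u = "snd x $ k $ 1" and ?v = "snd x $ k $ 2"
  define A :: "complex ^ 2 ^ 2" where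
    "A = (if ?u \<noteq> 0 then vector [vector [?u, 0], vector [?v, inverse ?u]]
          else vector [vector [0, - inverse ?v], vector [?v, 0]])"
  have "?u \<noteq> 0 \<or> ?v \<noteq> 0" using nz[OF x, of k] by (auto simp: vec2_eq_iff)
  then have A: "A \<in> SL2" and A2: "(adjugate A *v snd x $ k) $ 2 = 0"
    by (auto simp: A_def SL2_iff nth2_simps)
  define y where "y = act A (\<chi> i. 1) x"
  have yx: "y \<in> G_orbit x" unfolding y_def by (rule G_orbitI[OF A]) simp
  then have y: "y \<in> core_points \<alpha> S" using core_points_G_orbit x by blast
  have k2: "snd y $ k $ 2 = 0" using A A2 by (simp add: y_def act_nth matrix_inv_SL2)
  then have k1: "snd y $ k $ 1 \<noteq> 0" using nz[OF y, of k] by (auto simp: vec2_eq_iff)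
  have q2: "snd y $ i $ 2 = 0" if "i \<in> S" for i
    using y k that k1 k2 by (auto simp: core_points_iff wedge_def)
  then have q1: "snd y $ i $ 1 \<noteq> 0" if "i \<in> S" for i using nz[OF y, of i] that by (auto simp: vec2_eq_iff)
  have mu: "y \<in> mu_C_zero" using y by (simp add: core_points_def stable_points_def)
  have p1: "fst y $ i $ 1 = 0" if "i \<in> S" for i
  proof -
    have "row_col (fst y $ i) (snd y $ i) = 0" using mu by (simp add: mu_C_zero_iff)
    then show ?thesis using q1[OF that] q2[OF that] by (simp add: row_col_2)
  qed
  have p0: "fst y $ j = 0" if "j \<in> - S" for j using y that by (simp add: core_points_iff)
  have "(\<Sum>i\<in>S. snd y $ i $ 1 * fst y $ i $ 2) = (\<Sum>i\<in>UNIV. snd y $ i $ 1 * fst y $ i $ 2)"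
    using p0 by (intro sum.mono_neutral_left) auto
  also have "\<dots> = (\<Sum>i\<in>UNIV. col_row (snd y $ i) (fst y $ i)) $ 1 $ 2" by (simp add: sum_component)
  also have "\<dots> = 0" using mu by (simp add: mu_C_zero_iff)
  finally have "in_normal_form S y" using p0 p1 q1 q2 by (simp add: in_normal_form_def)
  then show ?thesis using that yx by blast
qed

lemma limitin_G_orbit:
  assumes "(f \<longlongrightarrow> x) F" "x \<in> stable_points \<alpha>" "eventually (\<lambda>c. f c \<in> stable_points \<alpha>) F"
  shows "limitin (hyperpolygon_space \<alpha>) (\<lambda>c. G_orbit (f c)) (G_orbit x) F"
proof -
  have "limitin (top_of_set (stable_points \<alpha>)) f x F"
    using assms by (simp add: limitin_subtopology)
  from continuous_map_limit[OF quotient_imp_continuous_map[OF quotient_map_G_orbit] this]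
  show ?thesis by (simp add: o_def)
qed

text \<open>
  In general position the flow converges: conjugating by the diagonal matrix with entries
  \<open>\<surd>\<lambda>\<close> and \<open>1 / \<surd>\<lambda>\<close>, and rescaling, undoes the effect of \<open>\<lambda>\<close> on \<open>p\<close>, at the cost of
  dividing by \<open>\<lambda>\<close> the first coordinates of the \<open>q\<^sub>j\<close> with \<open>j \<notin> S\<close>.
\<close>

lemma general_position_flows_into:
  fixes x :: "'n::finite point"
  assumes pos: "\<And>i. \<alpha> i > 0" and S: "short \<alpha> S" and x: "in_general_position S x"
  shows "flows_into \<alpha> S x"
proof -
  define w :: "complex \<Rightarrow> 'n point" where
    "w \<xi> = (fst x, \<chi> i. if i \<in> S then snd x $ i else vector [\<xi> * snd x $ i $ 1, snd x $ i $ 2])" for \<xi>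
  have wn: "fst (w \<xi>) = fst x" "i \<in> S \<Longrightarrow> snd (w \<xi>) $ i = snd x $ i"
    "i \<notin> S \<Longrightarrow> snd (w \<xi>) $ i $ 1 = \<xi> * snd x $ i $ 1" "i \<notin> S \<Longrightarrow> snd (w \<xi>) $ i $ 2 = snd x $ i $ 2" for \<xi> i
    by (simp_all add: w_def)
  have "in_general_position S (w \<xi>)" for \<xi>
    using x by (simp add: in_general_position_def in_normal_form_def wn)
  then have core: "w \<xi> \<in> core_points \<alpha> S" for \<xi> using general_position_core pos S by blast
  then have st: "w \<xi> \<in> stable_points \<alpha>" for \<xi> by (simp add: core_points_def)
  have orb: "G_orbit (rescale c x) = G_orbit (w (inverse c))" if c: "c \<noteq> 0" for c
  proof -
    define s where "s = csqrt c"
    have s: "s \<noteq> 0" "s * s = c" using c by (auto simp: s_def simp flip: power2_eq_square)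
    let ?A = "vector [vector [s, 0], vector [0, inverse s]] :: complex ^ 2 ^ 2"
    let ?e = "\<chi> i. if i \<in> S then s else inverse s"
    have A: "?A \<in> SL2" using s by (simp add: SL2_iff)
    have "act ?A ?e (rescale c x) = w (inverse c)"
    proof -
      have "snd (act ?A ?e (rescale c x)) $ i = snd (w (inverse c)) $ i" for i
        using x s c
        by (cases "i \<in> S")
           (simp_all add: vec2_eq_iff act_nth matrix_inv_SL2[OF A] nth2_simps rescale_def split_beta wn
             in_general_position_def in_normal_form_def flip: s(2))
      moreover have "fst (act ?A ?e (rescale c x)) $ i = fst (w (inverse c)) $ i" for i
        using x s c
        by (cases "i \<in> S")
           (auto simp: vec2_eq_iff act_nth nth2_simps rescale_def split_beta wn
             in_general_position_def in_normal_form_def field_simps simp flip: s(2))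
      ultimately show ?thesis by (simp add: prod_eq_iff vec_eq_iff[where 'b='n])
    qed
    then show ?thesis using G_orbit_act[OF A, of ?e "rescale c x"] s by simp
  qed
  have "((\<lambda>c. w (inverse c)) \<longlongrightarrow> w 0) at_infinity"
  proof -
    have "((\<lambda>c. snd (w (inverse c)) $ i) \<longlongrightarrow> snd (w 0) $ i) at_infinity" for i
    proof (cases "i \<in> S")
      case False
      have inv: "((\<lambda>c::complex. inverse c) \<longlongrightarrow> 0) at_infinity" by (rule tendsto_inverse_0)
      show ?thesis
      proof (rule vec_tendstoI)
        fix a :: 2
        show "((\<lambda>c. snd (w (inverse c)) $ i $ a) \<longlongrightarrow> snd (w 0) $ i $ a) at_infinity"
          using exhaust_2[of a] by (elim disjE; simp only: wn(3,4)[OF False]; intro tendsto_intros inv)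
      qed
    qed (simp add: wn)
    then have "((\<lambda>c. (fst (w (inverse c)), snd (w (inverse c)))) \<longlongrightarrow> (fst (w 0), snd (w 0))) at_infinity"
      by (intro tendsto_Pair vec_tendstoI[of "\<lambda>c. snd (w (inverse c))"]) (simp_all add: wn)
    then show ?thesis by simp
  qed
  then have "limitin (hyperpolygon_space \<alpha>) (\<lambda>c. G_orbit (w (inverse c))) (G_orbit (w 0)) at_infinity"
    by (rule limitin_G_orbit) (simp_all add: st)
  then have "limitin (hyperpolygon_space \<alpha>) (\<lambda>c. G_orbit (rescale c x)) (G_orbit (w 0)) at_infinity"
  proof (rule limitin_transform_eventually[rotated])
    show "eventually (\<lambda>c. G_orbit (w (inverse c)) = G_orbit (rescale c x)) at_infinity"
      unfolding eventually_at_infinity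
    proof (intro exI[of _ 1] allI impI)
      fix c :: complex assume "1 \<le> cmod c"
      then show "G_orbit (w (inverse c)) = G_orbit (rescale c x)" by (intro orb[symmetric]) auto
    qed
  qed
  moreover have "G_orbit (w 0) \<in> X_fixed \<alpha> S"
  proof -
    have "snd (w 0) $ i \<noteq> 0" for i using st by (simp add: stable_points_def stable_iff_wedge)
    then have "straight (- S) (fst (w 0), snd (w 0))"
      by (simp add: straight_iff_wedge wedge_def wn)
    then show ?thesis using core[of 0] unfolding X_fixed_def core_points_def
      by (intro CollectI exI[of _ "fst (w 0)"] exI[of _ "snd (w 0)"]) simp
  qed
  ultimately show ?thesis by (auto simp: flows_into_def)
qed

text \<open>
  The condition \<open>|S| \<ge> 2\<close> is what makes it possible to move \<open>p = 0\<close> off zero within the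
  level set of the complex moment map.
\<close>

lemma normal_form_approx:
  fixes x :: "'n::finite point"
  assumes x: "in_normal_form S x" and S: "card S \<ge> 2"
  obtains f :: "complex \<Rightarrow> 'n point" where "(f \<longlongrightarrow> x) (at 0)" "\<And>c. c \<noteq> 0 \<Longrightarrow> in_general_position S (f c)"
proof -
  obtain k m where km: "k \<in> S" "m \<in> S" "k \<noteq> m"
  proof -
    obtain k where k: "k \<in> S" using S by fastforce
    then have "card (S - {k}) \<noteq> 0" using S by simp
    then have "S - {k} \<noteq> {}" by (metis card.empty)
    then show ?thesis using k that by blast
  qed
  have q1: "snd x $ i $ 1 \<noteq> 0" if "i \<in> S" for i using x that by (simp add: in_normal_form_def)
  define z where "z = (\<exists>i\<in>S. fst x $ i $ 2 \<noteq> 0)"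
  \<comment> \<open>The two perturbations of \<open>p\<close>, at \<open>k\<close> and at \<open>m\<close>, cancel in the complex moment map.\<close>
  define \<gamma> where "\<gamma> i = (if z then 0 else if i = k then inverse (snd x $ k $ 1) else if i = m then - inverse (snd x $ m $ 1) else 0)" for i
  define \<eta> where "\<eta> j = (if j \<notin> S \<and> snd x $ j $ 2 = 0 then 1 else 0 :: complex)" for j
  define f :: "complex \<Rightarrow> 'n point" where
    "f c = (\<chi> i. fst x $ i + vector [0, c * \<gamma> i], \<chi> i. snd x $ i + vector [0, c * \<eta> i])" for c
  have fn: "fst (f c) $ i $ 1 = fst x $ i $ 1" "fst (f c) $ i $ 2 = fst x $ i $ 2 + c * \<gamma> i"
     "snd (f c) $ i $ 1 = snd x $ i $ 1" "snd (f c) $ i $ 2 = snd x $ i $ 2 + c * \<eta> i" for c i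
    by (simp_all add: f_def)
  have "(\<Sum>i\<in>S. snd x $ i $ 1 * \<gamma> i) = 0"
  proof (cases z)
    case False
    have "(\<Sum>i\<in>S. snd x $ i $ 1 * \<gamma> i) = (\<Sum>i\<in>{k, m}. snd x $ i $ 1 * \<gamma> i)"
      using km by (intro sum.mono_neutral_right) (auto simp: \<gamma>_def)
    also have "\<dots> = 0" using km False q1 by (simp add: \<gamma>_def)
    finally show ?thesis .
  qed (simp add: \<gamma>_def)
  moreover have "(\<Sum>i\<in>S. snd x $ i $ 1 * fst x $ i $ 2) = 0" using x by (simp add: in_normal_form_def)
  ultimately have "(\<Sum>i\<in>S. snd x $ i $ 1 * (fst x $ i $ 2 + c * \<gamma> i)) = 0" for c
    by (simp add: distrib_left sum.distrib mult.left_commute[of _ c] flip: sum_distrib_left)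
  moreover have "\<gamma> j = 0" if "j \<notin> S" for j using that km by (auto simp: \<gamma>_def)
  ultimately have nf: "in_normal_form S (f c)" for c
    using x by (auto simp: in_normal_form_def fn \<eta>_def vec2_eq_iff)
  have "in_general_position S (f c)" if c: "c \<noteq> 0" for c
  proof -
    have "\<exists>i\<in>S. fst (f c) $ i $ 2 \<noteq> 0"
    proof (cases z)
      case True
      then show ?thesis by (auto simp: fn \<gamma>_def z_def)
    next
      case False
      then have "fst (f c) $ k $ 2 = c * inverse (snd x $ k $ 1)" using km by (auto simp: fn \<gamma>_def z_def)
      then have "fst (f c) $ k $ 2 \<noteq> 0" using c q1[OF km(1)] by simp
      then show ?thesis using km(1) by blast
    qed
    then show ?thesis using nf c by (auto simp: in_general_position_def fn \<eta>_def)
  qed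
  moreover have "(f \<longlongrightarrow> x) (at 0)"
  proof -
    have "((\<lambda>c. fst (f c) $ i $ a) \<longlongrightarrow> fst x $ i $ a + 0 * (if a = 2 then \<gamma> i else 0)) (at 0)"
      "((\<lambda>c. snd (f c) $ i $ a) \<longlongrightarrow> snd x $ i $ a + 0 * (if a = 2 then \<eta> i else 0)) (at 0)" for i a
    proof -
      have "fst (f c) $ i $ a = fst x $ i $ a + c * (if a = 2 then \<gamma> i else 0)"
        "snd (f c) $ i $ a = snd x $ i $ a + c * (if a = 2 then \<eta> i else 0)" for c
        using exhaust_2[of a] by (auto simp: fn)
      then show "((\<lambda>c. fst (f c) $ i $ a) \<longlongrightarrow> fst x $ i $ a + 0 * (if a = 2 then \<gamma> i else 0)) (at 0)"
        "((\<lambda>c. snd (f c) $ i $ a) \<longlongrightarrow> snd x $ i $ a + 0 * (if a = 2 then \<eta> i else 0)) (at 0)"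
        by (simp_all only:) (intro tendsto_intros)+
    qed
    then have "((\<lambda>c. (fst (f c), snd (f c))) \<longlongrightarrow> (fst x, snd x)) (at 0)"
      by (intro tendsto_Pair vec_tendstoI) simp_all
    then show ?thesis by simp
  qed
  ultimately show ?thesis using that by blast
qed

text \<open>
  The image of the core points is closed and contains the points of the flow, and points in general
  position approximate every core point.
\<close>

lemma U_core_eq:
  fixes \<alpha> :: "'n::finite \<Rightarrow> real"
  assumes pos: "\<And>i. \<alpha> i > 0" and S: "short \<alpha> S" "card S \<ge> 2"
  shows "U_core \<alpha> S = G_orbit ` core_points \<alpha> S"
proof -
  let ?F = "{G_orbit x | x. x \<in> stable_points \<alpha> \<and> flows_into \<alpha> S x}"
  have U: "U_core \<alpha> S = hyperpolygon_space \<alpha> closure_of ?F"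
    by (simp add: U_core_def flows_into_def)
  have "?F \<subseteq> G_orbit ` core_points \<alpha> S" using flows_into_imp_core pos S(1) by blast
  then have "U_core \<alpha> S \<subseteq> G_orbit ` core_points \<alpha> S"
    unfolding U by (rule closure_of_minimal[OF _ closedin_core_image])
  moreover have "G_orbit x \<in> hyperpolygon_space \<alpha> closure_of ?F" if x: "x \<in> core_points \<alpha> S" for x
    unfolding in_closure_of
  proof (intro conjI allI impI)
    show "G_orbit x \<in> topspace (hyperpolygon_space \<alpha>)"
      using x by (simp add: topspace_hyperpolygon_space core_points_def)
    fix T assume T: "G_orbit x \<in> T \<and> openin (hyperpolygon_space \<alpha>) T"
    have "S \<noteq> {}" using S(2) by auto
    then obtain y where y: "y \<in> G_orbit x" "in_normal_form S y" using core_normal_form[OF x] by blast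
    obtain f :: "complex \<Rightarrow> 'n point" where f: "(f \<longlongrightarrow> y) (at 0)" "\<And>c. c \<noteq> 0 \<Longrightarrow> in_general_position S (f c)"
      using normal_form_approx[OF y(2) S(2)] by blast
    have st: "f c \<in> stable_points \<alpha>" if "c \<noteq> 0" for c
      using general_position_core[OF pos S(1) f(2)[OF that]] by (simp add: core_points_def)
    have "y \<in> stable_points \<alpha>" using core_points_G_orbit[OF x y(1)] by (simp add: core_points_def)
    then have "limitin (hyperpolygon_space \<alpha>) (\<lambda>c. G_orbit (f c)) (G_orbit y) (at 0)"
      by (rule limitin_G_orbit[OF f(1)]) (auto simp: eventually_at_filter st)
    moreover have "G_orbit y = G_orbit x" using y by (simp add: G_orbit_eq_iff)
    ultimately have "eventually (\<lambda>c. G_orbit (f c) \<in> T) (at 0)" using T by (auto simp: limitin_def)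
    moreover have "eventually (\<lambda>c::complex. c \<noteq> 0) (at 0)" by (simp add: eventually_at_filter)
    ultimately have "eventually (\<lambda>c. c \<noteq> 0 \<and> G_orbit (f c) \<in> T) (at 0)" by eventually_elim simp
    then obtain c where c: "c \<noteq> 0" "G_orbit (f c) \<in> T" using eventually_happens[of _ "at (0::complex)"] by auto
    then have "G_orbit (f c) \<in> ?F"
      using st[OF c(1)] general_position_flows_into[OF pos S(1) f(2)[OF c(1)]] by blast
    then show "\<exists>y. y \<in> ?F \<and> y \<in> T" using c(2) by blast
  qed
  ultimately show ?thesis using U by blast
qed


section \<open>Level points of the core and configurations of vectors\<close>

definition core_level :: "('n::finite \<Rightarrow> real) \<Rightarrow> 'n set \<Rightarrow> 'n point set" where
  "core_level \<alpha> S = mu_R_level \<alpha> \<inter> core_points \<alpha> S"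

text \<open>
  The factor \<open>2\<close> gives \<open>u\<^sub>i\<close> the length \<open>|q\<^sub>i| |p\<^sub>i|\<close>, so that
  \<open>\<alpha>\<^sub>i\<^sup>2 + |u\<^sub>i|\<^sup>2\<close> is the square of \<open>(|q\<^sub>i|\<^sup>2 + |p\<^sub>i|\<^sup>2) / 2\<close>.
\<close>

definition to_vectors :: "'n set \<Rightarrow> 'n::finite point \<Rightarrow> (real ^ 3 ^ 'n) \<times> (real ^ 3)" where
  "to_vectors S x =
     (\<chi> i. if i \<in> S then 2 *\<^sub>R pauli (col_row (snd x $ i) (fst x $ i)) else hopf (snd x $ i),
      \<Sum>i\<in>S. moment (fst x $ i) (snd x $ i))"

definition rotate_config :: "real ^ 3 ^ 3 \<Rightarrow> (real ^ 3 ^ 'n) \<times> (real ^ 3) \<Rightarrow> (real ^ 3 ^ 'n) \<times> (real ^ 3)" where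
  "rotate_config R z = (\<chi> i. R *v (fst z $ i), R *v snd z)"

lemma core_level_D:
  assumes "x \<in> core_level \<alpha> S"
  shows "\<And>i. snd x $ i \<noteq> 0" "\<And>i. row_col (fst x $ i) (snd x $ i) = 0"
    "\<And>j. j \<notin> S \<Longrightarrow> fst x $ j = 0" "\<And>i j. i \<in> S \<Longrightarrow> j \<in> S \<Longrightarrow> wedge (snd x $ i) (snd x $ j) = 0"
    "\<And>i. (norm (snd x $ i))\<^sup>2 - (norm (fst x $ i))\<^sup>2 = 2 * \<alpha> i"
    "(\<Sum>i\<in>UNIV. moment (fst x $ i) (snd x $ i)) = 0" "x \<in> mu_C_zero"
  using assms
  by (auto simp: core_level_def core_points_iff stable_points_def stable_iff_wedge mu_R_level_iff mu_C_zero_iff)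

lemma core_level_act:
  assumes "x \<in> core_level \<alpha> S" "A \<in> SU2" "\<And>i. cmod (e $ i) = 1"
  shows "act A e x \<in> core_level \<alpha> S"
proof -
  have "act A e x \<in> G_orbit x" using K_orbitI[OF assms(2,3)] K_orbit_subset_G_orbit by blast
  then show ?thesis
    using assms by (auto simp: core_level_def mu_R_level_act intro: core_points_G_orbit)
qed

lemma to_vectors_act:
  assumes "A \<in> SU2" "\<And>i. cmod (e $ i) = 1"
  shows "to_vectors S (act A e x) = rotate_config (spin_matrix A) (to_vectors S x)"
proof -
  have h: "hopf (snd (act A e x) $ i) = spin_matrix A *v hopf (snd x $ i)" for i
    using moment_act[OF assms, where i = i and x = "(0, snd x)"] by (simp add: act_def split_beta)
  show ?thesis
    by (simp add: to_vectors_def rotate_config_def vec_eq_iff[where 'b='a] pauli_col_row_act[OF assms] h moment_act[OF assms]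
        matrix_vector_mult_scaleR linear_sum[OF matrix_vector_mul_linear])
qed

lemma rotate_config_mult: "rotate_config A (rotate_config B z) = rotate_config (A ** B) z"
  by (simp add: rotate_config_def matrix_vector_mul_assoc)

lemma rotate_config_1: "rotate_config (mat 1) z = z"
  by (simp add: rotate_config_def)

lemma rotation_orbit_eq: "rotation_orbit z = {rotate_config R z | R. rotation_matrix R}"
  by (cases z) (simp add: rotation_orbit_def rotate_config_def)

lemma rotation_matrix_mult: "rotation_matrix A \<Longrightarrow> rotation_matrix B \<Longrightarrow> rotation_matrix (A ** B)"
  for A B :: "real ^ 3 ^ 3"
  by (simp add: rotation_matrix_def orthogonal_matrix_mul det_mul)

lemma rotation_matrix_transpose: "rotation_matrix A \<Longrightarrow> rotation_matrix (transpose A)"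
  for A :: "real ^ 3 ^ 3"
  by (simp add: rotation_matrix_def orthogonal_matrix_transpose det_transpose)

lemma rotation_transpose_cancel:
  "rotation_matrix A \<Longrightarrow> transpose A ** A = mat 1" "rotation_matrix A \<Longrightarrow> A ** transpose A = mat 1"
  for A :: "real ^ 3 ^ 3"
  by (simp_all add: rotation_matrix_def orthogonal_matrix_def)

lemma rotation_orbit_eq_iff: "rotation_orbit z = rotation_orbit z' \<longleftrightarrow> z \<in> rotation_orbit z'"
proof
  assume "z \<in> rotation_orbit z'"
  then obtain R where R: "rotation_matrix R" "z = rotate_config R z'" by (auto simp: rotation_orbit_eq)
  have "rotate_config Q z = rotate_config (Q ** R) z'" for Q by (simp add: R(2) rotate_config_mult)
  moreover have "rotate_config Q z' = rotate_config (Q ** transpose R) z" for Q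
    by (simp add: R(2) rotate_config_mult rotation_transpose_cancel R(1) flip: matrix_mul_assoc)
  ultimately show "rotation_orbit z = rotation_orbit z'"
    unfolding rotation_orbit_eq using R(1) rotation_matrix_mult rotation_matrix_transpose by blast
next
  have "rotation_matrix (mat 1 :: real ^ 3 ^ 3)"
    by (simp add: rotation_matrix_def orthogonal_matrix_def)
  then have "z \<in> rotation_orbit z"
    using rotate_config_1[of z] unfolding rotation_orbit_eq by (metis (mono_tags, lifting) mem_Collect_eq)
  then show "rotation_orbit z = rotation_orbit z' \<Longrightarrow> z \<in> rotation_orbit z'" by simp
qed

lemma vector_configs_rotate:
  assumes R: "rotation_matrix R" and z: "z \<in> vector_configs \<alpha> S"
  shows "rotate_config R z \<in> vector_configs \<alpha> S"
proof -
  have orth: "orthogonal_transformation ((*v) R)"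
    using R by (simp add: rotation_matrix_def orthogonal_transformation_matrix matrix_vector_mul_linear)
  have n: "norm (R *v x) = norm x" for x using orth by (rule orthogonal_transformation_norm)
  have i: "(R *v x) \<bullet> (R *v y) = x \<bullet> y" for x y using orth by (simp add: orthogonal_transformation_def)
  have s: "(\<Sum>i\<in>T. R *v f i) = R *v (\<Sum>i\<in>T. f i)" for T :: "'a set" and f
    by (simp add: linear_sum[OF matrix_vector_mul_linear])
  have "R *v snd z + (\<Sum>j\<in>-S. R *v fst z $ j) = R *v (snd z + (\<Sum>j\<in>-S. fst z $ j))"
    by (simp add: s matrix_vector_right_distrib)
  then show ?thesis using z by (cases z) (simp add: vector_configs_def rotate_config_def n i s)
qed

lemma core_moment_sum:
  assumes x: "x \<in> core_level \<alpha> S" and k: "k \<in> S"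
  obtains c where "c > 0" "snd (to_vectors S x) = c *\<^sub>R hopf (snd x $ k)"
    "norm (snd (to_vectors S x)) = (\<Sum>i\<in>S. ((norm (snd x $ i))\<^sup>2 + (norm (fst x $ i))\<^sup>2) / 2)"
proof -
  obtain c where "c > 0" "(\<Sum>i\<in>S. moment (fst x $ i) (snd x $ i)) = c *\<^sub>R hopf (snd x $ k)"
    "norm (\<Sum>i\<in>S. moment (fst x $ i) (snd x $ i)) = (\<Sum>i\<in>S. norm (moment (fst x $ i) (snd x $ i)))"
    by (rule straight_moment_sum[of "\<lambda>i. fst x $ i" "\<lambda>i. snd x $ i" S k]) (use core_level_D[OF x] k in auto)
  then show ?thesis using that by (simp add: to_vectors_def norm_moment core_level_D[OF x])
qed

lemma norm_fst_to_vectors: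
  assumes x: "x \<in> core_level \<alpha> S" and i: "i \<in> S"
  shows "sqrt ((\<alpha> i)\<^sup>2 + (norm (fst (to_vectors S x) $ i))\<^sup>2) = ((norm (snd x $ i))\<^sup>2 + (norm (fst x $ i))\<^sup>2) / 2"
proof -
  have u: "norm (fst (to_vectors S x) $ i) = norm (snd x $ i) * norm (fst x $ i)"
    using i by (simp add: to_vectors_def norm_pauli_nilpotent core_level_D(1,2)[OF x])
  have a: "\<alpha> i = ((norm (snd x $ i))\<^sup>2 - (norm (fst x $ i))\<^sup>2) / 2" using core_level_D(5)[OF x, of i] by simp
  have "(\<alpha> i)\<^sup>2 + (norm (fst (to_vectors S x) $ i))\<^sup>2 = (((norm (snd x $ i))\<^sup>2 + (norm (fst x $ i))\<^sup>2) / 2)\<^sup>2"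
    unfolding u a by (simp add: power2_eq_square field_simps)
  then show ?thesis by simp
qed

lemma to_vectors_in_configs:
  assumes x: "x \<in> core_level \<alpha> S" and S: "S \<noteq> {}"
  shows "to_vectors S x \<in> vector_configs \<alpha> S"
proof -
  let ?w = "snd (to_vectors S x)" and ?v = "fst (to_vectors S x)"
  note D = core_level_D[OF x]
  obtain k where k: "k \<in> S" using S by blast
  have off: "?v $ j = moment (fst x $ j) (snd x $ j)" if "j \<in> - S" for j
    using that D(3) by (simp add: to_vectors_def)
  have w: "?w = (\<Sum>i\<in>S. moment (fst x $ i) (snd x $ i))" by (simp add: to_vectors_def)
  have v: "(\<Sum>j\<in>-S. ?v $ j) = (\<Sum>j\<in>-S. moment (fst x $ j) (snd x $ j))" by (intro sum.cong refl off)
  have "?w + (\<Sum>j\<in>-S. ?v $ j) = (\<Sum>i\<in>UNIV. moment (fst x $ i) (snd x $ i))"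
    unfolding w v using sum.subset_diff[of S UNIV "\<lambda>i. moment (fst x $ i) (snd x $ i)"]
    by (simp add: Compl_eq_Diff_UNIV add.commute)
  then have 1: "?w + (\<Sum>j\<in>-S. ?v $ j) = 0" using D(6) by simp
  have 2: "(\<Sum>i\<in>S. ?v $ i) = 0"
  proof -
    have "(\<Sum>i\<in>S. ?v $ i) = 2 *\<^sub>R pauli (\<Sum>i\<in>S. col_row (snd x $ i) (fst x $ i))"
      by (simp add: to_vectors_def linear_sum[OF linear_pauli] scaleR_sum_right)
    also have "(\<Sum>i\<in>S. col_row (snd x $ i) (fst x $ i)) = (\<Sum>i\<in>UNIV. col_row (snd x $ i) (fst x $ i))"
      by (rule sum.mono_neutral_left) (auto simp: D(3) matrix2_eq_iff)
    also have "\<dots> = 0" using D(7) by (simp add: mu_C_zero_iff)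
    finally show ?thesis by (simp add: linear_0[OF linear_pauli])
  qed
  have 3: "?v $ i \<bullet> ?w = 0" if i: "i \<in> S" for i
  proof -
    obtain c where "?w = c *\<^sub>R hopf (snd x $ i)" using core_moment_sum[OF x i] by metis
    then show ?thesis using i D(1,2) by (simp add: pauli_nilpotent_orthogonal to_vectors_def)
  qed
  have 4: "norm (?v $ j) = \<alpha> j" if "j \<in> - S" for j
    using that D(5)[of j] D(3)[of j] by (simp add: to_vectors_def norm_hopf)
  have 5: "norm ?w = (\<Sum>i\<in>S. sqrt ((\<alpha> i)\<^sup>2 + (norm (?v $ i))\<^sup>2))"
    using core_moment_sum[OF x k] norm_fst_to_vectors[OF x] by (metis (no_types, lifting) sum.cong)
  show ?thesis using 1 2 3 4 5 by (simp add: vector_configs_def split_beta)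
qed

text \<open>
  The direction of \<open>w\<close> together with the lengths determines the \<open>q\<^sub>i\<close> up to phases,
  and then \<open>u\<^sub>i\<close> determines \<open>p\<^sub>i\<close>.
\<close>

lemma to_vectors_inj:
  fixes x y :: "'n::finite point"
  assumes x: "x \<in> core_level \<alpha> S" and y: "y \<in> core_level \<alpha> S"
    and eq: "to_vectors S x = to_vectors S y"
  shows "y \<in> K_orbit x"
proof -
  note X = core_level_D[OF x] and Y = core_level_D[OF y]
  have "hopf (snd x $ i) = hopf (snd y $ i)" for i
  proof (cases "i \<in> S")
    case False
    then show ?thesis using arg_cong[OF eq, of "\<lambda>z. fst z $ i"] by (simp add: to_vectors_def)
  next
    case True
    have "((norm (snd x $ i))\<^sup>2 + (norm (fst x $ i))\<^sup>2) / 2 = ((norm (snd y $ i))\<^sup>2 + (norm (fst y $ i))\<^sup>2) / 2"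
      using norm_fst_to_vectors[OF x True] norm_fst_to_vectors[OF y True] eq by simp
    then have "(norm (snd x $ i))\<^sup>2 = (norm (snd y $ i))\<^sup>2" using X(5)[of i] Y(5)[of i] by argo
    then have n: "norm (hopf (snd x $ i)) = norm (hopf (snd y $ i))" by (simp add: norm_hopf)
    obtain c where c: "c > 0" "snd (to_vectors S x) = c *\<^sub>R hopf (snd x $ i)" using core_moment_sum[OF x True] by metis
    obtain d where d: "d > 0" "snd (to_vectors S y) = d *\<^sub>R hopf (snd y $ i)" using core_moment_sum[OF y True] by metis
    have e: "c *\<^sub>R hopf (snd x $ i) = d *\<^sub>R hopf (snd y $ i)" using c d eq by simp
    from arg_cong[OF this, of norm] have "c * norm (hopf (snd x $ i)) = d * norm (hopf (snd x $ i))"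
      using c(1) d(1) n by simp
    then have "c = d" using X(1)[of i] by (simp add: norm_hopf)
    then show ?thesis using e c(1) by simp
  qed
  then have "\<exists>e. cmod e = 1 \<and> snd y $ i = e *s snd x $ i" for i using hopf_eq_imp_phase by metis
  then obtain e where e: "\<And>i. cmod (e i) = 1" "\<And>i. snd y $ i = e i *s snd x $ i" by metis
  have e0: "e i \<noteq> 0" for i using e(1)[of i] by auto
  have p: "fst x $ i = e i *s fst y $ i" for i
  proof (cases "i \<in> S")
    case False
    then show ?thesis by (simp add: X(3) Y(3))
  next
    case True
    have "col_row (snd y $ i) (fst y $ i) = col_row (snd x $ i) (e i *s fst y $ i)"
      by (simp add: e(2) matrix2_eq_iff)
    moreover have "pauli (col_row (snd x $ i) (fst x $ i)) = pauli (col_row (snd y $ i) (fst y $ i))"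
      using arg_cong[OF eq, of "\<lambda>z. fst z $ i"] True by (simp add: to_vectors_def)
    moreover have "row_col (e i *s fst y $ i) (snd x $ i) = 0"
      using Y(2)[of i] by (simp add: row_col_2 e(2) algebra_simps)
    ultimately show ?thesis using annihilator_inj[OF _ X(2) _ X(1)] by metis
  qed
  have "y = act (mat 1) (\<chi> i. e i) x"
    using e0 by (simp add: prod_eq_iff vec_eq_iff[where 'b='n] vec2_eq_iff act_nth matrix_inv_SL2 nth2_simps e(2) p)
  then show ?thesis using K_orbitI[OF SU2_one, of "\<chi> i. e i" x] e(1) by simp
qed

text \<open>
  When \<open>w\<close> points along the third axis, all \<open>u\<^sub>i\<close> are horizontal and a preimage can be written down:
  \<open>q\<^sub>i = (a\<^sub>i, 0)\<close> and \<open>p\<^sub>i = (0, b\<^sub>i)\<close>, where \<open>a\<^sub>i b\<^sub>i\<close> is the conjugate of \<open>u\<^sub>i\<close> as a complex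
  number and \<open>a\<^sub>i\<^sup>2 = \<surd>(\<alpha>\<^sub>i\<^sup>2 + |u\<^sub>i|\<^sup>2) + \<alpha>\<^sub>i\<close> solves the norm equation.
\<close>

lemma to_vectors_surj_axis:
  fixes v :: "real ^ 3 ^ 'n::finite"
  assumes pos: "\<And>i. \<alpha> i > 0" and gen: "generic \<alpha>"
    and z: "(v, l *\<^sub>R axis 3 1) \<in> vector_configs \<alpha> S" and l: "l > 0"
  obtains x where "x \<in> core_level \<alpha> S" "to_vectors S x = (v, l *\<^sub>R axis 3 1)"
proof -
  have Z: "l *\<^sub>R axis 3 1 + (\<Sum>j\<in>-S. v $ j) = 0" "(\<Sum>i\<in>S. v $ i) = 0"
    "\<And>i. i \<in> S \<Longrightarrow> v $ i \<bullet> (l *\<^sub>R axis 3 1) = 0" "\<And>j. j \<in> - S \<Longrightarrow> norm (v $ j) = \<alpha> j"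
    "norm (l *\<^sub>R (axis 3 1 :: real ^ 3)) = (\<Sum>i\<in>S. sqrt ((\<alpha> i)\<^sup>2 + (norm (v $ i))\<^sup>2))"
    using z by (auto simp: vector_configs_def)
  have v3: "v $ i $ 3 = 0" if "i \<in> S" for i using Z(3)[OF that] l by (simp add: inner_axis)
  have lsum: "l = (\<Sum>i\<in>S. sqrt ((\<alpha> i)\<^sup>2 + (norm (v $ i))\<^sup>2))" using Z(5) l by simp
  define r where "r i = sqrt ((\<alpha> i)\<^sup>2 + (norm (v $ i))\<^sup>2)" for i
  have r: "r i > 0" "(r i)\<^sup>2 = (\<alpha> i)\<^sup>2 + (norm (v $ i))\<^sup>2" for i
    using pos[of i] by (auto simp: r_def add_pos_nonneg)
  define a where "a i = sqrt (r i + \<alpha> i)" for i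
  have ra: "r i + \<alpha> i > 0" for i using r(1)[of i] pos[of i] by simp
  have a: "a i > 0" "(a i)\<^sup>2 = r i + \<alpha> i" for i using ra[of i] by (auto simp: a_def)
  have "\<exists>h. hopf h = v $ j" for j using hopf_surj by metis
  then obtain h where h: "\<And>j. hopf (h j) = v $ j" by metis
  define b where "b i = Complex (v $ i $ 1) (- v $ i $ 2) / complex_of_real (a i)" for i
  have ab: "complex_of_real (a i) * b i = Complex (v $ i $ 1) (- v $ i $ 2)" for i using a(1)[of i] by (simp add: b_def)
  have b2: "(cmod (b i))\<^sup>2 = r i - \<alpha> i" if "i \<in> S" for i
  proof -
    have "(cmod (b i))\<^sup>2 = (norm (v $ i))\<^sup>2 / (a i)\<^sup>2"
      using a(1)[of i] v3[OF that] by (simp add: b_def norm_divide power_divide cmod_power2 norm_vec3_squared)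
    also have "(norm (v $ i))\<^sup>2 = (r i - \<alpha> i) * (r i + \<alpha> i)" using r(2)[of i] by (simp add: algebra_simps power2_eq_square)
    finally show ?thesis unfolding a(2) using ra[of i] by simp
  qed
  define x :: "'n point" where
    "x = (\<chi> i. if i \<in> S then vector [0, b i] else 0, \<chi> i. if i \<in> S then vector [complex_of_real (a i), 0] else h i)"
  have xS: "fst x $ i = vector [0, b i]" "snd x $ i = vector [complex_of_real (a i), 0]" if "i \<in> S" for i
    using that by (simp_all add: x_def)
  have xC: "fst x $ j = 0" "snd x $ j = h j" if "j \<notin> S" for j using that by (simp_all add: x_def)
  have norms: "(norm (snd x $ i))\<^sup>2 = r i + \<alpha> i" "(norm (fst x $ i))\<^sup>2 = r i - \<alpha> i" if "i \<in> S" for i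
    using that by (simp_all add: xS norm_vec2_squared b2 a(2))
  have mom: "moment (fst x $ i) (snd x $ i) = r i *\<^sub>R axis 3 1" if "i \<in> S" for i
  proof -
    have "moment (fst x $ i) (snd x $ i) $ 3 = r i"
      unfolding moment_nth3 using that by (simp add: xS b2 a(2))
    moreover have "moment (fst x $ i) (snd x $ i) $ 1 = 0" "moment (fst x $ i) (snd x $ i) $ 2 = 0"
      using that by (simp_all add: moment_hopf hopf_nth xS)
    ultimately show ?thesis by (simp add: vec3_eq_iff axis_def)
  qed
  have w: "(\<Sum>i\<in>S. moment (fst x $ i) (snd x $ i)) = l *\<^sub>R axis 3 1"
    by (simp add: mom lsum r_def flip: scaleR_left.sum)
  have momC: "moment (fst x $ j) (snd x $ j) = v $ j" if "j \<in> - S" for j using that by (simp add: xC h)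
  have lev: "x \<in> mu_R_level \<alpha>"
  proof -
    have "(\<Sum>i\<in>UNIV. moment (fst x $ i) (snd x $ i)) = l *\<^sub>R axis 3 1 + (\<Sum>j\<in>-S. v $ j)"
      using sum.subset_diff[of S UNIV "\<lambda>i. moment (fst x $ i) (snd x $ i)"] momC w
      by (simp add: Compl_eq_Diff_UNIV add.commute)
    moreover have "(norm (snd x $ i))\<^sup>2 - (norm (fst x $ i))\<^sup>2 = 2 * \<alpha> i" for i
    proof (cases "i \<in> S")
      case False
      then have "(norm (h i))\<^sup>2 = 2 * \<alpha> i" using Z(4)[of i] norm_hopf[of "h i"] h[of i] by simp
      then show ?thesis using False by (simp add: xC)
    qed (simp add: norms)
    ultimately show ?thesis using Z(1) by (simp add: mu_R_level_iff)
  qed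
  have muC: "x \<in> mu_C_zero"
  proof -
    have "(\<Sum>i\<in>UNIV. col_row (snd x $ i) (fst x $ i)) = (\<Sum>i\<in>S. col_row (snd x $ i) (fst x $ i))"
      by (rule sum.mono_neutral_right) (auto simp: xC matrix2_eq_iff)
    moreover have "(\<Sum>i\<in>S. col_row (snd x $ i) (fst x $ i)) = 0"
    proof -
      have "(\<Sum>i\<in>S. v $ i $ 1) = 0" "(\<Sum>i\<in>S. v $ i $ 2) = 0"
        using Z(2) by (simp_all flip: sum_component)
      then have "(\<Sum>i\<in>S. Complex (v $ i $ 1) (- v $ i $ 2)) = 0"
        by (simp add: complex_eq_iff sum_negf)
      then show ?thesis by (simp add: matrix2_eq_iff sum_component xS ab)
    qed
    moreover have "row_col (fst x $ i) (snd x $ i) = 0" for i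
      by (cases "i \<in> S") (simp_all add: xS xC row_col_2)
    ultimately show ?thesis by (simp add: mu_C_zero_iff)
  qed
  have "x \<in> core_points \<alpha> S"
    unfolding core_points_iff stable_points_def
    using level_imp_stable[OF gen pos lev muC] muC by (simp add: xS xC wedge_def)
  then have "x \<in> core_level \<alpha> S" using lev by (simp add: core_level_def)
  moreover have "to_vectors S x = (v, l *\<^sub>R axis 3 1)"
  proof -
    have "2 *\<^sub>R pauli (col_row (snd x $ i) (fst x $ i)) = v $ i" if "i \<in> S" for i
      using that by (simp add: vec3_eq_iff pauli_nth xS ab v3)
    then show ?thesis by (simp add: to_vectors_def w vec_eq_iff[where 'b='n] xC h)
  qed
  ultimately show ?thesis using that by blast
qed

lemma to_vectors_image:
  fixes \<alpha> :: "'n::finite \<Rightarrow> real"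
  assumes pos: "\<And>i. \<alpha> i > 0" and gen: "generic \<alpha>" and S: "S \<noteq> {}"
  shows "to_vectors S ` core_level \<alpha> S = vector_configs \<alpha> S"
proof
  show "to_vectors S ` core_level \<alpha> S \<subseteq> vector_configs \<alpha> S" using to_vectors_in_configs S by blast
  show "vector_configs \<alpha> S \<subseteq> to_vectors S ` core_level \<alpha> S"
  proof
    fix z assume z: "z \<in> vector_configs \<alpha> S"
    let ?w = "snd z"
    have "norm ?w = (\<Sum>i\<in>S. sqrt ((\<alpha> i)\<^sup>2 + (norm (fst z $ i))\<^sup>2))" using z by (auto simp: vector_configs_def)
    also have "\<dots> > 0" using S by (intro sum_pos) (auto intro!: add_pos_nonneg zero_less_power pos)
    finally have w: "norm ?w > 0" .
    then have "norm (inverse (norm ?w) *\<^sub>R ?w) = 1" by simp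
    then obtain A where A: "A \<in> SU2" "spin_matrix A *v axis 3 1 = inverse (norm ?w) *\<^sub>R ?w"
      by (rule spin_matrix_to_axis)
    let ?R = "transpose (spin_matrix A)"
    note rot = rotation_spin_matrix[OF A(1)]
    have "?w = norm ?w *\<^sub>R (spin_matrix A *v axis 3 1)" using w by (simp add: A(2))
    then have "?R *v ?w = norm ?w *\<^sub>R ((?R ** spin_matrix A) *v axis 3 1)"
      by (metis matrix_vector_mul_assoc matrix_vector_mult_scaleR)
    then have "?R *v ?w = norm ?w *\<^sub>R axis 3 1" by (simp add: rotation_transpose_cancel rot)
    then have "rotate_config ?R z = (fst (rotate_config ?R z), norm ?w *\<^sub>R axis 3 1)"
      by (simp add: rotate_config_def)
    moreover have "rotate_config ?R z \<in> vector_configs \<alpha> S"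
      by (intro vector_configs_rotate rotation_matrix_transpose rot z)
    ultimately obtain x where x: "x \<in> core_level \<alpha> S" "to_vectors S x = rotate_config ?R z"
      using to_vectors_surj_axis[OF pos gen _ w] by metis
    have "to_vectors S (act A (\<chi> i. 1) x) = rotate_config (spin_matrix A) (rotate_config ?R z)"
      using A(1) by (simp add: to_vectors_act x)
    also have "\<dots> = z" by (simp add: rotate_config_mult rotation_transpose_cancel rot rotate_config_1)
    finally show "z \<in> to_vectors S ` core_level \<alpha> S"
      using core_level_act[OF x(1) A(1), of "\<chi> i. 1"] by force
  qed
qed

lemma rotation_orbit_to_vectors_eq_iff:
  assumes x: "x \<in> core_level \<alpha> S" and y: "y \<in> core_level \<alpha> S"
  shows "rotation_orbit (to_vectors S x) = rotation_orbit (to_vectors S y) \<longleftrightarrow> K_orbit x = K_orbit y"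
proof
  assume "K_orbit x = K_orbit y"
  then obtain A e where "A \<in> SU2" "\<forall>i. cmod (e $ i) = 1" "x = act A e y"
    unfolding K_orbit_eq_iff by (auto simp: K_orbit_def)
  then have "to_vectors S x \<in> rotation_orbit (to_vectors S y)"
    unfolding rotation_orbit_eq using to_vectors_act rotation_spin_matrix by blast
  then show "rotation_orbit (to_vectors S x) = rotation_orbit (to_vectors S y)" by (simp add: rotation_orbit_eq_iff)
next
  assume "rotation_orbit (to_vectors S x) = rotation_orbit (to_vectors S y)"
  then obtain R where R: "rotation_matrix R" "to_vectors S x = rotate_config R (to_vectors S y)"
    unfolding rotation_orbit_eq_iff by (auto simp: rotation_orbit_eq)
  obtain A where A: "A \<in> SU2" "spin_matrix A = R" using spin_matrix_surj[OF R(1)] .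
  define y' where "y' = act A (\<chi> i. 1) y"
  have "y' \<in> core_level \<alpha> S" unfolding y'_def by (rule core_level_act[OF y A(1)]) simp
  moreover have "to_vectors S y' = to_vectors S x" by (simp add: y'_def to_vectors_act A R)
  ultimately have "x \<in> K_orbit y'" using to_vectors_inj x by blast
  moreover have "y' \<in> K_orbit y" unfolding y'_def by (rule K_orbitI[OF A(1)]) simp
  ultimately show "K_orbit x = K_orbit y" unfolding K_orbit_eq_iff by (rule K_orbit_trans[rotated])
qed


section \<open>Comparison of the quotients\<close>

lemma homeomorphic_quotients:
  assumes f: "quotient_map X Y f" and g: "quotient_map X Z g"
    and same: "\<And>x y. x \<in> topspace X \<Longrightarrow> y \<in> topspace X \<Longrightarrow> f x = f y \<longleftrightarrow> g x = g y"
  shows "Y homeomorphic_space Z"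
proof -
  obtain h where h: "continuous_map Y Z h" "\<And>x. x \<in> topspace X \<Longrightarrow> h (f x) = g x"
    using quotient_map_lift_exists[OF f quotient_imp_continuous_map[OF g]] same by metis
  obtain k where k: "continuous_map Z Y k" "\<And>x. x \<in> topspace X \<Longrightarrow> k (g x) = f x"
    using quotient_map_lift_exists[OF g quotient_imp_continuous_map[OF f]] same by metis
  have "topspace Y = f ` topspace X" "topspace Z = g ` topspace X"
    using quotient_imp_surjective_map[OF f] quotient_imp_surjective_map[OF g] by simp_all
  then have "homeomorphic_maps Y Z h k"
    using h k by (auto simp: homeomorphic_maps_def)
  then show ?thesis by (auto simp: homeomorphic_space_def)
qed

lemma continuous_on_col_row:
  assumes "\<And>a. continuous_on X (\<lambda>x. q x $ a)" "\<And>a. continuous_on X (\<lambda>x. p x $ a)"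
  shows "continuous_on X (\<lambda>x. col_row (q x) (p x))"
  by (intro continuous_on_vecI) (simp add: continuous_intros assms)

lemma continuous_on_pauli:
  assumes "continuous_on X f"
  shows "continuous_on X (\<lambda>x. pauli (f x))"
proof -
  have "continuous_on UNIV pauli" using linear_pauli by (intro linear_continuous_on) (simp add: linear_conv_bounded_linear)
  then show ?thesis using continuous_on_compose2[OF _ assms] by blast
qed

lemma continuous_on_hopf:
  assumes "\<And>a. continuous_on X (\<lambda>x. q x $ a)"
  shows "continuous_on X (\<lambda>x. hopf (q x))"
  unfolding hopf_def by (intro continuous_on_pauli continuous_on_col_row assms) (simp add: continuous_intros assms)

lemma continuous_on_moment:
  "continuous_on X (\<lambda>x :: 'n::finite point. moment (fst x $ i) (snd x $ i))"
  unfolding moment_hopf by (intro continuous_on_diff continuous_on_hopf) (simp_all, (intro continuous_intros)+)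

lemma continuous_on_to_vectors: "continuous_on X (to_vectors S)"
proof -
  have "continuous_on X (\<lambda>x. if i \<in> S then 2 *\<^sub>R pauli (col_row (snd x $ i) (fst x $ i)) else hopf (snd x $ i))" for i
    by (cases "i \<in> S"; simp; intro continuous_intros continuous_on_pauli continuous_on_hopf continuous_on_col_row)
  then have "continuous_on X (\<lambda>x. \<chi> i. if i \<in> S then 2 *\<^sub>R pauli (col_row (snd x $ i) (fst x $ i)) else hopf (snd x $ i))"
    by (rule continuous_on_vec_lambda)
  then show ?thesis
    unfolding to_vectors_def[abs_def] by (intro continuous_on_Pair continuous_on_sum continuous_on_moment)
qed

lemma core_level_eq:
  assumes gen: "generic \<alpha>" and pos: "\<And>i. \<alpha> i > 0"
  shows "core_level \<alpha> S = mu_R_level \<alpha> \<inter> mu_C_zero \<inter>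
     {x. (\<forall>i\<in>S. \<forall>j\<in>S. wedge (snd x $ i) (snd x $ j) = 0) \<and> (\<forall>j\<in>-S. fst x $ j = 0)}"
  using level_imp_stable[OF gen pos] by (auto simp: core_level_def core_points_iff stable_points_def)

lemma closed_core_conditions:
  "closed {x :: 'n::finite point. (\<forall>i\<in>S. \<forall>j\<in>S. wedge (snd x $ i) (snd x $ j) = 0) \<and> (\<forall>j\<in>-S. fst x $ j = 0)}"
proof -
  have "{x :: 'n point. (\<forall>i\<in>S. \<forall>j\<in>S. wedge (snd x $ i) (snd x $ j) = 0) \<and> (\<forall>j\<in>-S. fst x $ j = 0)}
     = (\<Inter>i\<in>S. \<Inter>j\<in>S. {x. wedge (snd x $ i) (snd x $ j) = 0}) \<inter> (\<Inter>j\<in>-S. {x. fst x $ j = 0})"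
    by auto
  also have "closed \<dots>" unfolding wedge_def
    by (intro closed_Int closed_INT ballI closed_Collect_eq continuous_intros)
  finally show ?thesis .
qed

lemma closed_level:
  fixes \<alpha> :: "'n::finite \<Rightarrow> real"
  shows "closed (mu_R_level \<alpha> \<inter> mu_C_zero)"
proof -
  have R: "mu_R_level \<alpha> = {x. (\<Sum>i\<in>UNIV. moment (fst x $ i) (snd x $ i)) = 0} \<inter>
      (\<Inter>i. {x. (norm (snd x $ i))\<^sup>2 - (norm (fst x $ i))\<^sup>2 = 2 * \<alpha> i})"
    by (auto simp: mu_R_level_iff)
  have C: "(mu_C_zero :: 'n point set) = {x. (\<Sum>i\<in>UNIV. col_row (snd x $ i) (fst x $ i)) = 0} \<inter>
      (\<Inter>i. {x :: 'n point. row_col (fst x $ i) (snd x $ i) = 0})"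
    by (auto simp: mu_C_zero_iff)
  have cont: "continuous_on UNIV (\<lambda>x :: 'n point. col_row (snd x $ i) (fst x $ i))" for i
    by (intro continuous_on_col_row continuous_intros)
  show ?thesis
    unfolding R C row_col_2 by (intro closed_Int closed_INT ballI closed_Collect_eq continuous_intros continuous_on_moment cont)
qed

text \<open>
  Boundedness: half the sum of all squared norms over \<open>S\<close> is \<open>|w|\<close>, and \<open>w\<close> is balanced by the
  vectors \<open>v\<^sub>j\<close> of fixed lengths.
\<close>

lemma compact_core_level:
  fixes \<alpha> :: "'n::finite \<Rightarrow> real"
  assumes gen: "generic \<alpha>" and pos: "\<And>i. \<alpha> i > 0" and S: "S \<noteq> {}"
  shows "compact (core_level \<alpha> S)"
proof -
  have "closed (core_level \<alpha> S)"
    unfolding core_level_eq[OF gen pos] by (intro closed_Int closed_level closed_core_conditions)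
  moreover have "bounded (core_level \<alpha> S)"
  proof -
    define M where "M = 2 * sum \<alpha> UNIV"
    have "(norm (snd x $ i))\<^sup>2 \<le> M \<and> (norm (fst x $ i))\<^sup>2 \<le> M" if x: "x \<in> core_level \<alpha> S" for x i
    proof (cases "i \<in> S")
      case False
      have "\<alpha> i \<le> sum \<alpha> UNIV" using pos by (intro member_le_sum) (auto simp: less_imp_le)
      moreover have "(norm (snd x $ i))\<^sup>2 = 2 * \<alpha> i" using core_level_D(5)[OF x, of i] core_level_D(3)[OF x False] by simp
      ultimately show ?thesis using core_level_D(3)[OF x False] pos[of i] by (simp add: M_def)
    next
      case True
      let ?w = "snd (to_vectors S x)" and ?v = "fst (to_vectors S x)"
      have z: "to_vectors S x \<in> vector_configs \<alpha> S" by (rule to_vectors_in_configs[OF x S])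
      then have "?w = - (\<Sum>j\<in>-S. ?v $ j)" "\<forall>j\<in>-S. norm (?v $ j) = \<alpha> j"
        by (auto simp: vector_configs_def split_beta eq_neg_iff_add_eq_0)
      then have "norm ?w \<le> (\<Sum>j\<in>-S. \<alpha> j)"
        using norm_sum[of "\<lambda>j. ?v $ j" "- S"] sum.cong[OF refl, of "- S" "\<lambda>j. norm (?v $ j)" \<alpha>] by simp
      also have "\<dots> \<le> sum \<alpha> UNIV" using pos by (intro sum_mono2) (auto simp: less_imp_le)
      finally have w: "norm ?w \<le> sum \<alpha> UNIV" .
      have "norm ?w = (\<Sum>i\<in>S. ((norm (snd x $ i))\<^sup>2 + (norm (fst x $ i))\<^sup>2) / 2)"
        by (rule core_moment_sum[OF x True])
      moreover have "((norm (snd x $ i))\<^sup>2 + (norm (fst x $ i))\<^sup>2) / 2 \<le> (\<Sum>i\<in>S. ((norm (snd x $ i))\<^sup>2 + (norm (fst x $ i))\<^sup>2) / 2)"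
        using True by (intro member_le_sum) auto
      ultimately have "((norm (snd x $ i))\<^sup>2 + (norm (fst x $ i))\<^sup>2) / 2 \<le> norm ?w" by (simp only:)
      then have "((norm (snd x $ i))\<^sup>2 + (norm (fst x $ i))\<^sup>2) / 2 \<le> sum \<alpha> UNIV" using w by (rule order_trans)
      then have "(norm (snd x $ i))\<^sup>2 + (norm (fst x $ i))\<^sup>2 \<le> M" by (simp add: M_def)
      then show ?thesis using zero_le_power2[of "norm (snd x $ i)"] zero_le_power2[of "norm (fst x $ i)"] by linarith
    qed
    then have le: "norm (snd x $ i) \<le> sqrt M \<and> norm (fst x $ i) \<le> sqrt M" if "x \<in> core_level \<alpha> S" for x i
      using that real_le_rsqrt by blast
    have "norm x \<le> CARD('n) * sqrt M + CARD('n) * sqrt M" if x: "x \<in> core_level \<alpha> S" for x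
    proof -
      have "norm v \<le> CARD('n) * sqrt M" if "\<And>i. norm (v $ i) \<le> sqrt M" for v :: "complex ^ 2 ^ 'n"
      proof -
        have "norm v \<le> (\<Sum>i\<in>UNIV. norm (v $ i))" unfolding norm_vec_def by (rule L2_set_le_sum) simp
        also have "\<dots> \<le> (\<Sum>i\<in>(UNIV :: 'n set). sqrt M)" by (intro sum_mono that)
        finally show ?thesis by simp
      qed
      then have "norm (fst x) \<le> CARD('n) * sqrt M" "norm (snd x) \<le> CARD('n) * sqrt M" using le[OF x] by blast+
      moreover have "norm x \<le> norm (fst x) + norm (snd x)" using norm_Pair_le[of "fst x" "snd x"] by simp
      ultimately show ?thesis by linarith
    qed
    then show ?thesis unfolding bounded_iff by blast
  qed
  ultimately show ?thesis by (simp add: compact_eq_bounded_closed)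
qed

lemma quotient_map_to_moduli:
  fixes \<alpha> :: "'n::finite \<Rightarrow> real"
  assumes gen: "generic \<alpha>" and pos: "\<And>i. \<alpha> i > 0" and S: "S \<noteq> {}"
  shows "quotient_map (top_of_set (core_level \<alpha> S)) (vector_moduli \<alpha> S) (rotation_orbit \<circ> to_vectors S)"
proof (rule quotient_map_compose)
  show "quotient_map (top_of_set (core_level \<alpha> S)) (top_of_set (vector_configs \<alpha> S)) (to_vectors S)"
  proof (rule continuous_imp_quotient_map)
    show "continuous_map (top_of_set (core_level \<alpha> S)) (top_of_set (vector_configs \<alpha> S)) (to_vectors S)"
      using to_vectors_in_configs[OF _ S] by (auto simp: continuous_on_to_vectors)
    show "compact_space (top_of_set (core_level \<alpha> S))"
      using compact_core_level[OF gen pos S] by (simp add: compact_space_subtopology)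
    show "Hausdorff_space (top_of_set (vector_configs \<alpha> S))" by (simp add: Hausdorff_space_subtopology)
    show "to_vectors S ` topspace (top_of_set (core_level \<alpha> S)) = topspace (top_of_set (vector_configs \<alpha> S))"
      using to_vectors_image[OF pos gen S] by simp
  qed
  show "quotient_map (top_of_set (vector_configs \<alpha> S)) (vector_moduli \<alpha> S) rotation_orbit"
    unfolding vector_moduli_def by (rule quotient_map_quotient_topology)
qed

lemma U_core_K_eq:
  fixes \<alpha> :: "'n::finite \<Rightarrow> real"
  assumes pos: "\<And>i. \<alpha> i > 0" and S: "short \<alpha> S" "card S \<ge> 2"
  shows "U_core_K \<alpha> S = K_orbit ` core_level \<alpha> S"
  by (auto simp: U_core_K_def U_core_eq[OF pos S] G_orbit_mem_image_core core_level_def)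
     (auto simp: core_points_def stable_points_def)

lemma quotient_map_K_orbit:
  fixes \<alpha> :: "'n::finite \<Rightarrow> real"
  assumes gen: "generic \<alpha>" and pos: "\<And>i. \<alpha> i > 0" and S: "short \<alpha> S" "card S \<ge> 2"
  shows "quotient_map (top_of_set (core_level \<alpha> S))
           (subtopology (hyperpolygon_space_K \<alpha>) (U_core_K \<alpha> S)) K_orbit"
proof -
  let ?L = "mu_R_level \<alpha> \<inter> mu_C_zero"
  have q: "quotient_map (top_of_set ?L) (hyperpolygon_space_K \<alpha>) K_orbit"
    unfolding hyperpolygon_space_K_def by (rule quotient_map_quotient_topology)
  have sub: "core_level \<alpha> S \<subseteq> ?L" by (auto simp: core_level_eq[OF gen pos])
  have pre: "{x \<in> topspace (top_of_set ?L). K_orbit x \<in> U_core_K \<alpha> S} = core_level \<alpha> S"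
  proof -
    have "x \<in> core_level \<alpha> S" if x: "x \<in> ?L" "y \<in> core_level \<alpha> S" "K_orbit x = K_orbit y" for x y
    proof -
      have "x \<in> G_orbit y" using x(3) K_orbit_subset_G_orbit unfolding K_orbit_eq_iff by blast
      moreover have "y \<in> core_points \<alpha> S" using x(2) by (simp add: core_level_def)
      ultimately have "x \<in> core_points \<alpha> S" using core_points_G_orbit by blast
      then show ?thesis using x(1) by (simp add: core_level_def)
    qed
    then show ?thesis unfolding U_core_K_eq[OF pos S] using sub by auto
  qed
  have cl: "closedin (top_of_set ?L) (core_level \<alpha> S)"
    using sub compact_core_level[OF gen pos, of S] S(2) by (intro closed_subset compact_imp_closed) fastforce+
  have "U_core_K \<alpha> S \<subseteq> topspace (hyperpolygon_space_K \<alpha>)"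
    using quotient_imp_surjective_map[OF q] sub unfolding U_core_K_eq[OF pos S] by auto
  from q[unfolded quotient_map_closedin, THEN conjunct2, rule_format, OF this]
  have "closedin (hyperpolygon_space_K \<alpha>) (U_core_K \<alpha> S)"
    unfolding pre using cl by (rule iffD1)
  then have "quotient_map (subtopology (top_of_set ?L) (core_level \<alpha> S)) (subtopology (hyperpolygon_space_K \<alpha>) (U_core_K \<alpha> S)) K_orbit"
    by (intro quotient_map_restriction[OF q pre]) simp
  moreover have "subtopology (top_of_set ?L) (core_level \<alpha> S) = top_of_set (core_level \<alpha> S)"
    using sub by (simp add: subtopology_subtopology inf.absorb2)
  ultimately show ?thesis by simp
qed

text \<open>
  A limit of points whose orbits meet the compact set \<open>C\<close> is in the orbit of a limit of points of \<open>C\<close>.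
\<close>

lemma closed_map_G_orbit_core_level:
  fixes \<alpha> :: "'n::finite \<Rightarrow> real"
  assumes gen: "generic \<alpha>" and pos: "\<And>i. \<alpha> i > 0" and S: "S \<noteq> {}"
    and C: "closedin (top_of_set (core_level \<alpha> S)) C"
  shows "closedin (hyperpolygon_space \<alpha>) (G_orbit ` C)"
proof -
  have CL: "C \<subseteq> core_level \<alpha> S" using C closedin_subset by fastforce
  have cC: "compact C" using C compact_core_level[OF gen pos S] by (rule closedin_compact[rotated])
  have Cst: "C \<subseteq> stable_points \<alpha>" using CL by (auto simp: core_level_def core_points_def)
  have "closedin (top_of_set (stable_points \<alpha>)) {x \<in> stable_points \<alpha>. G_orbit x \<in> G_orbit ` C}"
    unfolding closedin_limpt islimpt_sequential
  proof (intro conjI allI impI)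
    fix y0 :: "'n point"
    assume "(\<exists>y. (\<forall>k. y k \<in> {x \<in> stable_points \<alpha>. G_orbit x \<in> G_orbit ` C} - {y0}) \<and> y \<longlonglongrightarrow> y0) \<and> y0 \<in> stable_points \<alpha>"
    then obtain y where y: "\<And>k. G_orbit (y k) \<in> G_orbit ` C" "y0 \<in> stable_points \<alpha>" "y \<longlonglongrightarrow> y0" by auto
    have "\<exists>x\<in>C. y k \<in> G_orbit x" for k using y(1)[of k] by (auto simp: G_orbit_eq_iff)
    then obtain x where x: "\<And>k. x k \<in> C" "\<And>k. y k \<in> G_orbit (x k)" by metis
    obtain x0 f where f: "x0 \<in> C" "strict_mono f" "(x \<circ> f) \<longlonglongrightarrow> x0"
      using compact_imp_seq_compact[OF cC] x(1) by (metis seq_compactE)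
    have "(y \<circ> f) \<longlonglongrightarrow> y0" by (rule LIMSEQ_subseq_LIMSEQ[OF y(3) f(2)])
    then have "y0 \<in> G_orbit x0"
      by (intro G_orbit_limit[OF pos f(3) _ _ y(2)]) (use f(1) Cst x(2) in auto)
    then show "y0 \<in> {x \<in> stable_points \<alpha>. G_orbit x \<in> G_orbit ` C}"
      using y(2) f(1) G_orbit_eq_iff by blast
  qed auto
  moreover have "G_orbit ` C \<subseteq> topspace (hyperpolygon_space \<alpha>)"
    using Cst by (auto simp: topspace_hyperpolygon_space)
  ultimately show ?thesis
    using quotient_map_G_orbit[of \<alpha>, unfolded quotient_map_closedin, THEN conjunct2, rule_format, of "G_orbit ` C"]
    by simp
qed

lemma quotient_map_G_orbit_core_level:
  fixes \<alpha> :: "'n::finite \<Rightarrow> real"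
  assumes gen: "generic \<alpha>" and pos: "\<And>i. \<alpha> i > 0" and S: "short \<alpha> S" "card S \<ge> 2"
  shows "quotient_map (top_of_set (core_level \<alpha> S)) (subtopology (hyperpolygon_space \<alpha>) (U_core \<alpha> S)) G_orbit"
proof -
  have Sn: "S \<noteq> {}" using S(2) by auto
  have U: "U_core \<alpha> S = G_orbit ` core_level \<alpha> S"
  proof -
    have "\<exists>y\<in>core_level \<alpha> S. G_orbit x = G_orbit y" if x: "x \<in> core_points \<alpha> S" for x
    proof -
      have "x \<in> stable_points \<alpha>" using x by (simp add: core_points_def)
      then obtain y where y: "y \<in> G_orbit x" "y \<in> mu_R_level \<alpha>" using stable_orbit_meets_level[where \<alpha> = \<alpha>, OF pos] by metis
      then have "y \<in> core_level \<alpha> S" using core_points_G_orbit[OF x] by (simp add: core_level_def)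
      moreover have "G_orbit x = G_orbit y" using y(1) G_orbit_eq_iff by blast
      ultimately show ?thesis by blast
    qed
    then show ?thesis unfolding U_core_eq[OF pos S] by (auto simp: core_level_def) blast
  qed
  have st: "core_level \<alpha> S \<subseteq> stable_points \<alpha>" by (auto simp: core_level_def core_points_def)
  have top: "topspace (subtopology (hyperpolygon_space \<alpha>) (U_core \<alpha> S)) = G_orbit ` core_level \<alpha> S"
    using st by (auto simp: U topspace_hyperpolygon_space)
  show ?thesis
  proof (rule continuous_closed_imp_quotient_map)
    have "continuous_map (top_of_set (core_level \<alpha> S)) (hyperpolygon_space \<alpha>) G_orbit"
      using continuous_map_from_subtopology_mono[OF quotient_imp_continuous_map[OF quotient_map_G_orbit] st] .
    then show "continuous_map (top_of_set (core_level \<alpha> S)) (subtopology (hyperpolygon_space \<alpha>) (U_core \<alpha> S)) G_orbit"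
      by (rule continuous_map_into_subtopology) (auto simp: U)
    show "closed_map (top_of_set (core_level \<alpha> S)) (subtopology (hyperpolygon_space \<alpha>) (U_core \<alpha> S)) G_orbit"
      unfolding closed_map_def
    proof (intro allI impI)
      fix C assume C: "closedin (top_of_set (core_level \<alpha> S)) C"
      then have "C \<subseteq> core_level \<alpha> S" using closedin_subset by fastforce
      then have "G_orbit ` C \<subseteq> U_core \<alpha> S" by (auto simp: U)
      then show "closedin (subtopology (hyperpolygon_space \<alpha>) (U_core \<alpha> S)) (G_orbit ` C)"
        by (intro closedin_subset_topspace closed_map_G_orbit_core_level[OF gen pos Sn C])
    qed
    show "G_orbit ` topspace (top_of_set (core_level \<alpha> S)) = topspace (subtopology (hyperpolygon_space \<alpha>) (U_core \<alpha> S))"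
      unfolding top by simp
  qed
qed

lemma G_orbit_eq_iff_K_orbit_eq:
  assumes x: "x \<in> core_level \<alpha> S" and y: "y \<in> core_level \<alpha> S"
  shows "G_orbit x = G_orbit y \<longleftrightarrow> K_orbit x = K_orbit y"
proof
  assume "G_orbit x = G_orbit y"
  then show "K_orbit x = K_orbit y"
    using level_G_orbit_imp_K_orbit x y unfolding G_orbit_eq_iff K_orbit_eq_iff core_level_def by blast
next
  assume "K_orbit x = K_orbit y"
  then show "G_orbit x = G_orbit y"
    using K_orbit_subset_G_orbit unfolding G_orbit_eq_iff K_orbit_eq_iff by blast
qed

theorem theorem2p5:
  fixes \<alpha> :: "'n::finite \<Rightarrow> real" and S :: "'n set"
  assumes "CARD('n) \<ge> 3"
    and "\<And>i. \<alpha> i > 0"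
    and "generic \<alpha>"
    and "short \<alpha> S"
    and "card S \<ge> 2"
  shows "subtopology (hyperpolygon_space \<alpha>) (U_core \<alpha> S) homeomorphic_space vector_moduli \<alpha> S \<and>
         subtopology (hyperpolygon_space_K \<alpha>) (U_core_K \<alpha> S) homeomorphic_space vector_moduli \<alpha> S"
proof
  note pos = assms(2) and gen = assms(3) and S = assms(4,5)
  have "S \<noteq> {}" using S(2) by auto
  note moduli = quotient_map_to_moduli[OF gen pos this]
  show "subtopology (hyperpolygon_space \<alpha>) (U_core \<alpha> S) homeomorphic_space vector_moduli \<alpha> S"
    by (rule homeomorphic_quotients[OF quotient_map_G_orbit_core_level[OF gen pos S] moduli])
       (simp add: rotation_orbit_to_vectors_eq_iff G_orbit_eq_iff_K_orbit_eq)
  show "subtopology (hyperpolygon_space_K \<alpha>) (U_core_K \<alpha> S) homeomorphic_space vector_moduli \<alpha> S"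
    by (rule homeomorphic_quotients[OF quotient_map_K_orbit[OF gen pos S] moduli])
       (simp add: rotation_orbit_to_vectors_eq_iff)
qed

end
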